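(* Let $m\in\{2,3\}$, let $p^0\in\mathcal P^0\subset\mathbb R^m$ and let $p_1,p_2,\ldots\in\mathcal P\subset\mathbb R^m$ be sensor positions. Let $\alpha>0$ be a known constant, $0<\sigma^2<\infty$, and let $$y_i=\log_{10}\|p_i-p^0\|+\omega_i,\qquad i=1,2,\dots,$$ where $\omega_1,\omega_2,\ldots$ are i.i.d. Gaussian random variables with mean $0$ and variance $\sigma^2/(100\alpha^2)$. Suppose: (a) $\mathcal P^0$ and $\mathcal P$ are compact, do not depend on $n$, and $\mathcal P^0\cap\mathcal P=\emptyset$. (b) The empirical distribution function of $p_1,\dots,p_n$ converges, as $n\to\infty$, to a distribution function $F_\mu$, which induces a probability measure $\mu$. (c) For every $n\ge m+1$, the points $p_1,\dots,p_n$ do not all lie on a line (if $m=2$) or on a plane (if $m=3$); and there is no subset $\mathcal P'\subset\mathcal P$ with $\mu(\mathcal P')=1$ that lies entirely on a line (if $m=2$) or on a plane (if $m=3$). Let $\widehat p_n^{\rm ML}$ be the maximum likelihood estimator, i.e. a minimizer over $p\in\mathbb R^m$ of $$\frac1n\sum_{i=1}^n\bigl(y_i-\log_{10}\|p_i-p\|\bigr)^2 .$$ Then $\widehat p_n^{\rm ML}\to p^0$ almost surely as $n\to\infty$, and $$\sqrt n\,\bigl(\widehat p_n^{\rm ML}-p^0\bigr)\to\mathcal N\!\left(0,\frac{\sigma^2}{100\alpha^2}(M^0)^{-1}\right)\quad\text{in distribution as } n\to\infty,$$ where $M^0=\lim_{n\to\infty}\frac1n\sum_{i=1}^n\nabla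 f_i(p^0)\nabla f_i(p^0)^T$ and $f_i(p)=\log_{10}\|p_i-p\|$.
   Context: $\|\cdot\|$ is the Euclidean norm. The empirical distribution of $p_1,\dots,p_n$ is $\frac1n\sum_{i=1}^n\delta_{p_i}$; convergence of distribution functions is in the usual sense (weak convergence). The gradient is the column vector $\nabla f_i(p)=\dfrac{p-p_i}{\|p_i-p\|^2\ln 10}$. Under the stated assumptions the limit $M^0$ exists and is a nonsingular $m\times m$ matrix. *)

theory Defs
  imports "HOL-Probability.Probability"
begin

text \<open>
  Distribution functions on \<open>real ^ 'n\<close> and their weak convergence, generalizing \<^const>\<open>cdf\<close> and
  \<^const>\<open>weak_conv\<close>. The order on \<open>real ^ 'n\<close> is componentwise, so \<open>{..x}\<close> is the lower orthant with
  corner \<open>x\<close>.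
\<close>

definition vec_cdf :: "(real ^ 'n) measure \<Rightarrow> real ^ 'n \<Rightarrow> real" where
  "vec_cdf M x = measure M {..x}"

definition vec_weak_conv :: "(nat \<Rightarrow> real ^ 'n \<Rightarrow> real) \<Rightarrow> (real ^ 'n \<Rightarrow> real) \<Rightarrow> bool" where
  "vec_weak_conv F_seq F \<longleftrightarrow> (\<forall>x. isCont F x \<longrightarrow> (\<lambda>n. F_seq n x) \<longlonglongrightarrow> F x)"

definition converges_in_distribution ::
    "'a measure \<Rightarrow> (nat \<Rightarrow> 'a \<Rightarrow> real ^ 'n) \<Rightarrow> (real ^ 'n) measure \<Rightarrow> bool" where
  "converges_in_distribution M Z N \<longleftrightarrow>
     vec_weak_conv (\<lambda>n. vec_cdf (distr M borel (Z n))) (vec_cdf N)"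

text \<open>
  The distribution function of the empirical distribution (the mean of the point masses at
  \<open>p 1, \<dots>, p n\<close>). Sequences of sensors and measurements are indexed from 1.
\<close>

definition empirical_cdf :: "(nat \<Rightarrow> real ^ 'n) \<Rightarrow> nat \<Rightarrow> real ^ 'n \<Rightarrow> real" where
  "empirical_cdf p n x = (1 / real n) * (\<Sum>i=1..n. indicator {..x} (p i))"

text \<open>
  The normal distribution with mean \<open>\<mu>\<close> and covariance matrix \<open>S\<close>, given by its density; this is
  meaningful for symmetric positive definite \<open>S\<close>.
\<close>

definition mv_normal_density :: "real ^ 'n \<Rightarrow> real ^ 'n ^ 'n \<Rightarrow> real ^ 'n \<Rightarrow> real" where
  "mv_normal_density \<mu> S x =
     exp (- ((x - \<mu>) \<bullet> (matrix_inv S *v (x - \<mu>))) / 2) / sqrt ((2 * pi) ^ CARD('n) * det S)"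

definition mv_normal :: "real ^ 'n \<Rightarrow> real ^ 'n ^ 'n \<Rightarrow> (real ^ 'n) measure" where
  "mv_normal \<mu> S = density lborel (\<lambda>x. ennreal (mv_normal_density \<mu> S x))"

definition on_line_or_plane :: "(real ^ 'm) set \<Rightarrow> bool" where
  "on_line_or_plane S \<longleftrightarrow> (CARD('m) = 2 \<and> collinear S) \<or> (CARD('m) = 3 \<and> coplanar S)"

definition log_dist :: "real ^ 'm \<Rightarrow> real ^ 'm \<Rightarrow> real" where
  "log_dist s q = log 10 (norm (s - q))"

text \<open>The gradient of \<open>log_dist s\<close> at \<open>q \<noteq> s\<close>.\<close>

definition grad_log_dist :: "real ^ 'm \<Rightarrow> real ^ 'm \<Rightarrow> real ^ 'm" where
  "grad_log_dist s q = (1 / ((norm (s - q))\<^sup>2 * ln 10)) *\<^sub>R (q - s)"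

lemma has_derivative_log_dist:
  assumes "q \<noteq> s"
  shows "(log_dist s has_derivative (\<lambda>h. grad_log_dist s q \<bullet> h)) (at q)"
proof -
  have n: "norm (s - q) > 0" "s - q \<noteq> 0" using assms by auto
  have norm: "((\<lambda>q. norm (s - q)) has_derivative (\<lambda>h. (0 - h) \<bullet> sgn (s - q))) (at q)"
  proof (rule has_derivative_compose[of "\<lambda>q. s - q" _ _ _ norm "\<lambda>h. h \<bullet> sgn (s - q)"])
    show "((\<lambda>q. s - q) has_derivative (\<lambda>h. 0 - h)) (at q)"
      by (intro has_derivative_diff has_derivative_const has_derivative_ident)
  qed (rule has_derivative_norm[OF n(2)])
  have "((\<lambda>q. ln (norm (s - q)) / ln 10) has_derivative
         (\<lambda>h. ((sgn (s - q) \<bullet> (0 - h)) * inverse (norm (s - q))) / ln 10)) (at q)"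
    by (rule derivative_eq_intros norm n refl)+
       (use n in \<open>auto simp: inner_commute divide_inverse\<close>)
  moreover have "((sgn (s - q) \<bullet> (0 - h)) * inverse (norm (s - q))) / ln 10
                   = grad_log_dist s q \<bullet> h" for h
    by (simp add: grad_log_dist_def sgn_div_norm power2_eq_square divide_simps inner_diff_left)
  ultimately show ?thesis
    unfolding log_dist_def log_def by simp
qed

text \<open>
  Since \<^term>\<open>ln (0::real) = 0\<close>, the real-valued \<open>log_dist s\<close> has the wrong value at \<open>s\<close>. The least
  squares cost is minimized over all of \<open>real ^ 'm\<close>, so it uses \<open>log\<^sub>1\<^sub>0 0 = -\<infinity>\<close> and has the value \<open>\<infinity>\<close>
  at each sensor position.
\<close>

definition elog_dist :: "real ^ 'm \<Rightarrow> real ^ 'm \<Rightarrow> ereal" where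
  "elog_dist s q = (if q = s then -\<infinity> else ereal (log_dist s q))"

definition ls_cost :: "(nat \<Rightarrow> real ^ 'm) \<Rightarrow> (nat \<Rightarrow> real) \<Rightarrow> nat \<Rightarrow> real ^ 'm \<Rightarrow> ereal" where
  "ls_cost p y n q = ereal (1 / real n) * (\<Sum>i=1..n. (ereal (y i) - elog_dist (p i) q)\<^sup>2)"

definition is_ML_estimate ::
    "(nat \<Rightarrow> real ^ 'm) \<Rightarrow> (nat \<Rightarrow> real) \<Rightarrow> nat \<Rightarrow> real ^ 'm \<Rightarrow> bool" where
  "is_ML_estimate p y n q \<longleftrightarrow> is_arg_min (ls_cost p y n) (\<lambda>_. True) q"

definition outer_product :: "real ^ 'm \<Rightarrow> real ^ 'm ^ 'm" where
  "outer_product v = (columnvector v :: real ^ 1 ^ 'm) ** transpose (columnvector v)"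

definition info_matrix :: "(nat \<Rightarrow> real ^ 'm) \<Rightarrow> real ^ 'm \<Rightarrow> nat \<Rightarrow> real ^ 'm ^ 'm" where
  "info_matrix p q n = (1 / real n) *\<^sub>R (\<Sum>i=1..n. outer_product (grad_log_dist (p i) q))"

end

theory Submission
  imports Defs
begin

text \<open>
  Consistency. Comparing the cost at the estimate and at \<open>p0\<close> gives a basic inequality for the differences
  \<open>log_dist s q - log_dist s p0\<close>. Clamping these to \<open>[-T, T]\<close> only costs a mean of \<open>w ^ 4 / T\<^sup>2\<close>, and
  the clamped differences are uniformly Lipschitz in \<open>q\<close> and constant far away; so the strong law for countably
  many \<open>q\<close> yields a uniform one. The mean square of the differences clamped to \<open>[-1, 1]\<close> then tends
  to \<open>0\<close> at the estimate, while it stays away from \<open>0\<close> off \<open>p0\<close>, since points with the same distance to \<open>q\<close> and \<open>p0\<close> lie on a hyperplane.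

  Asymptotic normality. Expanding the first-order condition at \<open>p0\<close> shows that \<open>sqrt n *\<^sub>R (phat - p0)\<close>
  differs from a linear combination \<open>W\<close> of the noise variables by \<open>o(1 + norm W)\<close>. No central limit theorem
  is needed: after adding a small independent normal vector, \<open>W\<close> has a normal density, found by
  rank-one updates of the covariance matrix, and these densities converge dominatedly.
\<close>

section \<open>Rank-one updates of matrices\<close>

text \<open>The cost has a pole at every sensor, the noise is unbounded and the estimate ranges over
  the whole space, so the raw differences offer neither compactness nor a Lipschitz bound. Clamping
  supplies both, and its price \<open>w ^ 4 / T\<^sup>2\<close> is why fourth moments govern the
  argument. Consistency and linearization are proved for a fixed outcome; probability enters through
  countably many laws of large numbers. The hypothesis on lines and planes is used twice: to
  separate \<open>p0\<close> from other points and to make the limiting information matrix positive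
  definite. Weak convergence is given only at continuity points of distribution functions, so
  convergence of averages of continuous functions has to be built first. Smoothing is there because
  \<open>W\<close> lives on a proper subspace while the gradients do not span, and then has no
  density; the smoothing variance can tend to 0 because the limiting covariance is nonsingular. The
  error \<open>o(1 + norm W)\<close> suffices because the second moments of \<open>W\<close> stay
  bounded.\<close>

lemma outer_product_component: "outer_product v $ i $ j = v $ i * v $ j"
  by (simp add: outer_product_def columnvector_def matrix_matrix_mult_def transpose_def)

lemma outer_product_mult_vec: "outer_product v *v x = (v \<bullet> x) *\<^sub>R v"
  by (simp add: vec_eq_iff matrix_vector_mult_def outer_product_component inner_vec_def
      sum_distrib_right sum_distrib_left mult_ac)

lemma transpose_outer_product [simp]: "transpose (outer_product v) = outer_product v"
  by (simp add: vec_eq_iff transpose_def outer_product_component mult.commute)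

lemma transpose_add: "transpose (A + B) = transpose A + transpose B"
  by (simp add: vec_eq_iff transpose_def)

text \<open>Row \<open>k\<close> is \<open>v\<close>, so subtracting \<open>u $ i\<close> times it
  from each row \<open>i\<close> in \<open>T\<close> restores the unit vector without changing the
  determinant. What remains is the identity with row \<open>k\<close> replaced by
  \<open>v\<close>.\<close>

lemma det_mat_1_plus_rank_one_aux:
  fixes u v :: "real ^ 'n"
  assumes "finite T" "k \<notin> T"
  shows "det (\<chi> i. if i = k then v else if i \<in> T then axis i 1 + u $ i *s v else axis i 1) = v $ k"
  using assms
proof (induction T rule: finite_induct)
  case empty
  \<comment> \<open>\<open>v\<close> as a combination of the rows of the identity, the shape that
    \<open>cramer_lemma_transpose\<close> expects.\<close>
  let ?x = "(\<Sum>j\<in>UNIV. v $ j *s row j (mat 1 :: real^'n^'n))"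
  have "?x = v"
    by (simp add: vec_eq_iff row_def mat_def if_distrib cong: if_cong)
  moreover have "row i (mat 1 :: real^'n^'n) = axis i 1" for i
    by (simp add: vec_eq_iff row_def mat_def axis_def)
  ultimately show ?case
    using cramer_lemma_transpose[of k v "mat 1 :: real^'n^'n"]
    by (simp cong: if_cong)
next
  case (insert a T)
  define A :: "real^'n^'n" where
    "A = (\<chi> i. if i = k then v else if i \<in> T then axis i 1 + u $ i *s v else axis i 1)"
  have "a \<noteq> k" "k \<notin> T" using insert by auto
  then have "(\<chi> i. if i = k then v else if i \<in> insert a T then axis i 1 + u $ i *s v else axis i 1)
    = (\<chi> i. if i = a then row a A + u $ a *s row k A else row i A)"
    using insert(2) by (auto simp: vec_eq_iff row_def A_def)
  then show ?case
    using det_row_operation[OF \<open>a \<noteq> k\<close>, where c = "u $ a" and A = A] insert.IH \<open>k \<notin> T\<close> by (simp add: A_def)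
qed

text \<open>The matrix determinant lemma. Multilinearity splits row \<open>k\<close> into the unit
  vector, covered by the induction hypothesis, and \<open>u $ k *s v\<close>, which contributes
  \<open>u $ k * v $ k\<close> by the preceding lemma.\<close>

lemma det_mat_1_plus_rank_one:
  fixes u v :: "real ^ 'n"
  shows "det (mat 1 + (\<chi> i j. u $ i * v $ j)) = 1 + u \<bullet> v"
proof -
  have *: "det (\<chi> i. if i \<in> T then axis i 1 + u $ i *s v else axis i 1 :: real^'n^'n)
      = 1 + (\<Sum>i\<in>T. u $ i * v $ i)" if "finite T" for T
    using that
  proof (induction T rule: finite_induct)
    case empty
    have "(\<chi> i. axis i 1) = (mat 1 :: real^'n^'n)"
      by (simp add: vec_eq_iff mat_def axis_def)
    then show ?case by simp
  next
    case (insert k T)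
    let ?c = "\<lambda>i. if i \<in> T then axis i 1 + u $ i *s v else axis i 1 :: real^'n"
    have 1: "(\<chi> i. if i \<in> insert k T then axis i 1 + u $ i *s v else axis i 1)
      = (\<chi> i. if i = k then axis k 1 + u $ k *s v else ?c i)"
      by (auto simp: vec_eq_iff)
    have 2: "(\<chi> i. if i = k then axis k 1 else ?c i) = (\<chi> i. ?c i)"
      using insert(2) by (auto simp: vec_eq_iff)
    have "det (\<chi> i. if i = k then axis k 1 + u $ k *s v else ?c i)
      = det (\<chi> i. if i = k then axis k 1 else ?c i) + u $ k * det (\<chi> i. if i = k then v else ?c i)"
      using det_row_add[of k "\<lambda>_. axis k 1" "\<lambda>_. u $ k *s v" ?c] det_row_mul[of k "u $ k" "\<lambda>_. v" ?c]
      by simp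
    then show ?case
      unfolding 1 using det_mat_1_plus_rank_one_aux[OF insert(1,2), of v u] insert
      by (simp add: 2 cong: if_cong)
  qed
  have "mat 1 + (\<chi> i j. u $ i * v $ j) = (\<chi> i. if i \<in> UNIV then axis i 1 + u $ i *s v else axis i 1)"
    by (simp add: vec_eq_iff mat_def axis_def)
  then show ?thesis using *[of UNIV] by (simp add: inner_vec_def)
qed

lemma matrix_inv_mult_vec:
  fixes S :: "real ^ 'n ^ 'n"
  assumes "invertible S"
  shows "S *v (matrix_inv S *v x) = x" "matrix_inv S *v (S *v x) = x"
proof -
  have "S ** matrix_inv S = mat 1 \<and> matrix_inv S ** S = mat 1"
    using assms unfolding invertible_def matrix_inv_def by (rule someI_ex)
  then show "S *v (matrix_inv S *v x) = x" "matrix_inv S *v (S *v x) = x"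
    by (simp_all add: matrix_vector_mul_assoc)
qed

lemma matrix_inv_mult_vec_eqI:
  fixes S :: "real ^ 'n ^ 'n"
  assumes "invertible S" "S *v y = x"
  shows "matrix_inv S *v x = y"
  using matrix_inv_mult_vec[OF assms(1)] assms(2) by metis

lemma tendsto_det:
  fixes A :: "'a \<Rightarrow> real ^ 'n ^ 'n"
  assumes "(A \<longlongrightarrow> B) F"
  shows "((\<lambda>x. det (A x)) \<longlongrightarrow> det B) F"
  unfolding det_def by (intro tendsto_intros assms)

text \<open>By Cramer's rule each component of the solution is a quotient of determinants, hence
  continuous in the matrix where the denominator is nonzero.\<close>

lemma tendsto_matrix_inv_mult_vec:
  fixes A :: "'a \<Rightarrow> real ^ 'n ^ 'n"
  assumes A: "(A \<longlongrightarrow> B) F" and B: "invertible B"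
  shows "((\<lambda>x. matrix_inv (A x) *v b) \<longlongrightarrow> matrix_inv B *v b) F"
proof -
  let ?m = "\<lambda>(C :: real ^ 'n ^ 'n) k. (\<chi> i j. if j = k then b $ i else C $ i $ j)"
  have cr: "matrix_inv C *v b = (\<chi> k. det (?m C k) / det C)"
    if "det C \<noteq> 0" for C :: "real ^ 'n ^ 'n"
    using cramer[OF that, of "matrix_inv C *v b" b] matrix_inv_mult_vec(1)[of C b] that
    by (simp add: invertible_det_nz)
  have B0: "det B \<noteq> 0" using B by (simp add: invertible_det_nz)
  have ev: "\<forall>\<^sub>F x in F. det (A x) \<noteq> 0"
    using tendsto_imp_eventually_ne[OF tendsto_det[OF A] B0] .
  have "((\<lambda>x. \<chi> k. det (?m (A x) k) / det (A x))
      \<longlongrightarrow> (\<chi> k. det (?m B k) / det B)) F"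
  proof (intro vec_tendstoI, simp, intro tendsto_divide tendsto_det A B0 vec_tendstoI)
    fix k i j
    show "((\<lambda>x. (?m (A x) k) $ i $ j) \<longlongrightarrow>
        (?m B k) $ i $ j) F"
      by (cases "j = k") (auto intro!: tendsto_vec_nth A)
  qed
  then have "((\<lambda>x. \<chi> k. det (?m (A x) k) / det (A x))
      \<longlongrightarrow> matrix_inv B *v b) F"
    using cr[OF B0] by simp
  then show ?thesis
    by (rule Lim_transform_eventually) (use ev cr in \<open>auto elim!: eventually_mono\<close>)
qed

text \<open>Positivity of the determinant belongs to the notion because the density divides by its
  square root and because each rank-one update hands it on through
  \<open>det_plus_outer_product\<close>.\<close>

definition spd :: "real ^ 'n ^ 'n \<Rightarrow> bool" where
  "spd S \<longleftrightarrow> transpose S = S \<and> (\<forall>x. x \<noteq> 0 \<longrightarrow> 0 < x \<bullet> (S *v x)) \<and> 0 < det S"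

lemma spd_invertible: "spd S \<Longrightarrow> invertible S"
  by (simp add: spd_def invertible_det_nz)

lemma symmetric_matrix_inner:
  fixes S :: "real ^ 'n ^ 'n"
  assumes "transpose S = S"
  shows "x \<bullet> (S *v y) = (S *v x) \<bullet> y"
  using dot_lmul_matrix[of x S y] assms by (metis transpose_matrix_vector)

lemma matrix_inv_inner:
  fixes S :: "real ^ 'n ^ 'n"
  assumes "transpose S = S" "invertible S"
  shows "x \<bullet> (matrix_inv S *v y) = (matrix_inv S *v x) \<bullet> y"
  using symmetric_matrix_inner[OF assms(1), of "matrix_inv S *v x" "matrix_inv S *v y"]
    matrix_inv_mult_vec(1)[OF assms(2)] by simp

lemma spd_matrix_inv_pos:
  assumes "spd S" "x \<noteq> 0"
  shows "0 < x \<bullet> (matrix_inv S *v x)"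
proof -
  have i: "S *v (matrix_inv S *v x) = x"
    using matrix_inv_mult_vec(1)[OF spd_invertible[OF assms(1)]] .
  then have "matrix_inv S *v x \<noteq> 0"
    using assms(2) by (metis matrix_vector_mult_0_right)
  then show ?thesis
    using assms(1) i unfolding spd_def by (metis inner_commute)
qed

lemma spd_matrix_inv_nonneg: "spd S \<Longrightarrow> 0 \<le> x \<bullet> (matrix_inv S *v x)"
  using spd_matrix_inv_pos[of S x] by (cases "x = 0") (auto simp: less_imp_le)

text \<open>Factoring out \<open>S\<close> leaves the identity plus a rank-one matrix built from
  \<open>matrix_inv S *v c\<close> and \<open>c\<close>.\<close>

lemma det_plus_outer_product:
  fixes S :: "real ^ 'n ^ 'n"
  assumes "invertible S"
  shows "det (S + outer_product c) = det S * (1 + c \<bullet> (matrix_inv S *v c))"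
proof -
  let ?u = "matrix_inv S *v c"
  have "S ** (\<chi> i j. ?u $ i * c $ j) = (\<chi> i j. (S *v ?u) $ i * c $ j)"
    by (simp add: vec_eq_iff matrix_matrix_mult_def matrix_vector_mult_def[of S] sum_distrib_right mult.assoc)
  also have "\<dots> = outer_product c"
    using matrix_inv_mult_vec(1)[OF assms] by (simp add: vec_eq_iff outer_product_component)
  finally have "S + outer_product c = S ** (mat 1 + (\<chi> i j. ?u $ i * c $ j))"
    by (simp add: matrix_add_ldistrib)
  then show ?thesis
    by (simp add: det_mul det_mat_1_plus_rank_one inner_commute)
qed

lemma spd_plus_outer_product:
  assumes "spd S"
  shows "spd (S + outer_product c)"
proof -
  have "0 < x \<bullet> ((S + outer_product c) *v x)" if "x \<noteq> 0" for x
  proof -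
    have "0 < x \<bullet> (S *v x)" using assms that by (simp add: spd_def)
    moreover have "x \<bullet> (outer_product c *v x) = (c \<bullet> x)\<^sup>2"
      by (simp add: outer_product_mult_vec power2_eq_square inner_commute)
    ultimately show ?thesis
      by (simp add: matrix_vector_mult_add_rdistrib inner_add_right add_pos_nonneg)
  qed
  moreover have "0 < det (S + outer_product c)"
    using assms spd_matrix_inv_nonneg[OF assms, of c]
    by (simp add: det_plus_outer_product spd_invertible)
       (simp add: spd_def add_pos_nonneg)
  ultimately show ?thesis
    using assms by (simp add: spd_def transpose_add)
qed

text \<open>The Sherman-Morrison formula, checked by multiplying back with the updated matrix. The
  denominator is at least 1 because the inverse form is nonnegative.\<close>

lemma matrix_inv_plus_outer_product:
  assumes "spd S"
  shows "matrix_inv (S + outer_product c) *v x =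
    matrix_inv S *v x - ((c \<bullet> (matrix_inv S *v x)) / (1 + c \<bullet> (matrix_inv S *v c))) *\<^sub>R (matrix_inv S *v c)"
proof (rule matrix_inv_mult_vec_eqI[OF spd_invertible[OF spd_plus_outer_product[OF assms]]])
  let ?Q = "matrix_inv S" and ?k = "1 + c \<bullet> (matrix_inv S *v c)"
  have k: "?k > 0" using spd_matrix_inv_nonneg[OF assms, of c] by simp
  have i: "S *v (?Q *v z) = z" for z
    using matrix_inv_mult_vec(1)[OF spd_invertible[OF assms]] .
  have "(S + outer_product c) *v (?Q *v x - ((c \<bullet> (?Q *v x)) / ?k) *\<^sub>R (?Q *v c))
     = x - ((c \<bullet> (?Q *v x)) / ?k) *\<^sub>R c + (c \<bullet> (?Q *v x)) *\<^sub>R c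
       - ((c \<bullet> (?Q *v x)) / ?k * (c \<bullet> (?Q *v c))) *\<^sub>R c"
    by (simp add: matrix_vector_mult_add_rdistrib matrix_vector_mult_diff_distrib matrix_vector_mult_scaleR
        outer_product_mult_vec i inner_diff_right algebra_simps)
  also have "\<dots> = x + ((c \<bullet> (?Q *v x)) - (c \<bullet> (?Q *v x)) / ?k * ?k) *\<^sub>R c"
    by (simp only: algebra_simps) simp
  also have "\<dots> = x" using k by simp
  finally show "(S + outer_product c) *v (?Q *v x - ((c \<bullet> (?Q *v x)) / ?k) *\<^sub>R (?Q *v c)) = x" .
qed

section \<open>Convolution of normal distributions\<close>

text \<open>A crude bound through the entries. The dimension factors are harmless: it only feeds
  estimates in which \<open>norm A\<close> is bounded or tends to 0.\<close>

lemma norm_matrix_vector_mult_le: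
  fixes A :: "real ^ 'n ^ 'm"
  shows "norm (A *v x) \<le> real CARD('m) * real CARD('n) * norm A * norm x"
proof -
  have "\<bar>A $ i $ j\<bar> \<le> norm A" for i j
    by (rule order_trans[OF component_le_norm_cart Finite_Cartesian_Product.norm_nth_le])
  then have "onorm ((*v) A) \<le> real CARD('m) * real CARD('n) * norm A"
    by (rule onorm_le_matrix_component)
  then have "onorm ((*v) A) * norm x \<le> real CARD('m) * real CARD('n) * norm A * norm x"
    by (rule mult_right_mono) simp
  then show ?thesis
    using onorm[OF matrix_vector_mul_bounded_linear[of A], of x] by linarith
qed

lemma mv_normal_density_nonneg: "0 < det S \<Longrightarrow> 0 \<le> mv_normal_density \<mu> S x"
  by (simp add: mv_normal_density_def)

lemma borel_measurable_mv_normal_density [measurable]: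
  "mv_normal_density \<mu> S \<in> borel_measurable borel"
proof -
  have "continuous_on UNIV (\<lambda>x. x \<bullet> (matrix_inv S *v x))"
    by (intro continuous_intros matrix_vector_mult_linear_continuous_on)
  then have [measurable]: "(\<lambda>x. x \<bullet> (matrix_inv S *v x)) \<in> borel_measurable borel"
    by (rule borel_measurable_continuous_onI)
  show ?thesis unfolding mv_normal_density_def by measurable
qed

text \<open>With \<open>X\<close> normal of covariance \<open>S\<close> and an independent normal
  \<open>t\<close>, the left side is the joint density of \<open>X + t *\<^sub>R c\<close> and
  \<open>t\<close>. It factors into the density of the first and the conditional density of the
  second; \<open>k\<close> is the factor by which the determinant grows.\<close>

lemma mv_normal_density_times_normal_density:
  fixes S :: "real ^ 'n ^ 'n"
  assumes S: "spd S" and s: "0 < s"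
    and k: "k = 1 + s\<^sup>2 * (c \<bullet> (matrix_inv S *v c))"
  shows "mv_normal_density 0 S (x - t *\<^sub>R c) * normal_density 0 s t =
    mv_normal_density 0 (S + outer_product (s *\<^sub>R c)) x *
    normal_density (s\<^sup>2 * (c \<bullet> (matrix_inv S *v x)) / k) (s / sqrt k) t"
proof -
  let ?Q = "matrix_inv S"
  define q where "q = c \<bullet> (?Q *v c)"
  define r where "r = c \<bullet> (?Q *v x)"
  define b where "b = s\<^sup>2 * r / k"
  let ?e' = "exp (- (x \<bullet> (?Q *v x) - s\<^sup>2 * r\<^sup>2 / k) / 2) * exp (- ((t - b)\<^sup>2) / (2 * (s / sqrt k)\<^sup>2))"
  let ?e = "exp (- ((x - t *\<^sub>R c) \<bullet> (?Q *v (x - t *\<^sub>R c))) / 2) * exp (- (t\<^sup>2) / (2 * s\<^sup>2))"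
  have k': "k = 1 + s\<^sup>2 * q" using k by (simp add: q_def)
  have kpos: "k > 0" using spd_matrix_inv_nonneg[OF S, of c] k by (simp add: add_pos_nonneg)
  have sym: "x \<bullet> (?Q *v c) = r"
    using matrix_inv_inner[OF _ spd_invertible[OF S], of x c] S
    by (simp add: r_def spd_def inner_commute)
  have e1: "(x - t *\<^sub>R c) \<bullet> (?Q *v (x - t *\<^sub>R c)) = x \<bullet> (?Q *v x) - 2 * t * r + t\<^sup>2 * q"
    by (simp add: matrix_vector_mult_diff_distrib matrix_vector_mult_scaleR inner_diff_left inner_diff_right
        sym r_def[symmetric] q_def[symmetric] power2_eq_square algebra_simps)
  have e2: "x \<bullet> (matrix_inv (S + outer_product (s *\<^sub>R c)) *v x) = x \<bullet> (?Q *v x) - s\<^sup>2 * r\<^sup>2 / k"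
    unfolding matrix_inv_plus_outer_product[OF S]
    by (simp add: matrix_vector_mult_scaleR inner_diff_right sym r_def[symmetric] q_def[symmetric] k'
        power2_eq_square algebra_simps)
  have e3: "det (S + outer_product (s *\<^sub>R c)) = det S * k"
    unfolding det_plus_outer_product[OF spd_invertible[OF S]]
    by (simp add: matrix_vector_mult_scaleR q_def[symmetric] k' power2_eq_square)
  \<comment> \<open>Completing the square in \<open>t\<close>: \<open>b\<close> is the conditional
    mean and \<open>s / sqrt k\<close> the conditional standard deviation.\<close>
  have ex: "x \<bullet> (?Q *v x) - 2 * t * r + t\<^sup>2 * q + t\<^sup>2 / s\<^sup>2
      = x \<bullet> (?Q *v x) - s\<^sup>2 * r\<^sup>2 / k + (t - b)\<^sup>2 / (s / sqrt k)\<^sup>2"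
  proof -
    have "(t - b)\<^sup>2 / (s / sqrt k)\<^sup>2 = k * (t - b)\<^sup>2 / s\<^sup>2"
      using kpos s by (simp add: power_divide field_simps)
    also have "\<dots> = t\<^sup>2 * k / s\<^sup>2 - 2 * t * r + s\<^sup>2 * r\<^sup>2 / k"
      unfolding b_def using kpos s by (simp add: power2_eq_square field_simps)
    also have "t\<^sup>2 * k / s\<^sup>2 = t\<^sup>2 / s\<^sup>2 + t\<^sup>2 * q"
      using s by (simp add: k' field_simps)
    finally show ?thesis by simp
  qed
  have "?e
      = exp (- (x \<bullet> (?Q *v x) - 2 * t * r + t\<^sup>2 * q + t\<^sup>2 / s\<^sup>2) / 2)"
    unfolding e1 exp_add[symmetric] by (rule arg_cong[of _ _ exp]) (simp add: field_simps)
  also have "\<dots> = ?e'"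
    unfolding ex exp_add[symmetric] by (rule arg_cong[of _ _ exp]) (simp add: field_simps)
  finally have E: "?e
      = ?e'" .
  have C: "sqrt ((2 * pi) ^ CARD('n) * det S) * sqrt (2 * pi * s\<^sup>2)
      = sqrt ((2 * pi) ^ CARD('n) * (det S * k)) * sqrt (2 * pi * (s / sqrt k)\<^sup>2)"
    using kpos by (simp add: power_divide real_sqrt_mult[symmetric] field_simps)
  have "mv_normal_density 0 S (x - t *\<^sub>R c) * normal_density 0 s t
    = ?e
      / (sqrt ((2 * pi) ^ CARD('n) * det S) * sqrt (2 * pi * s\<^sup>2))"
    by (simp add: mv_normal_density_def normal_density_def)
  also have "\<dots> = mv_normal_density 0 (S + outer_product (s *\<^sub>R c)) x * normal_density b (s / sqrt k) t"
    unfolding E C by (simp add: mv_normal_density_def normal_density_def e2 e3)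
  finally show ?thesis by (simp add: b_def r_def)
qed

lemma nn_integral_lborel_translate:
  fixes f :: "'a::euclidean_space \<Rightarrow> ennreal"
  assumes [measurable]: "f \<in> borel_measurable borel"
  shows "(\<integral>\<^sup>+x. f (c + x) \<partial>lborel) = (\<integral>\<^sup>+x. f x \<partial>lborel)"
proof -
  have "(\<integral>\<^sup>+x. f x \<partial>lborel) = (\<integral>\<^sup>+x. f x \<partial>distr lborel borel ((+) c))"
    by (simp add: lborel_distr_plus)
  also have "\<dots> = (\<integral>\<^sup>+x. f (c + x) \<partial>lborel)"
    by (subst nn_integral_distr) auto
  finally show ?thesis ..
qed

lemma nn_integral_normal_density: "0 < s \<Longrightarrow> (\<integral>\<^sup>+t. ennreal (normal_density b s t) \<partial>lborel) = 1"
  using prob_space.emeasure_space_1[OF prob_space_normal_density[of s b]]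
  by (simp add: emeasure_density)

abbreviation normal_integral :: "real ^ 'n ^ 'n \<Rightarrow> (real ^ 'n \<Rightarrow> ennreal) \<Rightarrow> ennreal" where
  "normal_integral S f \<equiv> \<integral>\<^sup>+x. ennreal (mv_normal_density 0 S x) * f x \<partial>lborel"

text \<open>Shift \<open>x\<close> by \<open>t *\<^sub>R c\<close>, exchange the integrals and
  factor the density: the conditional density of \<open>t\<close> integrates to 1. Nonnegative
  integrals make the exchange free of integrability conditions.\<close>

lemma nn_integral_mv_normal_rank_one:
  fixes f :: "real ^ 'n \<Rightarrow> ennreal"
  assumes S: "spd S" and s: "0 < s" and [measurable]: "f \<in> borel_measurable borel"
  shows "(\<integral>\<^sup>+t. normal_density 0 s t * (normal_integral S (\<lambda>x. f (x + t *\<^sub>R c))) \<partial>lborel)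
    = normal_integral (S + outer_product (s *\<^sub>R c)) f"
proof -
  let ?S' = "S + outer_product (s *\<^sub>R c)"
  let ?h = "\<lambda>t x. normal_density 0 s t * (mv_normal_density 0 S (x - t *\<^sub>R c) * f x)"
  define k where "k = 1 + s\<^sup>2 * (c \<bullet> (matrix_inv S *v c))"
  have kpos: "k > 0" using spd_matrix_inv_nonneg[OF S, of c] by (simp add: k_def add_pos_nonneg)
  have d: "0 < det S" "0 < det ?S'" using S spd_plus_outer_product[OF S] by (auto simp: spd_def)
  have "normal_integral S (\<lambda>x. f (x + t *\<^sub>R c))
      = (\<integral>\<^sup>+x. mv_normal_density 0 S (x - t *\<^sub>R c) * f x \<partial>lborel)" for t
    using nn_integral_lborel_translate[of "\<lambda>x. mv_normal_density 0 S (x - t *\<^sub>R c) * f x" "t *\<^sub>R c"]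
    by (simp add: add.commute)
  then have "(\<integral>\<^sup>+t. normal_density 0 s t * (normal_integral S (\<lambda>x. f (x + t *\<^sub>R c))) \<partial>lborel)
    = (\<integral>\<^sup>+t. (\<integral>\<^sup>+x. ?h t x \<partial>lborel) \<partial>lborel)"
    by (simp add: nn_integral_cmult)
  also have "\<dots> = (\<integral>\<^sup>+x. (\<integral>\<^sup>+t. ?h t x \<partial>lborel) \<partial>lborel)"
    by (rule lborel_pair.Fubini') measurable
  also have "\<dots> = (\<integral>\<^sup>+x. (\<integral>\<^sup>+t. (mv_normal_density 0 ?S' x * f x) *
      ennreal (normal_density (s\<^sup>2 * (c \<bullet> (matrix_inv S *v x)) / k) (s / sqrt k) t) \<partial>lborel) \<partial>lborel)"
  proof (intro nn_integral_cong)
    fix x t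
    have "?h t x
      = ennreal (mv_normal_density 0 S (x - t *\<^sub>R c) * normal_density 0 s t) * f x"
      using d by (simp add: ennreal_mult mv_normal_density_nonneg mult_ac)
    also have "\<dots> = (mv_normal_density 0 ?S' x * f x) *
      ennreal (normal_density (s\<^sup>2 * (c \<bullet> (matrix_inv S *v x)) / k) (s / sqrt k) t)"
      unfolding mv_normal_density_times_normal_density[OF S s k_def]
      using d by (simp add: ennreal_mult mv_normal_density_nonneg mult_ac)
    finally show "?h t x
      = (mv_normal_density 0 ?S' x * f x) *
      ennreal (normal_density (s\<^sup>2 * (c \<bullet> (matrix_inv S *v x)) / k) (s / sqrt k) t)" .
  qed
  also have "\<dots> = normal_integral ?S' f"
    using kpos s by (simp add: nn_integral_cmult nn_integral_normal_density)
  finally show ?thesis .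
qed

text \<open>Functions of disjoint groups of independent variables are independent; this isolates one
  noise variable in the induction below.\<close>

lemma (in prob_space) indep_var_sum_scaleR:
  fixes w :: "'i \<Rightarrow> 'a \<Rightarrow> real" and c :: "'i \<Rightarrow> 'b::euclidean_space"
  assumes J: "finite J" "a \<notin> J" and ind: "indep_vars (\<lambda>_. borel) w (insert a J)"
  shows "indep_var borel (\<lambda>\<omega>. \<Sum>i\<in>J. w i \<omega> *\<^sub>R c i) borel (\<lambda>\<omega>. w a \<omega> *\<^sub>R c')"
proof -
  have "indep_var
    borel ((\<lambda>f. \<Sum>i\<in>J. f i *\<^sub>R c i) \<circ> (\<lambda>\<omega>. restrict (\<lambda>i. w i \<omega>) J))
    borel ((\<lambda>f. f a *\<^sub>R c') \<circ> (\<lambda>\<omega>. restrict (\<lambda>i. w i \<omega>) {a}))"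
    using J by (intro indep_var_compose[OF indep_var_restrict[OF ind]]) auto
  also have "((\<lambda>f. \<Sum>i\<in>J. f i *\<^sub>R c i) \<circ> (\<lambda>\<omega>. restrict (\<lambda>i. w i \<omega>) J)) = (\<lambda>\<omega>. \<Sum>i\<in>J. w i \<omega> *\<^sub>R c i)"
    by (auto cong: rev_conj_cong)
  also have "((\<lambda>f. f a *\<^sub>R c') \<circ> (\<lambda>\<omega>. restrict (\<lambda>i. w i \<omega>) {a})) = (\<lambda>\<omega>. w a \<omega> *\<^sub>R c')"
    by auto
  finally show ?thesis .
qed

text \<open>Each noise variable is absorbed into the normal vector by one rank-one update, so
  \<open>S\<close> must vary in the induction. The law of the remaining sum and the new variable is
  a product; integrating over the new variable first updates \<open>S\<close>, and the induction
  hypothesis handles the rest.\<close>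

lemma (in prob_space) nn_integral_mv_normal_plus_sum:
  fixes f :: "real ^ 'n \<Rightarrow> ennreal"
  assumes "finite J" "indep_vars (\<lambda>_. borel) w J"
    and "\<And>i. i \<in> J \<Longrightarrow> distributed M lborel (w i) (normal_density 0 s)"
    and "0 < s" "spd S" and [measurable]: "f \<in> borel_measurable borel"
  shows "(\<integral>\<^sup>+\<omega>. (normal_integral S (\<lambda>x. f (x + (\<Sum>i\<in>J. w i \<omega> *\<^sub>R c i)))) \<partial>M)
    = normal_integral (S + (\<Sum>i\<in>J. outer_product (s *\<^sub>R c i))) f"
  using assms(1-3,5)
proof (induction J arbitrary: S rule: finite_induct)
  case empty
  show ?case by (simp add: emeasure_space_1)
next
  case (insert a J)
  let ?S = "(S + outer_product (s *\<^sub>R c a))"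
  define V where "V = (\<lambda>\<omega>. \<Sum>i\<in>J. w i \<omega> *\<^sub>R c i)"
  \<comment> \<open>\<^const>\<open>prob_space.indep_var\<close> needs two variables of the same type, so \<open>w a\<close> becomes a vector.\<close>
  define k :: 'n where "k = undefined"
  define U where "U = (\<lambda>\<omega>. w a \<omega> *\<^sub>R (axis k 1 :: real ^ 'n))"
  have iv: "indep_var borel V borel U"
    unfolding V_def U_def by (rule indep_var_sum_scaleR[OF insert(1,2) insert(4)])
  have [measurable]: "V \<in> borel_measurable M" "U \<in> borel_measurable M" "w a \<in> borel_measurable M"
    using iv insert(5)[of a] by (auto dest: indep_var_rv1 indep_var_rv2 simp: distributed_def)
  have pr: "distr M borel V \<Otimes>\<^sub>M distr M borel U = distr M (borel \<Otimes>\<^sub>M borel) (\<lambda>\<omega>. (V \<omega>, U \<omega>))"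
    using iv unfolding indep_var_distribution_eq by simp
  have dw: "distr M borel (w a) = density lborel (normal_density 0 s)"
    using insert(5)[of a] unfolding distributed_def by (simp cong: distr_cong)
  interpret D: prob_space "distr M borel U" by (rule prob_space_distr) measurable
  let ?F = "\<lambda>(v, t). \<integral>\<^sup>+x. mv_normal_density 0 S x * f (x + t *\<^sub>R c a + v) \<partial>lborel"
  let ?G = "\<lambda>z. ?F (fst z, snd z $ k)"
  have [measurable]: "(\<lambda>u :: real ^ 'n. u $ k) \<in> borel_measurable borel"
    by (intro borel_measurable_continuous_onI continuous_intros)
  have mF [measurable]: "?F \<in> borel_measurable (borel \<Otimes>\<^sub>M borel)" by measurable
  have mG: "?G \<in> borel_measurable (borel \<Otimes>\<^sub>M borel)"
    by (rule measurable_compose[OF _ mF]) measurable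
  have mG': "?G \<in> borel_measurable (distr M borel V \<Otimes>\<^sub>M distr M borel U)"
    using mG by (simp cong: measurable_cong_sets sets_pair_measure_cong)
  have "(\<integral>\<^sup>+\<omega>. (normal_integral S (\<lambda>x. f (x + (\<Sum>i\<in>insert a J. w i \<omega> *\<^sub>R c i)))) \<partial>M)
    = (\<integral>\<^sup>+\<omega>. ?G (V \<omega>, U \<omega>) \<partial>M)"
    using insert(1,2) by (simp add: V_def U_def add.assoc)
  also have "\<dots> = (\<integral>\<^sup>+z. ?G z \<partial>(distr M borel V \<Otimes>\<^sub>M distr M borel U))"
    unfolding pr by (subst nn_integral_distr) (use mG in auto)
  also have "\<dots> = (\<integral>\<^sup>+v. (\<integral>\<^sup>+u. ?G (v, u) \<partial>distr M borel U) \<partial>distr M borel V)"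
    using D.nn_integral_fst[OF mG'] by simp
  also have "\<dots> = (\<integral>\<^sup>+v. (\<integral>\<^sup>+t. ?F (v, t) \<partial>distr M borel (w a)) \<partial>distr M borel V)"
  proof (intro nn_integral_cong)
    fix v
    have [measurable]: "(\<lambda>t. ?F (v, t)) \<in> borel_measurable borel"
      by (rule measurable_compose[OF _ mF]) measurable
    show "(\<integral>\<^sup>+u. ?G (v, u) \<partial>distr M borel U) = (\<integral>\<^sup>+t. ?F (v, t) \<partial>distr M borel (w a))"
      by (subst (1 2) nn_integral_distr) (simp_all add: U_def)
  qed
  also have "\<dots> = (\<integral>\<^sup>+v. (normal_integral ?S (\<lambda>x. f (x + v))) \<partial>distr M borel V)"
  proof (intro nn_integral_cong)
    fix v
    have "(\<integral>\<^sup>+t. ?F (v, t) \<partial>distr M borel (w a)) = (\<integral>\<^sup>+t. normal_density 0 s t * ?F (v, t) \<partial>lborel)"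
      unfolding dw by (subst nn_integral_density) simp_all
    also have "\<dots> = normal_integral ?S (\<lambda>x. f (x + v))"
      using nn_integral_mv_normal_rank_one[OF insert(6) assms(4), of "\<lambda>x. f (x + v)" "c a"] by simp
    finally show "(\<integral>\<^sup>+t. ?F (v, t) \<partial>distr M borel (w a))
      = normal_integral ?S (\<lambda>x. f (x + v))" .
  qed
  also have "\<dots> = (\<integral>\<^sup>+\<omega>. (normal_integral ?S (\<lambda>x. f (x + V \<omega>))) \<partial>M)"
    by (subst nn_integral_distr) simp_all
  also have "\<dots> = normal_integral (S + outer_product (s *\<^sub>R c a) + (\<Sum>i\<in>J. outer_product (s *\<^sub>R c i))) f"
    unfolding V_def
    by (rule insert.IH) (use insert in \<open>auto intro: indep_vars_subset spd_plus_outer_product\<close>)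
  finally show ?case using insert(1,2) by (simp add: add.assoc)
qed

section \<open>Isotropic normal vectors: total mass and concentration near the origin\<close>

lemma spd_scaled_mat_1: "0 < e \<Longrightarrow> spd (e\<^sup>2 *\<^sub>R mat 1 :: real ^ 'n ^ 'n)"
proof -
  assume e: "0 < e"
  have m: "(e\<^sup>2 *\<^sub>R mat 1 :: real ^ 'n ^ 'n) *v x = e\<^sup>2 *\<^sub>R x" for x
    by (simp add: scaleR_matrix_vector_assoc[symmetric])
  have "det (e\<^sup>2 *\<^sub>R mat 1 :: real ^ 'n ^ 'n) = (e\<^sup>2) ^ CARD('n)"
    by (subst det_diagonal) (auto simp: mat_def)
  then show ?thesis
    using e unfolding spd_def m by (auto simp: vec_eq_iff transpose_def mat_def)
qed

lemma mv_normal_density_scaled_mat_1: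
  fixes x :: "real ^ 'n"
  assumes e: "0 < e"
  shows "mv_normal_density 0 (e\<^sup>2 *\<^sub>R mat 1) x = (\<Prod>b\<in>Basis. normal_density 0 e (x \<bullet> b))"
proof -
  let ?S = "e\<^sup>2 *\<^sub>R mat 1 :: real ^ 'n ^ 'n"
  have m: "?S *v x = e\<^sup>2 *\<^sub>R x" for x
    by (simp add: scaleR_matrix_vector_assoc[symmetric])
  have i: "matrix_inv ?S *v x = (1 / e\<^sup>2) *\<^sub>R x"
    using e by (intro matrix_inv_mult_vec_eqI[OF spd_invertible[OF spd_scaled_mat_1]]) (auto simp: m)
  have d: "det ?S = (e\<^sup>2) ^ CARD('n)"
    by (subst det_diagonal) (auto simp: mat_def)
  have E: "exp (- (x \<bullet> (matrix_inv ?S *v x)) / 2) = exp (\<Sum>b\<in>Basis. - ((x \<bullet> b)\<^sup>2) / (2 * e\<^sup>2))"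
    unfolding i by (rule arg_cong[of _ _ exp])
      (simp add: euclidean_inner[of x x] power2_eq_square sum_divide_distrib sum_negf mult_ac)
  have "(\<Prod>b\<in>Basis. normal_density 0 e (x \<bullet> b))
      = (\<Prod>b\<in>(Basis :: (real ^ 'n) set). 1 / sqrt (2 * pi * e\<^sup>2)) * (\<Prod>b\<in>Basis. exp (- ((x \<bullet> b)\<^sup>2) / (2 * e\<^sup>2)))"
    unfolding normal_density_def prod.distrib by simp
  also have "\<dots> = (1 / sqrt (2 * pi * e\<^sup>2)) ^ CARD('n) * exp (\<Sum>b\<in>Basis. - ((x \<bullet> b)\<^sup>2) / (2 * e\<^sup>2))"
    by (simp only: exp_sum[OF finite_Basis] prod_constant DIM_cart DIM_real mult_1_right)
  also have "(1 / sqrt (2 * pi * e\<^sup>2)) ^ CARD('n) = 1 / sqrt ((2 * pi) ^ CARD('n) * det ?S)"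
    unfolding d power_mult_distrib[symmetric] real_sqrt_power by (rule power_one_over)
  finally show ?thesis
    unfolding mv_normal_density_def E[symmetric] by simp
qed

text \<open>The isotropic density is a product over coordinates, so integrals of product functions
  reduce to dimension one.\<close>

lemma nn_integral_mv_normal_density_scaled_mat_1:
  fixes g :: "real ^ 'n \<Rightarrow> real \<Rightarrow> ennreal"
  assumes e: "0 < e" and [measurable]: "\<And>b. g b \<in> borel_measurable borel"
  shows "normal_integral (e\<^sup>2 *\<^sub>R mat 1 :: real ^ 'n ^ 'n) (\<lambda>x. (\<Prod>b\<in>Basis. g b (x \<bullet> b)))
    = (\<Prod>b\<in>(Basis :: (real ^ 'n) set). \<integral>\<^sup>+t. normal_density 0 e t * g b t \<partial>lborel)"
proof -
  have "ennreal (mv_normal_density 0 (e\<^sup>2 *\<^sub>R mat 1) x) * (\<Prod>b\<in>Basis. g b (x \<bullet> b))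
      = (\<Prod>b\<in>Basis. ennreal (normal_density 0 e (x \<bullet> b)) * g b (x \<bullet> b))" for x :: "real ^ 'n"
    unfolding mv_normal_density_scaled_mat_1[OF e] prod.distrib
    by (subst prod_ennreal) (rule normal_density_nonneg, rule refl)
  then show ?thesis
    by (simp only:) (rule nn_integral_lborel_prod, measurable)
qed

lemma nn_integral_mv_normal_scaled_mat_1:
  assumes e: "0 < e"
  shows "(\<integral>\<^sup>+x. mv_normal_density 0 (e\<^sup>2 *\<^sub>R mat 1 :: real ^ 'n ^ 'n) x \<partial>lborel) = 1"
  using nn_integral_mv_normal_density_scaled_mat_1[OF e, of "\<lambda>(_ :: real ^ 'n) _. 1"]
  by (simp add: nn_integral_normal_density[OF e])

text \<open>Chebyshev's inequality. For \<open>d < s\<close> the left side is \<open>ennreal\<close>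
  of a negative number, which is 0.\<close>

lemma normal_mass_near_0:
  assumes s: "0 < s" and d: "0 < d"
  shows "ennreal (1 - s\<^sup>2 / d\<^sup>2) \<le> (\<integral>\<^sup>+t. ennreal (normal_density 0 s t) * indicator {-d..d} t \<partial>lborel)"
proof -
  let ?N = "density lborel (normal_density 0 s)"
  let ?A = "{x \<in> space ?N. d \<le> \<bar>x\<bar>}"
  interpret N: prob_space ?N by (rule prob_space_normal_density[OF s])
  have di: "distributed ?N lborel (\<lambda>x. x) (normal_density 0 s)"
    by (auto simp: distributed_def distr_id2)
  have ex: "N.expectation (\<lambda>x. x) = 0" "N.variance (\<lambda>x. x) = s\<^sup>2"
    using N.normal_distributed_expectation[OF s di] N.normal_distributed_variance[OF s di] by auto
  have i2: "integrable ?N (\<lambda>x. x\<^sup>2)"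
    using integrable_normal_moment[of s 0 2] s by (simp add: integrable_density)
  have "N.prob ?A \<le> s\<^sup>2 / d\<^sup>2"
    using N.Chebyshev_inequality[of "\<lambda>x. x" d] i2 d ex by simp
  moreover have "N.prob {-d..d} \<ge> 1 - N.prob ?A"
  proof -
    have "1 - N.prob ?A = N.prob (space ?N - ?A)"
      by (subst N.prob_compl) auto
    also have "\<dots> \<le> N.prob {-d..d}"
      by (rule N.finite_measure_mono) auto
    finally show ?thesis .
  qed
  ultimately have "1 - s\<^sup>2 / d\<^sup>2 \<le> N.prob {-d..d}" by simp
  then have "ennreal (1 - s\<^sup>2 / d\<^sup>2) \<le> emeasure ?N {-d..d}"
    by (simp add: N.emeasure_eq_measure ennreal_leI)
  then show ?thesis by (simp add: emeasure_density)
qed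

text \<open>A product of one-dimensional Chebyshev bounds. The condition \<open>e \<le> d\<close>
  keeps the factor nonnegative, so that \<open>ennreal\<close> commutes with the power.\<close>

lemma mv_normal_scaled_mat_1_mass_near_0:
  assumes e: "0 < e" "e \<le> d"
  shows "ennreal ((1 - e\<^sup>2 / d\<^sup>2) ^ CARD('n))
    \<le> normal_integral (e\<^sup>2 *\<^sub>R mat 1 :: real ^ 'n ^ 'n) (indicator {x. \<forall>i. \<bar>x $ i\<bar> \<le> d})"
proof -
  let ?G = "(e\<^sup>2 *\<^sub>R mat 1 :: real ^ 'n ^ 'n)"
  have "e\<^sup>2 / d\<^sup>2 \<le> 1" using e by (simp add: power_mono)
  then have "ennreal ((1 - e\<^sup>2 / d\<^sup>2) ^ CARD('n)) = (\<Prod>b\<in>(Basis :: (real^'n) set). ennreal (1 - e\<^sup>2 / d\<^sup>2))"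
    by (simp add: ennreal_power)
  also have "\<dots> \<le> (\<Prod>b\<in>(Basis :: (real^'n) set). \<integral>\<^sup>+t. ennreal (normal_density 0 e t) * indicator {-d..d} t \<partial>lborel)"
    using e by (intro prod_mono_ennreal normal_mass_near_0) auto
  also have "\<dots> = normal_integral ?G (\<lambda>x. (\<Prod>b\<in>Basis. indicator {-d..d} (x \<bullet> b)))"
    by (rule nn_integral_mv_normal_density_scaled_mat_1[OF e(1), symmetric]) simp
  also have "\<dots> = normal_integral ?G (indicator {x. \<forall>i. \<bar>x $ i\<bar> \<le> d})"
  proof (intro nn_integral_cong arg_cong2[of _ _ _ _ "(*)"] refl)
    fix x :: "real ^ 'n"
    show "(\<Prod>b\<in>Basis. indicator {-d..d} (x \<bullet> b)) = (indicator {x. \<forall>i. \<bar>x $ i\<bar> \<le> d} x :: ennreal)"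
    proof (cases "\<forall>i. \<bar>x $ i\<bar> \<le> d")
      case True
      then have "\<forall>b\<in>Basis. indicator {-d..d} (x \<bullet> b) = (1 :: ennreal)"
        by (auto simp: Basis_vec_def inner_axis abs_le_iff minus_le_iff split: split_indicator)
      then show ?thesis using True by simp
    next
      case False
      then obtain i where "\<not> \<bar>x $ i\<bar> \<le> d" by blast
      then have "indicator {-d..d} (x \<bullet> axis i 1) = (0 :: ennreal)"
        by (auto simp: inner_axis abs_le_iff split: split_indicator)
      moreover have "axis i 1 \<in> (Basis :: (real ^ 'n) set)" by (simp add: axis_in_Basis_iff)
      ultimately show ?thesis using False by (metis (no_types, lifting) finite_Basis indicator_simps(2) mem_Collect_eq prod_zero)
    qed
  qed
  finally show ?thesis .
qed

section \<open>Limits of normal distributions\<close>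

text \<open>The form of \<open>S\<close> is nonnegative at
  \<open>z = matrix_inv S *v x - (1 / B) *\<^sub>R x\<close>; expand it and bound the form at
  \<open>x\<close>. Among all multiples of \<open>x\<close>, the factor \<open>1 / B\<close> gives
  the best bound.\<close>

lemma spd_matrix_inv_lower_bound:
  fixes S :: "real ^ 'n ^ 'n"
  assumes S: "spd S" and B: "0 < B" "\<And>x. x \<bullet> (S *v x) \<le> B * (norm x)\<^sup>2"
  shows "(norm x)\<^sup>2 / B \<le> x \<bullet> (matrix_inv S *v x)"
proof -
  define y where "y = matrix_inv S *v x"
  have Sy: "S *v y = x"
    unfolding y_def by (rule matrix_inv_mult_vec(1)[OF spd_invertible[OF S]])
  define z where "z = y - (1 / B) *\<^sub>R x"
  have "0 \<le> z \<bullet> (S *v z)"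
    using S by (cases "z = 0") (auto simp: spd_def less_imp_le)
  also have "z \<bullet> (S *v z) = x \<bullet> y - 2 / B * (norm x)\<^sup>2 + (1 / B)\<^sup>2 * (x \<bullet> (S *v x))"
  proof -
    have "y \<bullet> (S *v x) = (norm x)\<^sup>2"
      using symmetric_matrix_inner[of S y x] S Sy by (simp add: spd_def power2_norm_eq_inner)
    moreover have "norm x * norm x = x \<bullet> x"
      by (metis power2_norm_eq_inner power2_eq_square)
    ultimately show ?thesis
      by (simp add: z_def matrix_vector_mult_diff_distrib matrix_vector_mult_scaleR inner_diff_left
          inner_diff_right Sy power2_norm_eq_inner inner_commute power2_eq_square algebra_simps)
  qed
  also have "\<dots> \<le> x \<bullet> y - 2 / B * (norm x)\<^sup>2 + (1 / B)\<^sup>2 * (B * (norm x)\<^sup>2)"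
    using B by (intro add_left_mono mult_left_mono) auto
  also have "\<dots> = x \<bullet> y - (norm x)\<^sup>2 / B"
    using B by (simp add: power2_eq_square field_simps)
  finally show ?thesis by (simp add: y_def)
qed

text \<open>Dominated convergence: the \<open>S n\<close> are bounded, so their inverse forms have a
  common lower bound and the densities lie under a multiple of one isotropic density. The
  determinants are bounded below only from some index on, hence the shift by
  \<open>N\<close>.\<close>

lemma tendsto_nn_integral_mv_normal:
  fixes S :: "nat \<Rightarrow> real ^ 'n ^ 'n"
  assumes conv: "S \<longlonglongrightarrow> S0" and S: "\<And>n. spd (S n)" and S0: "spd S0" and A: "A \<in> sets borel"
  shows "(\<lambda>n. \<integral>\<^sup>+x. ennreal (mv_normal_density 0 (S n) x) * indicator A x \<partial>lborel)
    \<longlonglongrightarrow> normal_integral S0 (indicator A)"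
proof -
  note [measurable] = A
  obtain b where b: "0 < b" "\<And>n. norm (S n) \<le> b"
    using convergent_imp_Bseq[of S] conv by (auto simp: convergent_def Bseq_def)
  define B where "B = real CARD('n) * real CARD('n) * b"
  have B: "0 < B" using b by (simp add: B_def)
  have SB: "x \<bullet> (S n *v x) \<le> B * (norm x)\<^sup>2" for n x
  proof -
    have "x \<bullet> (S n *v x) \<le> norm x * norm (S n *v x)" by (rule norm_cauchy_schwarz)
    also have "\<dots> \<le> norm x * (real CARD('n) * real CARD('n) * norm (S n) * norm x)"
      by (intro mult_left_mono norm_matrix_vector_mult_le) simp
    also have "\<dots> \<le> norm x * (real CARD('n) * real CARD('n) * b * norm x)"
      using b by (intro mult_left_mono mult_right_mono) auto
    finally show ?thesis by (simp add: B_def power2_eq_square mult_ac)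
  qed
  define D where "D = det S0 / 2"
  have D: "0 < D" "D < det S0" using S0 by (auto simp: D_def spd_def)
  have "\<forall>\<^sub>F n in sequentially. D < det (S n)"
    using order_tendstoD(1)[OF tendsto_det[OF conv] D(2)] .
  then obtain N where N: "\<And>n. n \<ge> N \<Longrightarrow> D < det (S n)"
    by (auto simp: eventually_sequentially)
  define e where "e = sqrt B"
  let ?f = "\<lambda>n x. ennreal (mv_normal_density 0 (S (n + N)) x) * indicator A x"
  have e: "0 < e" "e\<^sup>2 = B" using B by (auto simp: e_def)
  let ?G = "e\<^sup>2 *\<^sub>R mat 1 :: real ^ 'n ^ 'n"
  \<comment> \<open>\<open>C\<close> exchanges the normalizing constant of \<open>?G\<close> for the
    one belonging to the determinant bound \<open>D\<close>.\<close>
  define C where "C = sqrt ((2 * pi) ^ CARD('n) * det ?G) / sqrt ((2 * pi) ^ CARD('n) * D)"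
  have dG: "0 < det ?G" using spd_scaled_mat_1[OF e(1)] unfolding spd_def by blast
  have iG: "matrix_inv ?G *v x = (1 / B) *\<^sub>R x" for x
    using B by (intro matrix_inv_mult_vec_eqI[OF spd_invertible[OF spd_scaled_mat_1[OF e(1)]]])
      (auto simp: e(2) scaleR_matrix_vector_assoc[symmetric])
  have bound: "mv_normal_density 0 (S n) x \<le> C * mv_normal_density 0 ?G x" if "n \<ge> N" for n x
  proof -
    have "C * mv_normal_density 0 ?G x = exp (- ((norm x)\<^sup>2 / B) / 2) / sqrt ((2 * pi) ^ CARD('n) * D)"
      using dG by (simp add: C_def mv_normal_density_def iG power2_norm_eq_inner)
    moreover have "mv_normal_density 0 (S n) x \<le> exp (- ((norm x)\<^sup>2 / B) / 2) / sqrt ((2 * pi) ^ CARD('n) * D)"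
      unfolding mv_normal_density_def
      using spd_matrix_inv_lower_bound[OF S[of n] B SB] N[OF that] D
      by (intro frac_le) auto
    ultimately show ?thesis by simp
  qed
  have "(\<lambda>n. \<integral>\<^sup>+x. ?f n x \<partial>lborel) \<longlonglongrightarrow> normal_integral S0 (indicator A)"
  proof (rule nn_integral_dominated_convergence[where w = "\<lambda>x. ennreal (C * mv_normal_density 0 ?G x)"])
    show "AE x in lborel. ?f n x \<le> ennreal (C * mv_normal_density 0 ?G x)" for n
      using bound[of "n + N"] by (auto intro!: AE_I2 ennreal_leI split: split_indicator)
    have C: "0 \<le> C" using D dG by (simp add: C_def)
    have "(\<integral>\<^sup>+x. ennreal (C * mv_normal_density 0 ?G x) \<partial>lborel)
        = ennreal C * (\<integral>\<^sup>+x. mv_normal_density 0 ?G x \<partial>lborel)"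
      using C by (simp add: ennreal_mult' nn_integral_cmult)
    then show "(\<integral>\<^sup>+x. ennreal (C * mv_normal_density 0 ?G x) \<partial>lborel) < \<infinity>"
      unfolding nn_integral_mv_normal_scaled_mat_1[OF e(1)] by simp
    show "AE x in lborel. (\<lambda>n. ?f n x) \<longlonglongrightarrow> ennreal (mv_normal_density 0 S0 x) * indicator A x"
    proof (intro AE_I2)
      fix x
      have c': "(\<lambda>n. S (n + N)) \<longlonglongrightarrow> S0" using conv by (rule LIMSEQ_ignore_initial_segment)
      have "(\<lambda>n. mv_normal_density 0 (S (n + N)) x) \<longlonglongrightarrow> mv_normal_density 0 S0 x"
        unfolding mv_normal_density_def
        using S0 spd_invertible[OF S0]
        by (intro tendsto_intros tendsto_det tendsto_matrix_inv_mult_vec c') (auto simp: spd_def)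
      then show "(\<lambda>n. ?f n x) \<longlonglongrightarrow> ennreal (mv_normal_density 0 S0 x) * indicator A x"
        by (auto intro!: tendsto_intros split: split_indicator)
    qed
  qed measurable
  then show ?thesis by (rule LIMSEQ_offset)
qed

lemma atMost_vec_borel [measurable]: "{..x :: real ^ 'n} \<in> sets borel"
proof -
  have "{..x} = {y. \<forall>i. y $ i \<le> x $ i}" by (auto simp: less_eq_vec_def)
  then show ?thesis using closed_interval_left_cart[of x] by simp
qed

lemma vec_cdf_mv_normal:
  "vec_cdf (mv_normal \<mu> S) x =
    enn2real (\<integral>\<^sup>+z. ennreal (mv_normal_density \<mu> S z) * indicator {..x} z \<partial>lborel)"
  by (simp add: vec_cdf_def mv_normal_def measure_def emeasure_density)

lemma vec_cdf_distr:
  assumes [measurable]: "Z \<in> borel_measurable M"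
  shows "vec_cdf (distr M borel Z) x = measure M {\<omega> \<in> space M. Z \<omega> \<le> x}"
  by (simp add: vec_cdf_def measure_distr vimage_def Int_def conj_commute)

lemma ennreal_le_one_minusI:
  assumes "0 \<le> a" "a \<le> 1" "ennreal a + c \<le> 1"
  shows "c \<le> ennreal (1 - a)"
proof (cases c)
  case (real r)
  then have "ennreal (a + r) \<le> ennreal 1" using assms by (simp add: ennreal_plus)
  then have "r \<le> 1 - a" by (subst (asm) ennreal_le_iff) auto
  then show ?thesis using real by (simp add: ennreal_leI)
next
  case top
  then show ?thesis using assms by (simp add: top_unique)
qed

section \<open>Sums of normal noise and their smoothed versions\<close>

locale normal_noise = prob_space M for M :: "'a measure" +
  fixes w :: "nat \<Rightarrow> 'a \<Rightarrow> real" and s :: real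
  assumes indep: "indep_vars (\<lambda>_. borel) w {1..}"
    and normal: "\<And>i. i \<ge> 1 \<Longrightarrow> distributed M lborel (w i) (normal_density 0 s)"
    and s_pos: "0 < s"
begin

lemma w_measurable: "i \<ge> 1 \<Longrightarrow> w i \<in> borel_measurable M"
  using normal[of i] by (simp add: distributed_def)

lemma indep_upto: "indep_vars (\<lambda>_. borel) w {1..n}"
  by (rule indep_vars_subset[OF indep]) auto

lemma smoothed_gaussian_integral:
  fixes c :: "nat \<Rightarrow> real ^ 'n"
  assumes "0 < e" "f \<in> borel_measurable borel"
  shows "(\<integral>\<^sup>+\<omega>. normal_integral (e\<^sup>2 *\<^sub>R mat 1) (\<lambda>x. f (x + (\<Sum>i=1..n. w i \<omega> *\<^sub>R c i))) \<partial>M)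
    = normal_integral (e\<^sup>2 *\<^sub>R mat 1 + (\<Sum>i=1..n. outer_product (s *\<^sub>R c i))) f"
  by (rule nn_integral_mv_normal_plus_sum[OF _ indep_upto normal s_pos spd_scaled_mat_1[OF assms(1)] assms(2)]) auto

text \<open>The constant test function in the smoothing identity yields the total mass, without
  evaluating a Gaussian integral for a general covariance.\<close>

lemma smoothed_gaussian_mass:
  fixes c :: "nat \<Rightarrow> real ^ 'n"
  assumes e: "0 < e"
  shows "normal_integral (e\<^sup>2 *\<^sub>R mat 1 + (\<Sum>i=1..n. outer_product (s *\<^sub>R c i))) (\<lambda>_. 1) = 1"
proof -
  have "normal_integral (e\<^sup>2 *\<^sub>R mat 1 :: real ^ 'n ^ 'n) (\<lambda>_. 1) = 1"
    unfolding mult_1_right by (rule nn_integral_mv_normal_scaled_mat_1[OF e])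
  then show ?thesis
    using smoothed_gaussian_integral[OF e, where f = "\<lambda>_. 1" and n = n and c = c]
    by (simp add: emeasure_space_1)
qed

text \<open>\<open>\<Phi>\<close> is the distribution function of \<open>W\<close> plus an
  independent isotropic normal vector. While that vector stays in the box of half-width
  \<open>d\<close>, whose mass is at least \<open>a\<close>, the sum differs from \<open>W\<close>
  by at most \<open>d\<close> in each coordinate.\<close>

lemma smoothed_gaussian_sum_bounds:
  fixes c :: "nat \<Rightarrow> real ^ 'n" and n :: nat
  assumes e: "0 < e" "e \<le> d"
  defines "W \<equiv> \<lambda>\<omega>. \<Sum>i=1..n. w i \<omega> *\<^sub>R c i"
    and "\<Phi> \<equiv> \<lambda>x. enn2real (normal_integral (e\<^sup>2 *\<^sub>R mat 1 + (\<Sum>i=1..n. outer_product (s *\<^sub>R c i))) (indicator {..x}))"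
    and "a \<equiv> (1 - e\<^sup>2 / d\<^sup>2) ^ CARD('n)"
  shows "a * prob {\<omega> \<in> space M. W \<omega> \<le> x} \<le> \<Phi> (x + (\<chi> i. d))"
    and "\<Phi> (x - (\<chi> i. d)) \<le> prob {\<omega> \<in> space M. W \<omega> \<le> x} + (1 - a)"
proof -
  let ?d = "(\<chi> i. d) :: real ^ 'n"
  let ?E = "{\<omega> \<in> space M. W \<omega> \<le> x}"
  let ?G = "e\<^sup>2 *\<^sub>R mat 1 :: real ^ 'n ^ 'n"
  let ?D = "\<lambda>z. ennreal (mv_normal_density 0 ?G z)"
  let ?J = "normal_integral ?G"
  let ?S = "?G + (\<Sum>i=1..n. outer_product (s *\<^sub>R c i))"
  let ?box = "{z :: real ^ 'n. \<forall>i. \<bar>z $ i\<bar> \<le> d}"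
  have [measurable]: "W \<in> borel_measurable M"
    unfolding W_def by (intro borel_measurable_sum borel_measurable_scaleR w_measurable) auto
  have "closed ?box" by (intro closed_Collect_all closed_Collect_le continuous_intros)
  then have [measurable]: "?box \<in> sets borel" by simp
  have G: "(\<integral>\<^sup>+\<omega>. (\<integral>\<^sup>+z. ?D z * f (z + W \<omega>) \<partial>lborel) \<partial>M)
    = normal_integral ?S f" if "f \<in> borel_measurable borel" for f
    unfolding W_def by (rule smoothed_gaussian_integral[OF e(1) that])
  have a01: "0 \<le> a" "a \<le> 1"
  proof -
    have "e\<^sup>2 / d\<^sup>2 \<le> 1" using e by (simp add: power_mono)
    then show "0 \<le> a" "a \<le> 1" by (auto simp: a_def power_le_one)
  qed
  have tot: "(\<integral>\<^sup>+z. ?D z \<partial>lborel) = 1" by (rule nn_integral_mv_normal_scaled_mat_1[OF e(1)])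
  have box: "ennreal a \<le> ?J (indicator ?box)"
    unfolding a_def by (rule mv_normal_scaled_mat_1_mass_near_0[OF e])
  have nbox: "?J (indicator (- ?box)) \<le> ennreal (1 - a)"
  proof -
    let ?b = "\<integral>\<^sup>+z. ?D z * indicator ?box z \<partial>lborel" and ?c = "\<integral>\<^sup>+z. ?D z * indicator (- ?box) z \<partial>lborel"
    have "?b + ?c = (\<integral>\<^sup>+z. ?D z \<partial>lborel)"
      by (subst nn_integral_add[symmetric]) (auto intro!: nn_integral_cong split: split_indicator)
    also have "\<dots> = 1" by (rule tot)
    finally have eq: "?b + ?c = 1" .
    have "ennreal a + ?c \<le> 1" using add_right_mono[OF box, of ?c] unfolding eq .
    then show ?thesis by (rule ennreal_le_one_minusI[OF a01])
  qed
  have le1: "(normal_integral ?S (indicator {..x})) \<le> 1" for x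
  proof -
    have "normal_integral ?S (indicator {..x})
      \<le> normal_integral ?S (\<lambda>z. 1)"
      by (intro nn_integral_mono mult_left_mono) (auto split: split_indicator)
    also have "\<dots> = 1"
      using smoothed_gaussian_mass[OF e(1), where n = n and c = c] by simp
    finally show ?thesis .
  qed
  have \<Phi>: "ennreal (\<Phi> x) = (\<integral>\<^sup>+\<omega>. (\<integral>\<^sup>+z. ?D z * indicator {..x} (z + W \<omega>) \<partial>lborel) \<partial>M)" for x
    unfolding \<Phi>_def G[OF borel_measurable_indicator[OF atMost_vec_borel]]
    using le1[of x] by (intro ennreal_enn2real) (auto simp: top_unique less_top[symmetric])
  have P: "ennreal (prob ?E) = (\<integral>\<^sup>+\<omega>. indicator ?E \<omega> \<partial>M)"
    by (simp add: emeasure_eq_measure)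
  have "ennreal (a * prob ?E) = (\<integral>\<^sup>+\<omega>. ennreal a * indicator ?E \<omega> \<partial>M)"
    using a01 by (simp add: ennreal_mult emeasure_eq_measure nn_integral_cmult)
  also have "\<dots> \<le> ennreal (\<Phi> (x + ?d))"
    unfolding \<Phi>
  proof (intro nn_integral_mono)
    fix \<omega>
    show "ennreal a * indicator ?E \<omega>
      \<le> ?J (\<lambda>z. indicator {..x + ?d} (z + W \<omega>))"
    proof (cases "W \<omega> \<le> x")
      case True
      have "z + W \<omega> \<le> x + ?d" if "z \<in> ?box" for z
        using True that by (auto simp: less_eq_vec_def abs_le_iff intro: add_mono) (smt (verit))
      then have "?J (indicator ?box)
        \<le> ?J (\<lambda>z. indicator {..x + ?d} (z + W \<omega>))"
        by (intro nn_integral_mono mult_left_mono) (auto simp: indicator_def)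
      then show ?thesis using box by (auto split: split_indicator)
    qed simp
  qed
  finally show "a * prob ?E \<le> \<Phi> (x + ?d)"
    by (simp add: \<Phi>_def ennreal_le_iff)
  have "ennreal (\<Phi> (x - ?d)) \<le> (\<integral>\<^sup>+\<omega>. indicator ?E \<omega> + ennreal (1 - a) \<partial>M)"
    unfolding \<Phi>
  proof (intro nn_integral_mono)
    fix \<omega> assume \<omega>: "\<omega> \<in> space M"
    show "?J (\<lambda>z. indicator {..x - ?d} (z + W \<omega>))
      \<le> indicator ?E \<omega> + ennreal (1 - a)"
    proof (cases "W \<omega> \<le> x")
      case True
      have "?J (\<lambda>z. indicator {..x - ?d} (z + W \<omega>)) \<le> (\<integral>\<^sup>+z. ?D z * 1 \<partial>lborel)"
        by (intro nn_integral_mono mult_left_mono) (auto split: split_indicator)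
      also have "\<dots> = 1" using tot by simp
      also have "\<dots> \<le> 1 + ennreal (1 - a)" by simp
      finally show ?thesis using True \<omega> by simp
    next
      case False
      have "z \<notin> ?box" if "z + W \<omega> \<le> x - ?d" for z
      proof
        assume "z \<in> ?box"
        then have "W \<omega> $ i \<le> x $ i" for i
          using that[unfolded less_eq_vec_def] by (auto simp: abs_le_iff dest!: spec[of _ i])
        then show False using False by (simp add: less_eq_vec_def)
      qed
      then have "?J (\<lambda>z. indicator {..x - ?d} (z + W \<omega>))
        \<le> ?J (indicator (- ?box))"
        by (intro nn_integral_mono mult_left_mono) (auto simp: indicator_def)
      then show ?thesis using nbox False by (auto intro: order_trans)
    qed
  qed
  also have "\<dots> = ennreal (prob ?E + (1 - a))"
    using a01 by (subst nn_integral_add) (auto simp: emeasure_eq_measure emeasure_space_1 ennreal_plus prob_space)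
  finally show "\<Phi> (x - ?d) \<le> prob ?E + (1 - a)"
    using a01 by (subst (asm) ennreal_le_iff) auto
qed

end

lemma spd_plus_sum_outer_product:
  "finite J \<Longrightarrow> spd S \<Longrightarrow> spd (S + (\<Sum>i\<in>J. outer_product (c i)))"
proof (induction J arbitrary: S rule: finite_induct)
  case (insert a J)
  have "spd (S + outer_product (c a) + (\<Sum>i\<in>J. outer_product (c i)))"
    using insert.prems by (intro insert.IH spd_plus_outer_product)
  then show ?case using insert(1,2) by (simp add: add.assoc)
qed simp

context normal_noise
begin

text \<open>A sandwich: \<open>Z n\<close> is replaced by \<open>W n\<close> up to the probability
  \<open>q n\<close> that they are more than \<open>d\<close> apart, and \<open>W n\<close> by its
  smoothed version up to \<open>1 - a n\<close>. The smoothed law is an explicit normal law whose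
  covariance tends to \<open>S0\<close>.\<close>

lemma converges_in_distribution_gaussian_sum:
  fixes c :: "nat \<Rightarrow> nat \<Rightarrow> real ^ 'n" and Z :: "nat \<Rightarrow> 'a \<Rightarrow> real ^ 'n"
  assumes cov: "(\<lambda>n. \<Sum>i=1..n. outer_product (s *\<^sub>R c n i)) \<longlonglongrightarrow> S0" and S0: "spd S0"
    and Z [measurable]: "\<And>n. Z n \<in> borel_measurable M"
    and close: "\<And>d. 0 < d \<Longrightarrow>
      (\<lambda>n. prob {\<omega> \<in> space M. \<not> norm (Z n \<omega> - (\<Sum>i=1..n. w i \<omega> *\<^sub>R c n i)) \<le> d}) \<longlonglongrightarrow> 0"
  shows "converges_in_distribution M Z (mv_normal 0 S0)"
  unfolding converges_in_distribution_def vec_weak_conv_def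
proof (intro allI impI)
  fix x assume cont: "isCont (vec_cdf (mv_normal 0 S0)) x"
  let ?F = "vec_cdf (mv_normal 0 S0)"
  define W where "W = (\<lambda>n \<omega>. \<Sum>i=1..n. w i \<omega> *\<^sub>R c n i)"
  \<comment> \<open>The smoothing scale tends to 0 but stays positive, so every \<open>S n\<close>
    is positive definite even where the plain covariance is singular.\<close>
  define e where "e = (\<lambda>n. 1 / real (Suc n))"
  have e: "0 < e n" for n by (simp add: e_def)
  have e0: "e \<longlonglongrightarrow> 0" unfolding e_def by (rule LIMSEQ_Suc[OF lim_1_over_n])
  define S where "S = (\<lambda>n. (e n)\<^sup>2 *\<^sub>R mat 1 + (\<Sum>i=1..n. outer_product (s *\<^sub>R c n i)))"
  define \<Phi> where "\<Phi> = (\<lambda>n x. vec_cdf (mv_normal 0 (S n)) x)"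
  have [measurable]: "W n \<in> borel_measurable M" for n
    unfolding W_def by (intro borel_measurable_sum borel_measurable_scaleR w_measurable) auto
  have spdS: "spd (S n)" for n
    unfolding S_def by (intro spd_plus_sum_outer_product spd_scaled_mat_1 e) simp
  have "S \<longlonglongrightarrow> 0\<^sup>2 *\<^sub>R mat 1 + S0"
    unfolding S_def by (intro tendsto_intros e0 cov)
  then have Sconv: "S \<longlonglongrightarrow> S0" by simp
  \<comment> \<open>The limit density has mass 1 as a limit of masses equal to 1; finiteness is what
    continuity of \<open>enn2real\<close> requires.\<close>
  have fin: "normal_integral S0 (indicator {..y}) \<noteq> \<infinity>" for y
  proof -
    have "normal_integral (S n) (\<lambda>_. 1) = 1" for n
      unfolding S_def by (rule smoothed_gaussian_mass[OF e])
    then have "(\<lambda>n. 1) \<longlonglongrightarrow> (\<integral>\<^sup>+z. ennreal (mv_normal_density 0 S0 z) \<partial>lborel)"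
      using tendsto_nn_integral_mv_normal[OF Sconv spdS S0, of UNIV] by simp
    then have 1: "(\<integral>\<^sup>+z. ennreal (mv_normal_density 0 S0 z) \<partial>lborel) = 1"
      by (simp add: LIMSEQ_const_iff)
    have "normal_integral S0 (indicator {..y})
        \<le> (\<integral>\<^sup>+z. ennreal (mv_normal_density 0 S0 z) \<partial>lborel)"
      by (intro nn_integral_mono) (auto split: split_indicator)
    then show ?thesis unfolding 1 by (auto simp: top_unique)
  qed
  have \<Phi>conv: "(\<lambda>n. \<Phi> n y) \<longlonglongrightarrow> ?F y" for y
    unfolding \<Phi>_def vec_cdf_mv_normal
    using fin[of y] tendsto_nn_integral_mv_normal[OF Sconv spdS S0 atMost_vec_borel[of y]]
    by (intro tendsto_enn2real) (auto simp: less_top)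
  define P where "P = (\<lambda>n. prob {\<omega> \<in> space M. Z n \<omega> \<le> x})"
  have "\<forall>\<^sub>F n in sequentially. dist (P n) (?F x) < \<eta>" if \<eta>: "0 < \<eta>" for \<eta>
  proof -
    obtain r where r: "0 < r" "\<And>z. dist z x < r \<Longrightarrow> dist (?F z) (?F x) < \<eta> / 4"
      using cont \<eta> unfolding continuous_at_eps_delta by (metis zero_less_divide_iff zero_less_numeral)
    \<comment> \<open>The corner moves by \<open>d\<close> twice, once for the distance from
      \<open>Z n\<close> to \<open>W n\<close> and once for the smoothing; the factor 4 and the
      dimension keep the total shift within \<open>r / 2\<close>.\<close>
    define d where "d = r / (4 * real CARD('n))"
    let ?t = "(\<chi> i. 2 * d) :: real ^ 'n"
    have "norm (?t :: real ^ 'n) \<le> r / 2"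
      using norm_le_l1_cart[of "?t :: real ^ 'n"] r(1) by (simp add: d_def)
    then have d: "dist (?F (x + ?t)) (?F x) < \<eta> / 4"
      "dist (?F (x - ?t)) (?F x) < \<eta> / 4" "0 < d"
      using r by (auto simp: dist_norm d_def intro!: r(2))
    define a where "a = (\<lambda>n. (1 - (e n)\<^sup>2 / d\<^sup>2) ^ CARD('n))"
    define q where "q = (\<lambda>n. prob {\<omega> \<in> space M. \<not> norm (Z n \<omega> - W n \<omega>) \<le> d})"
    have "a \<longlonglongrightarrow> (1 - 0\<^sup>2 / d\<^sup>2) ^ CARD('n)"
      unfolding a_def using d(3) by (intro tendsto_intros e0) auto
    then have a1: "a \<longlonglongrightarrow> 1" by simp
    have q0: "q \<longlonglongrightarrow> 0" unfolding q_def W_def by (rule close[OF d(3)])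
    have ee: "\<forall>\<^sub>F n in sequentially. e n < d" using order_tendstoD(2)[OF e0 d(3)] .
    have bounds: "P n \<le> \<Phi> n (x + ?t) + (1 - a n) + q n"
      "\<Phi> n (x - ?t) \<le> P n + (1 - a n) + q n" if "e n < d" for n
    proof -
      let ?d = "(\<chi> i. d) :: real ^ 'n"
      let ?far = "{\<omega> \<in> space M. \<not> norm (Z n \<omega> - W n \<omega>) \<le> d}"
      have "(e n)\<^sup>2 / d\<^sup>2 \<le> 1" using e[of n] that by (simp add: power_mono)
      then have a01: "0 \<le> a n" "a n \<le> 1" by (auto simp: a_def power_le_one)
      have sm: "a n * prob {\<omega> \<in> space M. W n \<omega> \<le> y} \<le> \<Phi> n (y + ?d)"
        "\<Phi> n (y - ?d) \<le> prob {\<omega> \<in> space M. W n \<omega> \<le> y} + (1 - a n)" for y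
        using smoothed_gaussian_sum_bounds[where e = "e n" and d = d and n = n and c = "c n" and x = y] e[of n] that
        by (simp_all add: W_def \<Phi>_def S_def vec_cdf_mv_normal a_def)
      have x2: "x + ?d + ?d = x + ?t" "x - ?d - ?d = x - ?t"
        by (simp_all add: vec_eq_iff)
      have cmp: "norm v \<le> d \<Longrightarrow> \<bar>v $ i\<bar> \<le> d" for v :: "real ^ 'n" and i
        using component_le_norm_cart[of v i] by linarith
      have mle: "{\<omega> \<in> space M. V \<omega> \<le> y} \<in> events" if "V \<in> borel_measurable M" for V :: "'a \<Rightarrow> real ^ 'n" and y
        using measurable_sets[OF that atMost_vec_borel[of y]] by (simp add: vimage_def Int_def conj_commute)
      have mfar: "?far \<in> events" by measurable
      have shift: "u \<le> y + ?d" if "norm (v - u) \<le> d" "v \<le> y" for u v y :: "real ^ 'n"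
        unfolding less_eq_vec_def
      proof
        fix i
        show "u $ i \<le> (y + ?d) $ i"
          using cmp[OF that(1), of i] that(2)[unfolded less_eq_vec_def, rule_format, of i] by simp
      qed
      have "P n \<le> prob ({\<omega> \<in> space M. W n \<omega> \<le> x + ?d} \<union> ?far)"
        unfolding P_def
        by (intro finite_measure_mono sets.Un mle mfar) (use shift in auto)
      also have "\<dots> \<le> prob {\<omega> \<in> space M. W n \<omega> \<le> x + ?d} + q n"
        unfolding q_def by (intro measure_Un_le mle mfar) measurable
      finally have 1: "P n \<le> prob {\<omega> \<in> space M. W n \<omega> \<le> x + ?d} + q n" .
      let ?p = "prob {\<omega> \<in> space M. W n \<omega> \<le> x + ?d}"
      have "(1 - a n) * ?p \<le> (1 - a n) * 1" using a01 by (intro mult_left_mono) auto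
      then have "?p \<le> a n * ?p + (1 - a n)" by (simp add: algebra_simps)
      then show "P n \<le> \<Phi> n (x + ?t) + (1 - a n) + q n"
        using 1 sm(1)[of "x + ?d"] unfolding x2 by linarith
      have "prob {\<omega> \<in> space M. W n \<omega> \<le> x - ?d}
        \<le> prob ({\<omega> \<in> space M. Z n \<omega> \<le> x} \<union> ?far)"
      proof (intro finite_measure_mono sets.Un mle mfar subsetI)
        fix \<omega> assume "\<omega> \<in> {\<omega> \<in> space M. W n \<omega> \<le> x - ?d}"
        then show "\<omega> \<in> {\<omega> \<in> space M. Z n \<omega> \<le> x} \<union> ?far"
          using shift[of "W n \<omega>" "Z n \<omega>" "x - ?d"] by (auto simp: norm_minus_commute)
      qed measurable
      also have "\<dots> \<le> P n + q n"
        unfolding q_def P_def by (intro measure_Un_le mle mfar) measurable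
      finally show "\<Phi> n (x - ?t) \<le> P n + (1 - a n) + q n"
        using sm(2)[of "x - ?d"] unfolding x2 by linarith
    qed
    \<comment> \<open>Together with the continuity of the limit at \<open>x\<close>, each side of
      the sandwich collects four errors below a quarter of \<open>\<eta>\<close>.\<close>
    have ev: "\<forall>\<^sub>F n in sequentially. dist (\<Phi> n (x + ?t)) (?F (x + ?t)) < \<eta> / 4"
      "\<forall>\<^sub>F n in sequentially. dist (\<Phi> n (x - ?t)) (?F (x - ?t)) < \<eta> / 4"
      "\<forall>\<^sub>F n in sequentially. dist (a n) 1 < \<eta> / 4" "\<forall>\<^sub>F n in sequentially. dist (q n) 0 < \<eta> / 4"
      by (rule tendstoD[OF \<Phi>conv] tendstoD[OF a1] tendstoD[OF q0], use \<eta> in simp)+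
    show ?thesis
      using ee ev
    proof eventually_elim
      case (elim n)
      show ?case using bounds(1)[OF elim(1)] bounds(2)[OF elim(1)] elim(2-5) d(1,2)
        unfolding dist_real_def by linarith
    qed
  qed
  then have "P \<longlonglongrightarrow> ?F x" by (rule tendstoI)
  then show "(\<lambda>n. vec_cdf (distr M borel (Z n)) x) \<longlonglongrightarrow> ?F x"
    by (simp add: vec_cdf_distr P_def)
qed

end

section \<open>A strong law of large numbers\<close>

text \<open>Lets a fourth moment control every lower one.\<close>

lemma abs_power_le_one_plus_fourth:
  fixes x :: real
  assumes "k \<le> 4"
  shows "\<bar>x ^ k\<bar> \<le> 1 + x ^ 4"
proof (cases "\<bar>x\<bar> \<le> 1")
  case True
  then have "\<bar>x\<bar> ^ k \<le> 1" by (simp add: power_le_one)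
  then show ?thesis by (simp add: power_abs add_increasing2)
next
  case False
  then have "\<bar>x\<bar> ^ k \<le> \<bar>x\<bar> ^ 4" using assms by (intro power_increasing) auto
  then show ?thesis by (simp add: power_abs)
qed

lemma (in finite_measure) integrable_lower_power:
  fixes X :: "'a \<Rightarrow> real"
  assumes [measurable]: "X \<in> borel_measurable M" and int: "integrable M (\<lambda>\<omega>. X \<omega> ^ 4)" and k: "k \<le> 4"
  shows "integrable M (\<lambda>\<omega>. X \<omega> ^ k)"
  by (rule Bochner_Integration.integrable_bound[of _ "\<lambda>\<omega>. 1 + X \<omega> ^ 4"])
     (use int abs_power_le_one_plus_fourth[OF k] in auto)

lemma (in prob_space) indep_var_power:
  fixes X Y :: "'a \<Rightarrow> real"
  assumes iv: "indep_var borel X borel Y"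
    and X: "integrable M (\<lambda>\<omega>. X \<omega> ^ 4)" and Y: "integrable M (\<lambda>\<omega>. Y \<omega> ^ 4)"
    and jk: "j \<le> 4" "k \<le> 4"
  shows "integrable M (\<lambda>\<omega>. X \<omega> ^ j * Y \<omega> ^ k)"
    and "expectation (\<lambda>\<omega>. X \<omega> ^ j * Y \<omega> ^ k) = expectation (\<lambda>\<omega>. X \<omega> ^ j) * expectation (\<lambda>\<omega>. Y \<omega> ^ k)"
proof -
  have m: "X \<in> borel_measurable M" "Y \<in> borel_measurable M"
    using iv by (auto dest: indep_var_rv1 indep_var_rv2)
  have iv': "indep_var borel (\<lambda>\<omega>. X \<omega> ^ j) borel (\<lambda>\<omega>. Y \<omega> ^ k)"
    using indep_var_compose[OF iv, of "\<lambda>x. x ^ j" borel "\<lambda>x. x ^ k" borel] by (simp add: comp_def)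
  show "integrable M (\<lambda>\<omega>. X \<omega> ^ j * Y \<omega> ^ k)"
    by (rule indep_var_integrable[OF iv']) (auto intro: integrable_lower_power m X Y jk)
  show "expectation (\<lambda>\<omega>. X \<omega> ^ j * Y \<omega> ^ k) = expectation (\<lambda>\<omega>. X \<omega> ^ j) * expectation (\<lambda>\<omega>. Y \<omega> ^ k)"
    by (rule indep_var_lebesgue_integral[OF iv']) (auto intro: integrable_lower_power m X Y jk)
qed

text \<open>The new variable and the sum so far are independent and centred, so the expanded fourth
  power keeps only the two fourth moments and six times the product of second moments. That product
  forces the second-moment bound into the same induction, where \<open>1 + C\<close> bounds a second
  moment through the fourth.\<close>

lemma (in prob_space) sum_fourth_moment_bound:
  fixes X :: "nat \<Rightarrow> 'a \<Rightarrow> real"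
  assumes ind: "indep_vars (\<lambda>_. borel) X {1..}"
    and int: "\<And>i. i \<ge> 1 \<Longrightarrow> integrable M (\<lambda>\<omega>. X i \<omega> ^ 4)"
    and bd: "\<And>i. i \<ge> 1 \<Longrightarrow> expectation (\<lambda>\<omega>. X i \<omega> ^ 4) \<le> C"
    and mean: "\<And>i. i \<ge> 1 \<Longrightarrow> expectation (X i) = 0"
  defines "S \<equiv> \<lambda>n \<omega>. \<Sum>i=1..n. X i \<omega>"
  shows "integrable M (\<lambda>\<omega>. S n \<omega> ^ 4) \<and> expectation (S n) = 0 \<and>
    expectation (\<lambda>\<omega>. S n \<omega> ^ 2) \<le> real n * (1 + C) \<and>
    expectation (\<lambda>\<omega>. S n \<omega> ^ 4) \<le> 7 * (1 + C)\<^sup>2 * (real n)\<^sup>2"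
proof (induction n)
  case 0
  show ?case by (simp add: S_def)
next
  case (Suc n)
  let ?Y = "X (Suc n)"
  let ?E = "\<lambda>Z k. expectation (\<lambda>\<omega>. Z \<omega> ^ k)"
  have IH: "integrable M (\<lambda>\<omega>. S n \<omega> ^ 4)" "expectation (S n) = 0"
    "?E (S n) 2 \<le> real n * (1 + C)"
    "?E (S n) 4 \<le> 7 * (1 + C)\<^sup>2 * (real n)\<^sup>2" using Suc by auto
  have mX: "X i \<in> borel_measurable M" if "i \<ge> 1" for i
    using ind that by (auto simp: indep_vars_def)
  have iY: "integrable M (\<lambda>\<omega>. ?Y \<omega> ^ 4)" and mY: "?Y \<in> borel_measurable M" by (auto intro: int mX)
  have mS: "S n \<in> borel_measurable M"
    unfolding S_def by (intro borel_measurable_sum) (auto intro: mX)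
  have "indep_vars (\<lambda>_. borel) X (insert (Suc n) {1..n})" by (rule indep_vars_subset[OF ind]) auto
  then have "indep_var borel ?Y borel (S n)"
    unfolding S_def by (intro indep_vars_sum) auto
  note I = indep_var_power[OF this iY IH(1)]
  have S: "S (Suc n) \<omega> = ?Y \<omega> + S n \<omega>" for \<omega> by (simp add: S_def)
  \<comment> \<open>The exponents 0 and 1 are kept so that every term has the shape of
    \<open>indep_var_power\<close>.\<close>
  have s4: "S (Suc n) \<omega> ^ 4 = ?Y \<omega> ^ 4 * S n \<omega> ^ 0 + 4 * (?Y \<omega> ^ 3 * S n \<omega> ^ 1) + 6 * (?Y \<omega> ^ 2 * S n \<omega> ^ 2)
      + 4 * (?Y \<omega> ^ 1 * S n \<omega> ^ 3) + ?Y \<omega> ^ 0 * S n \<omega> ^ 4" for \<omega>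
    unfolding S by algebra
  have s2: "S (Suc n) \<omega> ^ 2 = ?Y \<omega> ^ 2 * S n \<omega> ^ 0 + 2 * (?Y \<omega> ^ 1 * S n \<omega> ^ 1) + ?Y \<omega> ^ 0 * S n \<omega> ^ 2" for \<omega>
    unfolding S by algebra
  have Y0: "?E ?Y 1 = 0" "?E (S n) 1 = 0"
    using mean[of "Suc n"] IH(2) by simp_all
  have Z: "expectation (\<lambda>\<omega>. ?Y \<omega> ^ 3 * S n \<omega>) = 0" "expectation (\<lambda>\<omega>. ?Y \<omega> * S n \<omega> ^ 3) = 0"
    "expectation (\<lambda>\<omega>. ?Y \<omega> * S n \<omega>) = 0"
    using I(2)[of 3 1] I(2)[of 1 3] I(2)[of 1 1] Y0 by simp_all
  have E4: "?E (S (Suc n)) 4 = ?E ?Y 4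
      + 6 * (?E ?Y 2 * ?E (S n) 2) + ?E (S n) 4"
    unfolding s4
    by (subst Bochner_Integration.integral_add | intro Bochner_Integration.integrable_add integrable_mult_right I(1) | simp del: power_0 power_one_right power_Suc)+
       (simp add: I(2) Z Y0)
  have E2: "?E (S (Suc n)) 2 = ?E ?Y 2 + ?E (S n) 2"
    unfolding s2
    by (subst Bochner_Integration.integral_add | intro Bochner_Integration.integrable_add integrable_mult_right I(1) | simp del: power_0 power_one_right power_Suc)+
       (simp add: I(2) Z Y0)
  have "integrable M (\<lambda>\<omega>. S (Suc n) \<omega> ^ 4)"
    unfolding s4 by (intro Bochner_Integration.integrable_add integrable_mult_right I(1)) auto
  moreover have "expectation (S (Suc n)) = 0"
  proof -
    have "integrable M ?Y" "integrable M (S n)"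
      using integrable_lower_power[OF mY iY, of 1] integrable_lower_power[OF mS IH(1), of 1] by auto
    then show ?thesis using mean[of "Suc n"] IH(2) by (simp add: S[abs_def])
  qed
  moreover have Y4: "0 \<le> ?E ?Y 4" "?E ?Y 4 \<le> C"
    using bd[of "Suc n"] by auto
  have Y2: "0 \<le> ?E ?Y 2" "?E ?Y 2 \<le> 1 + C"
  proof -
    have "?E ?Y 2 \<le> expectation (\<lambda>\<omega>. 1 + ?Y \<omega> ^ 4)"
      using iY integrable_lower_power[OF mY iY, of 2] abs_power_le_one_plus_fourth[of 2]
      by (intro integral_mono) (auto simp: abs_le_iff)
    also have "\<dots> \<le> 1 + C" using iY Y4 by (simp add: prob_space)
    finally show "?E ?Y 2 \<le> 1 + C" .
  qed simp
  then have "?E (S (Suc n)) 2 \<le> real (Suc n) * (1 + C)"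
    unfolding E2 using IH(3) by (simp add: algebra_simps)
  moreover have "?E (S (Suc n)) 4 \<le> 7 * (1 + C)\<^sup>2 * (real (Suc n))\<^sup>2"
  proof -
    define D where "D = 1 + C"
    have D: "1 \<le> D" "C \<le> D\<^sup>2" using order_trans[OF Y4] by (auto simp: D_def power2_eq_square algebra_simps intro: add_nonneg_nonneg)
    have "?E ?Y 2 * ?E (S n) 2 \<le> D * (real n * D)"
      using Y2 IH(3) D by (intro mult_mono) (auto simp: D_def)
    then have "?E (S (Suc n)) 4 \<le> D\<^sup>2 + 6 * (D * (real n * D)) + 7 * D\<^sup>2 * (real n)\<^sup>2"
      unfolding E4 using IH(4) Y4 D by (simp add: D_def)
    also have "\<dots> = D\<^sup>2 * (1 + 6 * real n + 7 * (real n)\<^sup>2)"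
      by (simp add: power2_eq_square algebra_simps)
    \<comment> \<open>The constant 7 closes the recursion: passing from \<open>n\<close> to
      \<open>n + 1\<close> adds \<open>14 * n + 7\<close> on the right, at least the
      \<open>6 * n + 1\<close> to be covered.\<close>
    also have "\<dots> \<le> D\<^sup>2 * (7 * (real (Suc n))\<^sup>2)"
      by (intro mult_left_mono) (auto simp: power2_eq_square algebra_simps)
    finally show ?thesis by (simp add: D_def mult_ac)
  qed
  ultimately show ?case by blast
qed

text \<open>The fourth moment of the mean of \<open>n\<close> variables is of order
  \<open>1 / n\<^sup>2\<close>, hence summable; so the series of fourth powers is almost surely
  finite and its terms tend to 0. Only a common moment bound enters, which allows deterministic
  weights later.\<close>

lemma (in prob_space) slln_fourth_moment:
  fixes X :: "nat \<Rightarrow> 'a \<Rightarrow> real"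
  assumes ind: "indep_vars (\<lambda>_. borel) X {1..}"
    and int: "\<And>i. i \<ge> 1 \<Longrightarrow> integrable M (\<lambda>\<omega>. X i \<omega> ^ 4)"
    and bd: "\<And>i. i \<ge> 1 \<Longrightarrow> expectation (\<lambda>\<omega>. X i \<omega> ^ 4) \<le> C"
    and mean: "\<And>i. i \<ge> 1 \<Longrightarrow> expectation (X i) = 0"
  shows "AE \<omega> in M. (\<lambda>n. (\<Sum>i=1..n. X i \<omega>) / real n) \<longlonglongrightarrow> 0"
proof -
  define S where "S = (\<lambda>n \<omega>. \<Sum>i=1..n. X i \<omega>)"
  define Y where "Y = (\<lambda>n \<omega>. (S (Suc n) \<omega> / real (Suc n)) ^ 4)"
  have B: "integrable M (\<lambda>\<omega>. S n \<omega> ^ 4)" "expectation (\<lambda>\<omega>. S n \<omega> ^ 4) \<le> 7 * (1 + C)\<^sup>2 * (real n)\<^sup>2" for n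
    unfolding S_def using sum_fourth_moment_bound[OF ind int bd mean, of n] by auto
  have [measurable]: "X i \<in> borel_measurable M" if "i \<in> {1..n}" for i n
    using ind that by (auto simp: indep_vars_def)
  have [measurable]: "S n \<in> borel_measurable M" for n unfolding S_def by measurable
  have [measurable]: "Y n \<in> borel_measurable M" for n unfolding Y_def by measurable
  have iY: "integrable M (Y n)" for n
    using B(1)[of "Suc n"] unfolding Y_def power_divide by (intro integrable_divide_zero)
  have Yb: "expectation (Y n) \<le> 7 * (1 + C)\<^sup>2 * (1 / (real (Suc n))\<^sup>2)" for n
  proof -
    have "expectation (Y n) = expectation (\<lambda>\<omega>. S (Suc n) \<omega> ^ 4) / real (Suc n) ^ 4"
      by (simp add: Y_def power_divide del: of_nat_Suc)
    also have "\<dots> \<le> 7 * (1 + C)\<^sup>2 * (real (Suc n))\<^sup>2 / real (Suc n) ^ 4"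
      using B[of "Suc n"] by (intro divide_right_mono) auto
    also have "\<dots> = 7 * (1 + C)\<^sup>2 * (1 / (real (Suc n))\<^sup>2)"
      by (simp add: power4_eq_xxxx power2_eq_square field_simps del: of_nat_Suc)
    finally show ?thesis .
  qed
  have "summable (\<lambda>n. 1 / (real (Suc n))\<^sup>2)"
    using inverse_power_summable[of 2, where 'a = real] summable_Suc_iff[of "\<lambda>n. inverse (real n ^ 2)"]
    by (simp add: divide_inverse del: of_nat_Suc)
  then have sm: "summable (\<lambda>n. expectation (Y n))"
    by (rule summable_comparison_test'[OF summable_mult, where N = 0]) (use Yb in \<open>auto simp: Y_def\<close>)
  have "(\<integral>\<^sup>+\<omega>. (\<Sum>n. ennreal (Y n \<omega>)) \<partial>M) = (\<Sum>n. \<integral>\<^sup>+\<omega>. ennreal (Y n \<omega>) \<partial>M)"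
    by (rule nn_integral_suminf) measurable
  also have "\<dots> = (\<Sum>n. ennreal (expectation (Y n)))"
    using iY by (intro suminf_cong nn_integral_eq_integral) (auto simp: Y_def)
  also have "\<dots> \<noteq> \<infinity>"
    using sm by (simp add: suminf_ennreal2 Y_def)
  finally have "AE \<omega> in M. (\<Sum>n. ennreal (Y n \<omega>)) \<noteq> \<infinity>"
    by (intro nn_integral_PInf_AE) measurable
  then show ?thesis
  proof eventually_elim
    case (elim \<omega>)
    then have "summable (\<lambda>n. Y n \<omega>)"
      by (intro summable_suminf_not_top) (auto simp: Y_def)
    then have "(\<lambda>n. (S (Suc n) \<omega> / real (Suc n)) ^ 4) \<longlonglongrightarrow> 0"
      unfolding Y_def by (rule summable_LIMSEQ_zero)
    then have "(\<lambda>n. S (Suc n) \<omega> / real (Suc n)) \<longlonglongrightarrow> 0"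
      by (subst (asm) power_tendsto_0_iff) auto
    then show ?case unfolding S_def by (rule LIMSEQ_imp_Suc)
  qed
qed

section \<open>Weakly convergent point sequences\<close>

definition avg :: "nat \<Rightarrow> (nat \<Rightarrow> real) \<Rightarrow> real" where
  "avg n f = (\<Sum>i=1..n. f i) / real n"

lemma avg_add: "avg n (\<lambda>i. f i + g i) = avg n f + avg n g"
  by (simp add: avg_def sum.distrib add_divide_distrib)

lemma avg_cmult: "avg n (\<lambda>i. c * f i) = c * avg n f"
  by (simp add: avg_def sum_distrib_left)

lemma avg_const: "n \<ge> 1 \<Longrightarrow> avg n (\<lambda>i. c) = c"
  by (simp add: avg_def)

lemma avg_mono: "(\<And>i. 1 \<le> i \<Longrightarrow> i \<le> n \<Longrightarrow> f i \<le> g i) \<Longrightarrow> avg n f \<le> avg n g"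
  unfolding avg_def by (intro divide_right_mono sum_mono) auto

lemma avg_cong: "(\<And>i. 1 \<le> i \<Longrightarrow> i \<le> n \<Longrightarrow> f i = g i) \<Longrightarrow> avg n f = avg n g"
  unfolding avg_def by (intro arg_cong2[where f = "(/)"] sum.cong refl) auto

lemma avg_diff: "avg n (\<lambda>i. f i - g i) = avg n f - avg n g"
  by (simp add: avg_def sum_subtractf diff_divide_distrib)

lemma abs_avg_le: "\<bar>avg n f\<bar> \<le> avg n (\<lambda>i. \<bar>f i\<bar>)"
  by (auto simp: avg_def abs_divide intro!: divide_right_mono sum_abs)

lemma avg_diff_le:
  assumes "\<And>i. 1 \<le> i \<Longrightarrow> i \<le> n \<Longrightarrow> \<bar>f i - g i\<bar> \<le> h i"
  shows "\<bar>avg n f - avg n g\<bar> \<le> avg n h"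
  unfolding avg_diff[symmetric] by (rule order_trans[OF abs_avg_le avg_mono[OF assms]])

text \<open>For \<open>n = 0\<close> the average is 0 because division by zero gives 0; this case is
  where \<open>0 \<le> c\<close> enters.\<close>

lemma avg_le_const:
  assumes "0 \<le> c" and f: "\<And>i. 1 \<le> i \<Longrightarrow> i \<le> n \<Longrightarrow> f i \<le> c"
  shows "avg n f \<le> c"
proof (cases "n = 0")
  case True
  then show ?thesis using assms(1) by (simp add: avg_def)
next
  case False
  have "avg n f \<le> avg n (\<lambda>_. c)" by (rule avg_mono[OF f])
  then show ?thesis using False by (simp add: avg_const)
qed

lemma avg_abs_le:
  assumes "avg n (\<lambda>i. w i ^ 4) \<le> B"
  shows "avg n (\<lambda>i. \<bar>w i\<bar>) \<le> 1 + B"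
proof -
  have "avg n (\<lambda>i. \<bar>w i\<bar>) \<le> avg n (\<lambda>i. 1 + w i ^ 4)"
    using abs_power_le_one_plus_fourth[of 1] by (intro avg_mono) auto
  also have "\<dots> \<le> 1 + B" using assms avg_le_const[of 1 n "\<lambda>_. 1"] by (simp add: avg_add)
  finally show ?thesis .
qed

locale weakly_convergent_points = prob_space \<mu>
  for \<mu> :: "(real ^ 'm) measure" +
  fixes p :: "nat \<Rightarrow> real ^ 'm" and P :: "(real ^ 'm) set"
  assumes sets_mu [measurable_cong]: "sets \<mu> = sets borel"
    and weak_conv: "vec_weak_conv (empirical_cdf p) (vec_cdf \<mu>)"
    and compact_P: "compact P" and p_in_P: "\<And>i. i \<ge> 1 \<Longrightarrow> p i \<in> P"
begin

lemma space_mu [simp]: "space \<mu> = UNIV"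
  using sets_eq_imp_space_eq[OF sets_mu] by simp

lemma measurable_nth [measurable]: "(\<lambda>s :: real ^ 'm. s $ j) \<in> borel_measurable borel"
  by (intro borel_measurable_continuous_onI continuous_intros)

text \<open>\<open>c\<close> is not an atom of any coordinate marginal. Corners with such
  coordinates are continuity points of the distribution function, where convergence is
  given.\<close>

definition good :: "real \<Rightarrow> bool" where
  "good c \<longleftrightarrow> (\<forall>j. measure \<mu> {s. s $ j = c} = 0)"

text \<open>Each of the finitely many marginals has countably many atoms, and an open interval is
  uncountable.\<close>

lemma ex_good:
  assumes "a < b"
  shows "\<exists>c. a < c \<and> c < b \<and> good c"
proof -
  have "countable {c. measure \<mu> {s. s $ j = c} > 0}" for j
  proof -
    interpret D: real_distribution "distr \<mu> borel (\<lambda>s. s $ j)"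
      by (intro real_distribution.intro prob_space_distr) (auto simp: real_distribution_axioms_def)
    have "measure (distr \<mu> borel (\<lambda>s. s $ j)) {c} = measure \<mu> {s. s $ j = c}" for c
      by (subst measure_distr) (auto simp: vimage_def)
    then show ?thesis using D.countable_atoms by simp
  qed
  then have "countable (\<Union>j. {c. measure \<mu> {s. s $ j = c} > 0})"
    by (intro countable_UN) auto
  moreover have "(\<Union>j. {c. measure \<mu> {s. s $ j = c} > 0}) = {c. \<not> good c}"
    by (auto simp: good_def zero_less_measure_iff)
  ultimately have "\<not> {a<..<b} \<subseteq> {c. \<not> good c}"
    using assms uncountable_open_interval[of a b] countable_subset by metis
  then show ?thesis by auto
qed

text \<open>The indicator at \<open>s\<close> can fail to converge as the corner moves only if
  \<open>s\<close> shares a coordinate with \<open>x\<close>, and such points form a null set. The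
  rest is dominated convergence along sequences.\<close>

lemma isCont_vec_cdf:
  assumes "\<And>j. good (x $ j)"
  shows "isCont (vec_cdf \<mu>) x"
  unfolding continuous_at_sequentially comp_def
proof (intro allI impI)
  fix y :: "nat \<Rightarrow> real ^ 'm" assume y: "y \<longlonglongrightarrow> x"
  have "AE s in \<mu>. s $ j \<noteq> x $ j" for j
  proof -
    have "{s. s $ j = x $ j} \<in> null_sets \<mu>"
      using assms[of j] by (auto simp: good_def null_sets_def emeasure_eq_measure)
    then show ?thesis by (rule AE_I') auto
  qed
  then have "AE s in \<mu>. \<forall>j. s $ j \<noteq> x $ j" by (simp add: AE_all_countable)
  then have "AE s in \<mu>. (\<lambda>n. indicator {..y n} s :: real) \<longlonglongrightarrow> indicator {..x} s"
  proof eventually_elim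
    case (elim s)
    have yj: "(\<lambda>n. y n $ j) \<longlonglongrightarrow> x $ j" for j by (intro tendsto_vec_nth y)
    have "\<forall>\<^sub>F n in sequentially. indicator {..y n} s = (indicator {..x} s :: real)"
    proof (cases "s \<le> x")
      case True
      then have "s $ j < x $ j" for j using elim by (auto simp: less_eq_vec_def less_le)
      then have "\<forall>\<^sub>F n in sequentially. \<forall>j. s $ j < y n $ j"
        by (intro eventually_all_finite order_tendstoD(1)[OF yj])
      then show ?thesis
        by eventually_elim (use True in \<open>auto simp: less_eq_vec_def indicator_def less_imp_le\<close>)
    next
      case False
      then obtain j where "x $ j < s $ j" by (auto simp: less_eq_vec_def not_le)
      then have "\<forall>\<^sub>F n in sequentially. y n $ j < s $ j" by (rule order_tendstoD(2)[OF yj])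
      then show ?thesis
      proof eventually_elim
        case (elim n)
        then have "\<not> s \<le> y n" by (auto simp: less_eq_vec_def not_le)
        with False show ?case by simp
      qed
    qed
    then show ?case by (rule tendsto_eventually)
  qed
  then have "(\<lambda>n. \<integral>s. indicator {..y n} s \<partial>\<mu>) \<longlonglongrightarrow> (\<integral>s. (indicator {..x} s :: real) \<partial>\<mu>)"
    by (intro integral_dominated_convergence[where w = "\<lambda>_. 1"]) (auto split: split_indicator)
  then show "(\<lambda>n. vec_cdf \<mu> (y n)) \<longlonglongrightarrow> vec_cdf \<mu> x" by (simp add: vec_cdf_def)
qed

lemma tendsto_empirical_cdf:
  "(\<And>j. good (x $ j)) \<Longrightarrow> (\<lambda>n. avg n (\<lambda>i. indicator {..x} (p i))) \<longlonglongrightarrow> measure \<mu> {..x}"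
  using weak_conv isCont_vec_cdf[of x]
  by (simp add: vec_weak_conv_def empirical_cdf_def[abs_def] vec_cdf_def avg_def)

text \<open>
  The uniform limits of these functions on the box \<open>K\<close> below form an algebra containing the coordinates, so by
  Stone--Weierstrass they include all continuous functions.
\<close>

inductive step_fun :: "(real ^ 'm \<Rightarrow> real) \<Rightarrow> bool" where
  step_fun_indicator: "(\<And>j. good (x $ j)) \<Longrightarrow> step_fun (indicator {..x})"
| step_fun_scale: "step_fun f \<Longrightarrow> step_fun (\<lambda>s. c * f s)"
| step_fun_add: "step_fun f \<Longrightarrow> step_fun g \<Longrightarrow> step_fun (\<lambda>s. f s + g s)"

text \<open>Two orthants meet in the orthant whose corner is the componentwise minimum, and a
  minimum of \<open>good\<close> coordinates is \<open>good\<close>.\<close>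

lemma step_fun_mult:
  assumes "step_fun f" "step_fun g"
  shows "step_fun (\<lambda>s. f s * g s)"
  using assms(1)
proof induction
  case (step_fun_indicator x)
  show ?case using assms(2)
  proof induction
    case (step_fun_indicator y)
    have "indicator {..x} s * indicator {..y} s = (indicator {..\<chi> j. min (x $ j) (y $ j)} s :: real)" for s
      by (auto simp: indicator_def less_eq_vec_def)
    moreover have "good ((\<chi> j. min (x $ j) (y $ j)) $ j)" for j
      using step_fun_indicator \<open>\<And>j. good (x $ j)\<close> by (simp add: min_def)
    ultimately show ?case by (simp add: step_fun.step_fun_indicator)
  next
    case (step_fun_scale g c)
    show ?case
      using step_fun.step_fun_scale[OF step_fun_scale.IH, of c] by (simp add: mult_ac)
  next
    case (step_fun_add g h)
    show ?case
      using step_fun.step_fun_add[OF step_fun_add.IH] by (simp add: algebra_simps)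
  qed
next
  case (step_fun_scale f c)
  show ?case
    using step_fun.step_fun_scale[OF step_fun_scale.IH, of c] by (simp add: mult_ac)
next
  case (step_fun_add f h)
  show ?case
    using step_fun.step_fun_add[OF step_fun_add.IH] by (simp add: algebra_simps)
qed

lemma step_fun_bounded: "step_fun f \<Longrightarrow> \<exists>B. \<forall>s. \<bar>f s\<bar> \<le> B"
proof (induction rule: step_fun.induct)
  case (step_fun_indicator x)
  show ?case by (rule exI[of _ 1]) (auto split: split_indicator)
next
  case (step_fun_scale f c)
  then obtain B where "\<forall>s. \<bar>f s\<bar> \<le> B" by blast
  then have "\<forall>s. \<bar>c * f s\<bar> \<le> \<bar>c\<bar> * B" by (simp add: abs_mult mult_left_mono)
  then show ?case by blast
next
  case (step_fun_add f g)
  then obtain B B' where "\<forall>s. \<bar>f s\<bar> \<le> B" "\<forall>s. \<bar>g s\<bar> \<le> B'" by blast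
  then have "\<forall>s. \<bar>f s + g s\<bar> \<le> B + B'" by (meson abs_triangle_ineq add_mono order_trans)
  then show ?case by blast
qed

lemma step_fun_integrable_tendsto:
  "step_fun f \<Longrightarrow> integrable \<mu> f \<and> (\<lambda>n. avg n (\<lambda>i. f (p i))) \<longlonglongrightarrow> (\<integral>s. f s \<partial>\<mu>)"
proof (induction rule: step_fun.induct)
  case (step_fun_indicator x)
  then show ?case
    using tendsto_empirical_cdf[of x] by (auto simp: integrable_indicator_iff emeasure_eq_measure)
next
  case (step_fun_scale f c)
  then show ?case by (auto simp: avg_cmult intro!: tendsto_intros)
next
  case (step_fun_add f g)
  then show ?case by (auto simp: avg_add intro!: tendsto_intros)
qed

text \<open>Bounds of a box around \<open>P\<close>, chosen \<open>good\<close> so that orthants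
  with these coordinates can be tested against the empirical distribution functions.\<close>

definition lo :: real where "lo = (SOME a. good a \<and> (\<forall>s\<in>P. \<forall>j. a < s $ j))"
definition hi :: real where "hi = (SOME b. good b \<and> (\<forall>s\<in>P. \<forall>j. s $ j < b))"

lemma lo_hi: "good lo" "good hi" "s \<in> P \<Longrightarrow> lo < s $ j" "s \<in> P \<Longrightarrow> s $ j < hi"
proof -
  obtain R where "\<And>s. s \<in> P \<Longrightarrow> norm s \<le> R"
    using compact_imp_bounded[OF compact_P] by (auto simp: bounded_iff)
  then have R: "\<bar>s $ j\<bar> \<le> R" if "s \<in> P" for s j
    using that component_le_norm_cart[of s j] by (meson order_trans)
  obtain a b where "a < - R" "good a" "R < b" "good b"
    using ex_good[of "- R - 1" "- R"] ex_good[of R "R + 1"] by auto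
  then have "\<exists>a. good a \<and> (\<forall>s\<in>P. \<forall>j. a < s $ j)" "\<exists>b. good b \<and> (\<forall>s\<in>P. \<forall>j. s $ j < b)"
    using R by (meson abs_le_iff le_less_trans less_le_trans minus_le_iff)+
  from this[THEN someI_ex]
  show "good lo" "good hi" "s \<in> P \<Longrightarrow> lo < s $ j" "s \<in> P \<Longrightarrow> s $ j < hi"
    unfolding lo_def hi_def by auto
qed

text \<open>Half-open because it is one orthant minus others, and an orthant \<open>{..x}\<close>
  contains its upper boundary.\<close>

definition K :: "(real ^ 'm) set" where "K = {s. \<forall>j. lo < s $ j \<and> s $ j \<le> hi}"

lemma P_subset_K: "P \<subseteq> K"
  using lo_hi by (auto simp: K_def less_imp_le)

text \<open>All \<open>p i\<close> lie below the corner \<open>?b\<close> and in none of the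
  orthants \<open>?a j\<close>; the limits of the empirical values, 1 and 0, are the masses under
  \<open>\<mu>\<close>.\<close>

lemma AE_K: "AE s in \<mu>. s \<in> K"
proof -
  let ?I = "\<lambda>b :: real ^ 'm. (\<lambda>n. avg n (\<lambda>i. indicator {..b} (p i)))"
  let ?b = "(\<chi> i. hi) :: real ^ 'm"
  let ?a = "\<lambda>j. (\<chi> i. if i = j then lo else hi) :: real ^ 'm"
  have "?I ?b \<longlonglongrightarrow> measure \<mu> {..?b}"
    by (rule tendsto_empirical_cdf) (simp add: lo_hi)
  moreover have "?I ?b n = 1" if "n \<ge> 1" for n
  proof -
    have "?I ?b n = avg n (\<lambda>i. 1)"
      by (rule avg_cong) (use lo_hi(4)[OF p_in_P] in \<open>auto simp: indicator_def less_eq_vec_def less_imp_le\<close>)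
    then show ?thesis using that by (simp add: avg_const)
  qed
  then have "?I ?b \<longlonglongrightarrow> 1"
    by (intro tendsto_eventually) (auto simp: eventually_sequentially)
  ultimately have "measure \<mu> {..?b} = 1" using LIMSEQ_unique by blast
  then have 1: "AE s in \<mu>. s \<in> {..?b}" by (subst (asm) prob_eq_1) auto
  have 2: "AE s in \<mu>. s \<notin> {..?a j}" for j
  proof -
    have "?I (?a j) \<longlonglongrightarrow> measure \<mu> {..?a j}"
      by (rule tendsto_empirical_cdf) (simp add: lo_hi)
    moreover have "?I (?a j) n = avg n (\<lambda>i. 0)" for n
    proof (rule avg_cong)
      fix i :: nat assume "i \<ge> 1"
      then have "\<not> p i \<le> ?a j" using lo_hi(3)[OF p_in_P, of i j] by (auto simp: less_eq_vec_def not_le)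
      then show "indicator {..?a j} (p i) = (0::real)" by simp
    qed
    moreover have "avg n (\<lambda>i. 0) = 0" for n by (simp add: avg_def)
    ultimately have "measure \<mu> {..?a j} = 0" by (simp add: LIMSEQ_const_iff)
    then have "{..?a j} \<in> null_sets \<mu>" by (simp add: null_sets_def emeasure_eq_measure sets_mu)
    then show ?thesis by (rule AE_not_in)
  qed
  then have "AE s in \<mu>. \<forall>j. s \<notin> {..?a j}" by (simp add: AE_all_countable)
  with 1 show ?thesis
  proof eventually_elim
    case (elim s)
    have "lo < s $ j" for j
    proof (rule ccontr)
      assume "\<not> lo < s $ j"
      then have "s \<le> ?a j" using elim(1) by (auto simp: less_eq_vec_def)
      then show False using elim(2) by auto
    qed
    then show ?case using elim(1) by (auto simp: K_def less_eq_vec_def)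
  qed
qed

section \<open>Continuous functions as uniform limits of step functions\<close>

definition approximable :: "(real ^ 'm \<Rightarrow> real) \<Rightarrow> bool" where
  "approximable f \<longleftrightarrow> (\<forall>e>0. \<exists>g. step_fun g \<and> (\<forall>s\<in>K. \<bar>f s - g s\<bar> < e))"

text \<open>Combinations of orthant indicators vanish far out, so the constant 1 is available only
  on \<open>K\<close>.\<close>

lemma step_fun_one: "\<exists>g. step_fun g \<and> (\<forall>s\<in>K. g s = 1)"
  by (rule exI[of _ "indicator {..\<chi> i. hi}"])
     (auto intro!: step_fun_indicator simp: lo_hi K_def less_eq_vec_def indicator_def)

lemma approximable_const: "approximable (\<lambda>_. c)"
proof -
  obtain g where g: "step_fun g" "\<forall>s\<in>K. g s = 1" using step_fun_one by blast
  have "step_fun (\<lambda>s. c * g s)" by (rule step_fun_scale[OF g(1)])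
  then show ?thesis unfolding approximable_def using g(2) by (auto intro!: exI[of _ "\<lambda>s. c * g s"])
qed

lemma approximable_add:
  assumes "approximable f" "approximable g"
  shows "approximable (\<lambda>s. f s + g s)"
  unfolding approximable_def
proof (intro allI impI)
  fix e :: real assume e: "0 < e"
  obtain f' g' where fg: "step_fun f'" "\<forall>s\<in>K. \<bar>f s - f' s\<bar> < e / 2" "step_fun g'" "\<forall>s\<in>K. \<bar>g s - g' s\<bar> < e / 2"
    using assms e unfolding approximable_def by (meson half_gt_zero)
  have "\<bar>(f s + g s) - (f' s + g' s)\<bar> < e" if "s \<in> K" for s
    using fg(2,4)[rule_format, OF that] by linarith
  then show "\<exists>h. step_fun h \<and> (\<forall>s\<in>K. \<bar>f s + g s - h s\<bar> < e)"
    using step_fun_add[OF fg(1,3)] by blast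
qed

lemma approximable_bounded:
  assumes "approximable f"
  shows "\<exists>B. \<forall>s\<in>K. \<bar>f s\<bar> \<le> B"
proof -
  obtain g where g: "step_fun g" "\<forall>s\<in>K. \<bar>f s - g s\<bar> < 1" using assms unfolding approximable_def by (meson zero_less_one)
  obtain B where B: "\<forall>s. \<bar>g s\<bar> \<le> B" using step_fun_bounded[OF g(1)] by blast
  have "\<bar>f s\<bar> \<le> B + 1" if "s \<in> K" for s using g(2)[rule_format, OF that] B[rule_format, of s] by linarith
  then show ?thesis by blast
qed

lemma approximable_mult:
  assumes "approximable f" "approximable g"
  shows "approximable (\<lambda>s. f s * g s)"
  unfolding approximable_def
proof (intro allI impI)
  fix e :: real assume e: "0 < e"
  obtain A where A: "\<forall>s\<in>K. \<bar>f s\<bar> \<le> A" using approximable_bounded[OF assms(1)] by blast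
  obtain B where B: "\<forall>s\<in>K. \<bar>g s\<bar> \<le> B" using approximable_bounded[OF assms(2)] by blast
  define D where "D = \<bar>A\<bar> + \<bar>B\<bar> + 2"
  \<comment> \<open>The error of the product is at most
    \<open>\<bar>A\<bar> * d + (\<bar>B\<bar> + 1) * d\<close>, strictly below \<open>d * D\<close>;
    \<open>d \<le> 1\<close> accounts for the extra 1 in the bound for \<open>g'\<close>.\<close>
  define d where "d = min 1 (e / D)"
  have D: "0 < D" by (simp add: D_def)
  have d: "0 < d" "d \<le> 1" "d \<le> e / D" using e D by (auto simp: d_def)
  then have dD: "d * D \<le> e" using D by (simp add: pos_le_divide_eq)
  obtain f' g' where fg: "step_fun f'" "\<forall>s\<in>K. \<bar>f s - f' s\<bar> < d" "step_fun g'" "\<forall>s\<in>K. \<bar>g s - g' s\<bar> < d"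
    using assms d(1) unfolding approximable_def by meson
  have "\<bar>f s * g s - f' s * g' s\<bar> < e" if s: "s \<in> K" for s
  proof -
    have b: "\<bar>f s - f' s\<bar> \<le> d" "\<bar>g s - g' s\<bar> \<le> d" "\<bar>f s\<bar> \<le> \<bar>A\<bar>" "\<bar>g' s\<bar> \<le> \<bar>B\<bar> + 1"
      using fg(2,4)[rule_format, OF s] A[rule_format, OF s] B[rule_format, OF s] d(2) by linarith+
    have "f s * g s - f' s * g' s = f s * (g s - g' s) + g' s * (f s - f' s)" by algebra
    then have "\<bar>f s * g s - f' s * g' s\<bar> \<le> \<bar>f s\<bar> * \<bar>g s - g' s\<bar> + \<bar>g' s\<bar> * \<bar>f s - f' s\<bar>"
      by (metis abs_mult abs_triangle_ineq)
    also have "\<dots> \<le> \<bar>A\<bar> * d + (\<bar>B\<bar> + 1) * d" using b d by (intro add_mono mult_mono) auto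
    also have "\<dots> < d * D" using d(1) by (simp add: D_def algebra_simps)
    finally show ?thesis using dD by linarith
  qed
  then show "\<exists>h. step_fun h \<and> (\<forall>s\<in>K. \<bar>f s * g s - h s\<bar> < e)"
    using step_fun_mult[OF fg(1,3)] by blast
qed

text \<open>A staircase in the \<open>j\<close>-th coordinate. Thresholds must be
  \<open>good\<close>, so each is picked somewhere in its own window of length \<open>d\<close>;
  neighbouring ones then differ by at most \<open>2 * d\<close>, still below
  \<open>e\<close>.\<close>

lemma approximable_nth: "approximable (\<lambda>s. s $ j)"
  unfolding approximable_def
proof (intro allI impI)
  fix e :: real assume e: "0 < e"
  define d where "d = e / 3"
  have d: "0 < d" "2 * d < e" using e by (auto simp: d_def)
  obtain u where u: "step_fun u" "\<forall>s\<in>K. u s = 1" using step_fun_one by blast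
  \<comment> \<open>After \<open>N\<close> steps \<open>g\<close> follows the coordinate up to the
    threshold \<open>x\<close> and stays at height \<open>x\<close> beyond it.\<close>
  have step: "\<exists>g x. step_fun g \<and> good x \<and> lo + real N * d < x \<and> x < lo + (real N + 1) * d \<and>
    (\<forall>s\<in>K. s $ j \<le> x \<longrightarrow> \<bar>s $ j - g s\<bar> \<le> 2 * d) \<and> (\<forall>s\<in>K. x < s $ j \<longrightarrow> g s = x)" for N
  proof (induction N)
    case 0
    obtain x where x: "lo < x" "x < lo + d" "good x" using ex_good[of lo "lo + d"] d by auto
    have "step_fun (\<lambda>s. x * u s)" by (rule step_fun_scale[OF u(1)])
    moreover have "\<bar>s $ j - x * u s\<bar> \<le> 2 * d" if "s \<in> K" "s $ j \<le> x" for s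
    proof -
      have "lo < s $ j" using that(1) by (simp add: K_def)
      then show ?thesis using u(2) that x d by auto
    qed
    ultimately show ?case using x u(2)
      by (intro exI[of _ "\<lambda>s. x * u s"] exI[of _ x]) auto
  next
    case (Suc N)
    then obtain g x where g: "step_fun g" "good x" "lo + real N * d < x" "x < lo + (real N + 1) * d"
      "\<And>s. s \<in> K \<Longrightarrow> s $ j \<le> x \<Longrightarrow> \<bar>s $ j - g s\<bar> \<le> 2 * d" "\<And>s. s \<in> K \<Longrightarrow> x < s $ j \<Longrightarrow> g s = x" by blast
    obtain z where z: "lo + real (Suc N) * d < z" "z < lo + (real (Suc N) + 1) * d" "good z"
      using ex_good[of "lo + real (Suc N) * d" "lo + (real (Suc N) + 1) * d"] d by (auto simp: algebra_simps)
    have zx: "x < z" "z - x \<le> 2 * d" using g(3,4) z by (auto simp: algebra_simps)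
    define v :: "real ^ 'm \<Rightarrow> real" where "v = indicator {..\<chi> i. if i = j then x else hi}"
    have v: "step_fun v" unfolding v_def by (rule step_fun_indicator) (simp add: g(2) lo_hi)
    have vs: "v s = (if s $ j \<le> x then 1 else 0)" if "s \<in> K" for s
      using that by (auto simp: v_def K_def less_eq_vec_def indicator_def)
    \<comment> \<open>Lifts the plateau beyond \<open>x\<close> from \<open>x\<close> to
      \<open>z\<close>; where \<open>v\<close> is 1 the two added terms cancel.\<close>
    define h where "h = (\<lambda>s. g s + ((z - x) * u s + (x - z) * v s))"
    have "step_fun h" unfolding h_def by (intro step_fun_add step_fun_scale g(1) u(1) v)
    moreover have "h s = (if s $ j \<le> x then g s else z)" if "s \<in> K" for s
      using u(2) vs[OF that] g(6)[OF that] that by (auto simp: h_def not_le)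
    ultimately show ?case using z zx g(5)
      by (intro exI[of _ h] exI[of _ z]) (auto simp: not_le abs_le_iff)
  qed
  obtain N where N: "(hi - lo) / d \<le> real N" using real_arch_simple by blast
  then have N': "hi \<le> lo + real N * d" using d by (simp add: field_simps)
  obtain g x where g: "step_fun g" "lo + real N * d < x" "\<And>s. s \<in> K \<Longrightarrow> s $ j \<le> x \<Longrightarrow> \<bar>s $ j - g s\<bar> \<le> 2 * d"
    using step[of N] by blast
  have "\<bar>s $ j - g s\<bar> < e" if "s \<in> K" for s
  proof -
    have "s $ j \<le> x" using that g(2) N' by (auto simp: K_def dest!: spec[of _ j])
    then show ?thesis using g(3)[OF that] d by linarith
  qed
  then show "\<exists>g. step_fun g \<and> (\<forall>s\<in>K. \<bar>s $ j - g s\<bar> < e)" using g(1) by blast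
qed

lemma approximable_sum: "finite A \<Longrightarrow> (\<And>i. i \<in> A \<Longrightarrow> approximable (f i)) \<Longrightarrow> approximable (\<lambda>s. \<Sum>i\<in>A. f i s)"
  by (induction A rule: finite_induct) (auto intro: approximable_const approximable_add)

lemma approximable_polynomial: "real_polynomial_function f \<Longrightarrow> approximable f"
proof (induction rule: real_polynomial_function.induct)
  case (linear f)
  then interpret bounded_linear f .
  have "f = (\<lambda>s. \<Sum>j\<in>UNIV. f (axis j 1) * s $ j)"
  proof
    fix s
    have "f s = f (\<Sum>j\<in>UNIV. s $ j *\<^sub>R axis j 1)" by (metis basis_expansion scalar_mult_eq_scaleR)
    then show "f s = (\<Sum>j\<in>UNIV. f (axis j 1) * s $ j)" by (simp add: sum scaleR mult.commute)
  qed
  moreover have "approximable (\<lambda>s. \<Sum>j\<in>UNIV. f (axis j 1) * s $ j)"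
    by (rule approximable_sum[OF finite approximable_mult[OF approximable_const approximable_nth]])
  ultimately show ?case by simp
next
  case (const c)
  show ?case by (rule approximable_const)
next
  case (add f g)
  show ?case by (rule approximable_add[OF add.IH])
next
  case (mult f g)
  show ?case by (rule approximable_mult[OF mult.IH])
qed

lemma set_integrable_compact:
  assumes C: "compact C" "AE s in \<mu>. s \<in> C" and f: "continuous_on C (f :: real ^ 'm \<Rightarrow> real)"
  shows "set_integrable \<mu> C f"
proof -
  have Cb: "C \<in> sets borel" using C by (simp add: compact_imp_closed)
  have "bounded (f ` C)" by (intro compact_imp_bounded compact_continuous_image f C)
  then obtain B where "\<And>s. s \<in> C \<Longrightarrow> norm (f s) \<le> B" by (auto simp: bounded_iff)
  then have "AE s in \<mu>. norm (indicator C s *\<^sub>R f s) \<le> B" using C(2) by (auto elim!: eventually_mono)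
  moreover have "(\<lambda>s. indicator C s *\<^sub>R f s) \<in> borel_measurable \<mu>"
    using borel_measurable_continuous_on_indicator[OF Cb f] by (simp add: sets_mu cong: measurable_cong_sets)
  ultimately show ?thesis unfolding set_integrable_def
    by (rule integrable_const_bound)
qed

text \<open>A polynomial close to \<open>f\<close> on \<open>C\<close>, then a step function close
  to it on \<open>K\<close>, transfers both averages and integral. The set \<open>C\<close> is a
  parameter because the first application is to a box, where only \<open>AE_K\<close> is
  known.\<close>

lemma tendsto_avg_on:
  fixes f :: "real ^ 'm \<Rightarrow> real"
  assumes C: "compact C" "\<And>i. i \<ge> 1 \<Longrightarrow> p i \<in> C" "AE s in \<mu>. s \<in> C" and f: "continuous_on C f"
  shows "(\<lambda>n. avg n (\<lambda>i. f (p i))) \<longlonglongrightarrow> (LINT s:C|\<mu>. f s)"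
proof (rule tendstoI)
  fix e :: real assume e: "0 < e"
  obtain q where q: "real_polynomial_function q" "\<And>s. s \<in> C \<Longrightarrow> \<bar>f s - q s\<bar> < e / 8"
    using Stone_Weierstrass_real_polynomial_function[OF C(1) f, of "e / 8"] e by auto
  obtain g where g: "step_fun g" "\<forall>s\<in>K. \<bar>q s - g s\<bar> < e / 8"
    using approximable_polynomial[OF q(1)] e unfolding approximable_def by (meson divide_pos_pos zero_less_numeral)
  have fg: "\<bar>f s - g s\<bar> \<le> e / 4" if "s \<in> C" "s \<in> K" for s
    using q(2)[OF that(1)] g(2)[rule_format, OF that(2)] by linarith
  have ig: "integrable \<mu> g" and cg: "(\<lambda>n. avg n (\<lambda>i. g (p i))) \<longlonglongrightarrow> (\<integral>s. g s \<partial>\<mu>)"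
    using step_fun_integrable_tendsto[OF g(1)] by auto
  let ?f = "\<lambda>s. indicator C s *\<^sub>R f s"
  have AE: "AE s in \<mu>. \<bar>?f s - g s\<bar> \<le> e / 4"
    using C(3) AE_K by eventually_elim (use fg in auto)
  have if': "integrable \<mu> ?f" using set_integrable_compact[OF C(1,3) f] unfolding set_integrable_def .
  have 1: "\<bar>(\<integral>s. ?f s \<partial>\<mu>) - (\<integral>s. g s \<partial>\<mu>)\<bar> \<le> e / 4"
  proof -
    have "\<bar>(\<integral>s. ?f s \<partial>\<mu>) - (\<integral>s. g s \<partial>\<mu>)\<bar> = \<bar>\<integral>s. ?f s - g s \<partial>\<mu>\<bar>" using if' ig by simp
    also have "\<dots> \<le> (\<integral>s. \<bar>?f s - g s\<bar> \<partial>\<mu>)" by (rule integral_abs_bound)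
    also have "\<dots> \<le> (\<integral>s. e / 4 \<partial>\<mu>)" using if' ig AE by (intro integral_mono_AE) auto
    finally show ?thesis by (simp add: prob_space[simplified])
  qed
  have 2: "\<bar>avg n (\<lambda>i. f (p i)) - avg n (\<lambda>i. g (p i))\<bar> \<le> e / 4" for n
  proof (rule order_trans[OF avg_diff_le avg_le_const])
    show "\<bar>f (p i) - g (p i)\<bar> \<le> e / 4" if "1 \<le> i" for i
      by (rule fg[OF C(2)[OF that] subsetD[OF P_subset_K p_in_P[OF that]]])
  qed (use e in auto)
  have "\<forall>\<^sub>F n in sequentially. dist (avg n (\<lambda>i. g (p i))) (\<integral>s. g s \<partial>\<mu>) < e / 4"
    using e by (intro tendstoD[OF cg]) auto
  then show "\<forall>\<^sub>F n in sequentially. dist (avg n (\<lambda>i. f (p i))) (LINT s:C|\<mu>. f s) < e"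
  proof eventually_elim
    case (elim n)
    have *: "\<bar>u - v\<bar> < e" if "\<bar>x - z\<bar> < e / 4" "\<bar>v - z\<bar> \<le> e / 4" "\<bar>u - x\<bar> \<le> e / 4" for u v x z :: real
    proof -
      have "\<bar>u - v\<bar> \<le> \<bar>u - x\<bar> + \<bar>x - v\<bar>" using abs_triangle_ineq[of "u - x" "x - v"] by simp
      also have "\<bar>x - v\<bar> \<le> \<bar>x - z\<bar> + \<bar>v - z\<bar>" using abs_triangle_ineq4[of "x - z" "v - z"] by simp
      finally show ?thesis using that e by simp
    qed
    show ?case
      using *[OF elim[unfolded dist_real_def] 1 2[of n]]
      unfolding set_lebesgue_integral_def dist_real_def .
  qed
qed

text \<open>The distance to \<open>P\<close> is continuous and averages to 0 along the points, so
  its integral vanishes and \<open>\<mu>\<close> is carried by the closed set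
  \<open>P\<close>.\<close>

lemma AE_P: "AE s in \<mu>. s \<in> P"
proof -
  have Pne: "P \<noteq> {}" using p_in_P[of 1] by auto
  let ?C = "cbox (\<chi> i. lo) (\<chi> i. hi) :: (real ^ 'm) set"
  have KC: "K \<subseteq> ?C" by (auto simp: K_def mem_box_cart less_imp_le)
  let ?f = "\<lambda>s. infdist s P"
  have AC: "AE s in \<mu>. s \<in> ?C" using AE_K KC by auto
  have "(\<lambda>n. avg n (\<lambda>i. ?f (p i))) \<longlonglongrightarrow> (LINT s:?C|\<mu>. ?f s)"
  proof (rule tendsto_avg_on[OF compact_cbox _ AC])
    show "p i \<in> ?C" if "i \<ge> 1" for i using p_in_P[OF that] P_subset_K KC by blast
    show "continuous_on ?C ?f" by (intro continuous_intros)
  qed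
  moreover have "avg n (\<lambda>i. ?f (p i)) = avg n (\<lambda>i. 0)" for n
    by (rule avg_cong) (use p_in_P in auto)
  moreover have "avg n (\<lambda>i. 0) = 0" for n by (simp add: avg_def)
  ultimately have 0: "(\<integral>s. indicator ?C s *\<^sub>R ?f s \<partial>\<mu>) = 0"
    by (simp add: LIMSEQ_const_iff set_lebesgue_integral_def)
  have "integrable \<mu> (\<lambda>s. indicator ?C s *\<^sub>R ?f s)"
    unfolding set_integrable_def[symmetric]
    by (intro set_integrable_compact compact_cbox AC continuous_intros)
  then have "AE s in \<mu>. indicator ?C s *\<^sub>R ?f s = 0"
    using 0 by (subst (asm) integral_nonneg_eq_0_iff_AE) (auto simp: infdist_nonneg)
  with AC show ?thesis
  proof eventually_elim
    case (elim s)
    then have "infdist s P = 0" by simp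
    then show ?case using Pne compact_imp_closed[OF compact_P] by (simp add: in_closed_iff_infdist_zero)
  qed
qed

lemma tendsto_avg_continuous:
  "continuous_on P f \<Longrightarrow> (\<lambda>n. avg n (\<lambda>i. f (p i))) \<longlonglongrightarrow> (LINT s:P|\<mu>. f s)"
  by (rule tendsto_avg_on[OF compact_P p_in_P AE_P])

lemma AE_zero_of_set_integral_zero:
  assumes "continuous_on P (f :: real ^ 'm \<Rightarrow> real)" "\<And>s. s \<in> P \<Longrightarrow> 0 \<le> f s" "(LINT s:P|\<mu>. f s) = 0"
  shows "AE s in \<mu>. s \<in> P \<and> f s = 0"
proof -
  have "AE s in \<mu>. indicator P s *\<^sub>R f s = 0"
    using assms(3) set_integrable_compact[OF compact_P AE_P assms(1)] assms(2)
    unfolding set_integrable_def set_lebesgue_integral_def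
    by (subst (asm) integral_nonneg_eq_0_iff_AE) (auto split: split_indicator)
  with AE_P show ?thesis by eventually_elim auto
qed

end

section \<open>Consistency\<close>

text \<open>A hyperplane has affine dimension one less than the space. In dimension 2 this is
  collinearity; in dimension 3 an affine basis of \<open>S\<close> has at most three points, which
  are coplanar.\<close>

lemma on_line_or_plane_hyperplane:
  fixes a :: "real ^ 'm"
  assumes dim: "CARD('m) \<in> {2, 3}" and a: "a \<noteq> 0" and S: "S \<subseteq> {x. a \<bullet> x = b}"
  shows "on_line_or_plane S"
proof -
  have le: "aff_dim S \<le> int CARD('m) - 1"
    using aff_dim_subset[OF S] aff_dim_hyperplane[OF a, of b] by simp
  show ?thesis
  proof (cases "CARD('m) = 2")
    case True
    then have "collinear S" using le by (simp add: collinear_aff_dim)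
    then show ?thesis using True by (simp add: on_line_or_plane_def)
  next
    case False
    then have 3: "CARD('m) = 3" using dim by simp
    obtain B where B: "affine hull B = affine hull S" "\<not> affine_dependent B" "int (card B) = aff_dim S + 1"
      using aff_dim_basis_exists[of S] by auto
    have "card B \<le> 3" using B(3) le 3 by simp
    then have "coplanar B" using aff_independent_finite[OF B(2)] by (intro coplanar_small)
    then have "coplanar (affine hull S)" using B(1) coplanar_affine_hull_coplanar by metis
    then have "coplanar S" by (simp add: coplanar_affine_hull_coplanar)
    then show ?thesis using 3 by (simp add: on_line_or_plane_def)
  qed
qed

section \<open>The cost near its poles and the comparison of costs\<close>

lemma ls_cost_at_sensor:
  fixes p :: "nat \<Rightarrow> real ^ 'm"
  assumes "1 \<le> i" "i \<le> n"
  shows "ls_cost p y n (p i) = \<infinity>"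
proof -
  let ?t = "\<lambda>j. (ereal (y j) - elog_dist (p j) (p i))\<^sup>2"
  have "?t i = \<infinity>" by (simp add: elog_dist_def power2_eq_square)
  moreover have "(\<Sum>j=1..n. ?t j) = ?t i + (\<Sum>j\<in>{1..n} - {i}. ?t j)"
    using assms by (intro sum.remove) auto
  ultimately have "(\<Sum>j=1..n. ?t j) = \<infinity>" by simp
  then show ?thesis using assms by (simp add: ls_cost_def)
qed

lemma ls_cost_off_sensors:
  fixes p :: "nat \<Rightarrow> real ^ 'm"
  assumes "\<And>i. 1 \<le> i \<Longrightarrow> i \<le> n \<Longrightarrow> q \<noteq> p i"
  shows "ls_cost p y n q = ereal (avg n (\<lambda>i. (y i - log_dist (p i) q)\<^sup>2))"
proof -
  have "(\<Sum>i=1..n. (ereal (y i) - elog_dist (p i) q)\<^sup>2) = (\<Sum>i=1..n. ereal ((y i - log_dist (p i) q)\<^sup>2))"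
    using assms by (intro sum.cong) (auto simp: elog_dist_def power2_eq_square)
  then show ?thesis by (simp add: ls_cost_def avg_def)
qed

text \<open>The cost is infinite at a sensor and finite at \<open>p0\<close>.\<close>

lemma estimate_off_sensors:
  assumes ml: "is_ML_estimate p y n q" and p0: "\<And>i. 1 \<le> i \<Longrightarrow> i \<le> n \<Longrightarrow> p0 \<noteq> p i"
    and i: "1 \<le> i" "i \<le> n"
  shows "q \<noteq> p i"
proof
  assume "q = p i"
  then have "ls_cost p y n q = \<infinity>" using ls_cost_at_sensor[OF i] by simp
  then have "ls_cost p y n p0 < ls_cost p y n q" using ls_cost_off_sensors[of n p0 p y] p0 by simp
  then show False using ml by (auto simp: is_ML_estimate_def is_arg_min_def)
qed

lemma estimate_cost_le:
  assumes ml: "is_ML_estimate p y n q" and p0: "\<And>i. 1 \<le> i \<Longrightarrow> i \<le> n \<Longrightarrow> p0 \<noteq> p i"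
    and q': "\<And>i. 1 \<le> i \<Longrightarrow> i \<le> n \<Longrightarrow> q' \<noteq> p i"
  shows "avg n (\<lambda>i. (y i - log_dist (p i) q)\<^sup>2) \<le> avg n (\<lambda>i. (y i - log_dist (p i) q')\<^sup>2)"
proof -
  have "\<not> ls_cost p y n q' < ls_cost p y n q"
    using ml by (auto simp: is_ML_estimate_def is_arg_min_def)
  then show ?thesis
    using ls_cost_off_sensors[of n q p y] ls_cost_off_sensors[of n q' p y] q'
      estimate_off_sensors[OF ml p0] by (simp add: not_less)
qed

text \<open>Completing the square reduces this to comparing \<open>(c - w)\<^sup>2\<close> with
  \<open>(d - w)\<^sup>2\<close>. Clamping moves \<open>d\<close> away from \<open>w\<close> only if
  \<open>T < \<bar>w\<bar>\<close>, and then \<open>\<bar>c - w\<bar> \<le> \<bar>w\<bar>\<close>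
  while \<open>w\<^sup>2 \<le> w ^ 4 / T\<^sup>2\<close>.\<close>

lemma truncated_residual_le:
  fixes d w T :: real
  assumes T: "0 < T"
  defines "c \<equiv> max (- T) (min T d)"
  shows "c\<^sup>2 - 2 * w * c \<le> d\<^sup>2 - 2 * w * d + w ^ 4 / T\<^sup>2"
proof -
  have "\<bar>c - w\<bar> \<le> \<bar>d - w\<bar> \<or> T < \<bar>w\<bar> \<and> \<bar>c - w\<bar> \<le> \<bar>w\<bar>"
    using T unfolding c_def max_def min_def by (auto split: if_splits)
  then have "(c - w)\<^sup>2 \<le> (d - w)\<^sup>2 + w ^ 4 / T\<^sup>2"
  proof (elim disjE conjE)
    assume "\<bar>c - w\<bar> \<le> \<bar>d - w\<bar>"
    then show ?thesis by (simp add: abs_le_square_iff add_increasing2)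
  next
    assume w: "T < \<bar>w\<bar>" "\<bar>c - w\<bar> \<le> \<bar>w\<bar>"
    have "T\<^sup>2 \<le> w\<^sup>2" using power_mono[of T "\<bar>w\<bar>" 2] w T by simp
    then have "w\<^sup>2 * T\<^sup>2 \<le> w\<^sup>2 * w\<^sup>2" by (intro mult_left_mono) auto
    then have "w\<^sup>2 \<le> w ^ 4 / T\<^sup>2"
      using T by (simp add: pos_le_divide_eq power4_eq_xxxx power2_eq_square mult_ac)
    moreover have "(c - w)\<^sup>2 \<le> w\<^sup>2" using w(2) by (simp add: abs_le_square_iff)
    ultimately show ?thesis by (simp add: add_increasing)
  qed
  then show ?thesis by (simp add: power2_diff algebra_simps)
qed

text \<open>A finite net with a common Lipschitz constant. Each net point is moved to a nearby point
  of \<open>Q\<close>, since for random data convergence will be known only on a countable dense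
  set.\<close>

lemma eventually_uniformly_close:
  fixes F :: "nat \<Rightarrow> 'b::metric_space \<Rightarrow> real"
  assumes C: "compact C" and L: "0 \<le> L"
    and F: "\<And>n q q'. \<bar>F n q - F n q'\<bar> \<le> L * dist q q'"
    and G: "\<And>q q'. \<bar>G q - G q'\<bar> \<le> L * dist q q'"
    and dense: "\<And>x e. 0 < e \<Longrightarrow> \<exists>q\<in>Q. dist q x < e"
    and conv: "\<And>q. q \<in> Q \<Longrightarrow> (\<lambda>n. F n q) \<longlonglongrightarrow> G q" and e: "0 < e"
  shows "\<forall>\<^sub>F n in sequentially. \<forall>q\<in>C. \<bar>F n q - G q\<bar> < e"
proof -
  \<comment> \<open>Moving from \<open>q\<close> to a point of \<open>Q\<close> covers at most
    \<open>2 * d\<close> and costs at most \<open>e / 4\<close> for each of \<open>F\<close> and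
    \<open>G\<close>; convergence adds another \<open>e / 4\<close>.\<close>
  define d where "d = e / (8 * (L + 1))"
  have d: "0 < d" "L * d \<le> e / 8" using e L by (auto simp: d_def field_simps)
  obtain A where A: "A \<subseteq> C" "finite A" "C \<subseteq> (\<Union>x\<in>A. ball x d)"
    by (rule compactE_image[OF C, of C "\<lambda>x. ball x d"]) (use d in auto)
  obtain k where k: "\<And>x. k x \<in> Q" "\<And>x. dist (k x) x < d" using dense[OF d(1)] by metis
  have "\<forall>\<^sub>F n in sequentially. \<bar>F n (k x) - G (k x)\<bar> < e / 4" for x
    using tendstoD[OF conv[OF k(1)], of "e / 4" x] e by (simp add: dist_real_def)
  then have "\<forall>\<^sub>F n in sequentially. \<forall>x\<in>A. \<bar>F n (k x) - G (k x)\<bar> < e / 4"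
    using A(2) by (intro eventually_ball_finite) auto
  then show ?thesis
  proof eventually_elim
    case (elim n)
    show ?case
    proof
      fix q assume "q \<in> C"
      then obtain x where x: "x \<in> A" "dist x q < d" using A(3) by auto
      have "dist q (k x) \<le> 2 * d" using k(2)[of x] x(2) dist_triangle[of q "k x" x] by (simp add: dist_commute)
      then have "L * dist q (k x) \<le> L * (2 * d)" by (intro mult_left_mono L)
      then have "L * dist q (k x) \<le> e / 4" using d(2) by simp
      then show "\<bar>F n q - G q\<bar> < e"
        using F[of n q "k x"] G[of q "k x"] elim[rule_format, OF x(1)] e unfolding abs_less_iff abs_le_iff by linarith
    qed
  qed
qed

lemma abs_ln_diff_le:
  fixes u v l :: real
  assumes l: "0 < l" "l \<le> u" "l \<le> v"
  shows "\<bar>ln u - ln v\<bar> \<le> \<bar>u - v\<bar> / l"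
proof -
  have *: "ln a - ln b \<le> \<bar>a - b\<bar> / l" if "l \<le> a" "l \<le> b" for a b
  proof -
    have "ln a - ln b \<le> (a - b) / b" using that l by (intro ln_diff_le) auto
    also have "\<dots> \<le> \<bar>a - b\<bar> / l" using that l by (intro frac_le) auto
    finally show ?thesis .
  qed
  show ?thesis using *[of u v] *[of v u] l by (simp add: abs_le_iff abs_minus_commute)
qed

section \<open>Clamped log-distance differences and identification of \<open>p0\<close>\<close>

locale localization = weakly_convergent_points \<mu> p P
  for \<mu> :: "(real ^ 'm) measure" and p P +
  fixes p0 :: "real ^ 'm"
  assumes p0_notin: "p0 \<notin> P"
    and nondegenerate: "\<And>a b. a \<noteq> 0 \<Longrightarrow> \<not> (AE s in \<mu>. s \<in> P \<and> a \<bullet> s = b)"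
begin

lemma dist_bounds:
  obtains \<delta> R where "0 < \<delta>" "0 < R" "\<And>s. s \<in> P \<Longrightarrow> \<delta> \<le> norm (s - p0)" "\<And>s. s \<in> P \<Longrightarrow> norm (s - p0) \<le> R"
    "\<And>s. s \<in> P \<Longrightarrow> norm s \<le> R"
proof -
  obtain \<delta> where \<delta>: "0 < \<delta>" "\<And>s. s \<in> P \<Longrightarrow> \<delta> \<le> dist p0 s"
    using separate_point_closed[OF compact_imp_closed[OF compact_P] p0_notin] by blast
  obtain B where B: "0 < B" "\<And>s. s \<in> P \<Longrightarrow> norm s \<le> B"
    using compact_imp_bounded[OF compact_P] by (auto simp: bounded_pos)
  show ?thesis
  proof (rule that[of \<delta> "B + norm p0"])
    fix s assume s: "s \<in> P"
    show "\<delta> \<le> norm (s - p0)" using \<delta>(2)[OF s] by (simp add: dist_norm norm_minus_commute)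
    show "norm (s - p0) \<le> B + norm p0" using norm_triangle_ineq4[of s p0] B(2)[OF s] by simp
    show "norm s \<le> B + norm p0" using B(2)[OF s] by (simp add: add_increasing2)
  qed (use \<delta> B in \<open>auto intro: add_pos_nonneg\<close>)
qed

text \<open>The difference \<open>log_dist s q - log_dist s p0\<close>, clamped to \<open>[-T, T]\<close>. Clamping removes the singularity
  at \<open>q = s\<close> and makes the functions equal to the constant \<open>T\<close> for \<open>q\<close> far away.\<close>

definition tdiff :: "real \<Rightarrow> real ^ 'm \<Rightarrow> real ^ 'm \<Rightarrow> real" where
  "tdiff T s q = log 10 (max (10 powr - T) (min (10 powr T) (norm (s - q) / norm (s - p0))))"

lemma tdiff_eq:
  assumes "q \<noteq> s" "s \<in> P"
  shows "tdiff T s q = max (- T) (min T (log_dist s q - log_dist s p0))"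
proof -
  let ?r = "norm (s - q) / norm (s - p0)"
  have pos: "norm (s - q) > 0" "norm (s - p0) > 0" using assms p0_notin by auto
  then have r: "?r > 0" by simp
  have m: "log 10 (min a b) = min (log 10 a) (log 10 b)" "log 10 (max a b) = max (log 10 a) (log 10 b)"
    if "a > 0" "b > 0" for a b :: real
    using that by (auto simp: min_def max_def)
  have "log 10 ?r = log_dist s q - log_dist s p0"
    using pos by (simp add: log_dist_def log_divide)
  then show ?thesis using r by (simp add: tdiff_def m)
qed

lemma abs_tdiff_le:
  assumes "0 \<le> T"
  shows "\<bar>tdiff T s q\<bar> \<le> T"
proof -
  let ?x = "max (10 powr - T) (min (10 powr T) (norm (s - q) / norm (s - p0)))"
  have b: "10 powr - T \<le> ?x" "?x \<le> 10 powr T" using assms by (auto intro: powr_mono)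
  have "0 < 10 powr - T" by simp
  then have "0 < ?x" using b(1) by linarith
  then have "log 10 (10 powr - T) \<le> log 10 ?x" "log 10 ?x \<le> log 10 (10 powr T)"
    using b by (simp_all only: log_le_cancel_iff powr_gt_zero)
  then show ?thesis by (simp add: tdiff_def)
qed

text \<open>The ratio of distances moves by at most \<open>dist q q' / \<delta>\<close>, and the
  logarithm is Lipschitz above \<open>10 powr - T\<close>; clamping from below tames the
  pole.\<close>

lemma tdiff_Lipschitz:
  "\<exists>L\<ge>0. \<forall>s\<in>P. \<forall>q q'. \<bar>tdiff T s q - tdiff T s q'\<bar> \<le> L * dist q q'"
proof -
  obtain \<delta> R where \<delta>: "0 < \<delta>" "\<And>s. s \<in> P \<Longrightarrow> \<delta> \<le> norm (s - p0)" by (rule dist_bounds) blast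
  define l where "l = 10 powr - T"
  have l: "0 < l" by (simp add: l_def)
  have "\<bar>tdiff T s q - tdiff T s q'\<bar> \<le> (1 / (\<delta> * l * ln 10)) * dist q q'" if s: "s \<in> P" for s q q'
  proof -
    let ?c = "\<lambda>x. max l (min (10 powr T) x)"
    let ?r = "\<lambda>q. norm (s - q) / norm (s - p0)"
    have "\<bar>?c (?r q) - ?c (?r q')\<bar> \<le> \<bar>?r q - ?r q'\<bar>" by (auto simp: max_def min_def)
    also have "\<dots> = \<bar>norm (s - q) - norm (s - q')\<bar> / norm (s - p0)"
      by (simp add: diff_divide_distrib[symmetric])
    also have "\<dots> \<le> dist q q' / \<delta>"
      using \<delta>(1) \<delta>(2)[OF s] norm_triangle_ineq3[of "s - q" "s - q'"]
      by (intro frac_le) (auto simp: dist_norm norm_minus_commute)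
    finally have 1: "\<bar>?c (?r q) - ?c (?r q')\<bar> \<le> dist q q' / \<delta>" .
    have "\<bar>ln (?c (?r q)) - ln (?c (?r q'))\<bar> \<le> \<bar>?c (?r q) - ?c (?r q')\<bar> / l"
      using l by (intro abs_ln_diff_le) auto
    also have "\<dots> \<le> dist q q' / \<delta> / l" using 1 l by (intro divide_right_mono) auto
    finally have "\<bar>ln (?c (?r q)) - ln (?c (?r q'))\<bar> / ln 10 \<le> dist q q' / \<delta> / l / ln 10"
      by (intro divide_right_mono) auto
    then show ?thesis by (simp add: tdiff_def l_def[symmetric] log_def diff_divide_distrib[symmetric])
  qed
  then show ?thesis using \<delta>(1) l by (intro exI[of _ "1 / (\<delta> * l * ln 10)"]) auto
qed

text \<open>The value is \<open>T\<close> for \<open>T \<ge> 0\<close>; the maximum appears because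
  \<open>T\<close> carries no sign condition. Since it is independent of \<open>q\<close>, an
  unbounded region reduces to one value.\<close>

lemma tdiff_far: "\<exists>R. \<forall>q. R \<le> norm q \<longrightarrow> (\<forall>s\<in>P. tdiff T s q = max (- T) T)"
proof -
  obtain \<delta> R where R: "0 < \<delta>" "0 < R" "\<And>s. s \<in> P \<Longrightarrow> \<delta> \<le> norm (s - p0)"
    "\<And>s. s \<in> P \<Longrightarrow> norm (s - p0) \<le> R" "\<And>s. s \<in> P \<Longrightarrow> norm s \<le> R" by (rule dist_bounds) blast
  have "tdiff T s q = max (- T) T" if q: "R + 10 powr T * R \<le> norm q" and s: "s \<in> P" for q s
  proof -
    have "10 powr T * norm (s - p0) \<le> 10 powr T * R" using R(4)[OF s] by (intro mult_left_mono) auto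
    also have "\<dots> \<le> norm q - norm s" using q R(5)[OF s] by linarith
    also have "\<dots> \<le> norm (s - q)" using norm_triangle_ineq2[of q s] by (simp add: norm_minus_commute)
    finally have "10 powr T * norm (s - p0) \<le> norm (s - q)" .
    moreover have "0 < norm (s - p0)" using R(1) R(3)[OF s] by linarith
    ultimately have "10 powr T \<le> norm (s - q) / norm (s - p0)"
      by (simp only: pos_le_divide_eq)
    then have "tdiff T s q = log 10 (max (10 powr - T) (10 powr T))" by (simp add: tdiff_def)
    then show ?thesis by (auto simp: max_def)
  qed
  then show ?thesis by blast
qed

lemma continuous_on_tdiff: "continuous_on P (\<lambda>s. tdiff T s q)"
proof -
  have p: "norm (s - p0) \<noteq> 0" if "s \<in> P" for s using that p0_notin by auto
  have "0 < max (10 powr - T) (min (10 powr T) x)" for x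
    by (rule less_le_trans[of _ "10 powr - T"]) auto
  then have "max (10 powr - T) (min (10 powr T) x) \<noteq> 0" for x by (metis less_irrefl)
  then show ?thesis unfolding tdiff_def log_def
    using p by (intro continuous_intros) auto
qed

lemma avg_tdiff_sq_limit_pos:
  assumes "q \<noteq> p0"
  shows "0 < (LINT s:P|\<mu>. (tdiff 1 s q)\<^sup>2)"
proof -
  let ?I = "(LINT s:P|\<mu>. (tdiff 1 s q)\<^sup>2)"
  have c: "continuous_on P (\<lambda>s. (tdiff 1 s q)\<^sup>2)" by (intro continuous_intros continuous_on_tdiff)
  have "0 \<le> ?I"
    unfolding set_lebesgue_integral_def by (intro integral_nonneg_AE) auto
  moreover have "?I \<noteq> 0"
  proof
    assume "?I = 0"
    then have "AE s in \<mu>. s \<in> P \<and> (tdiff 1 s q)\<^sup>2 = 0"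
      by (intro AE_zero_of_set_integral_zero[OF c]) auto
    then have "AE s in \<mu>. s \<in> P \<and> (q - p0) \<bullet> s = ((norm q)\<^sup>2 - (norm p0)\<^sup>2) / 2"
    proof eventually_elim
      case (elim s)
      let ?r = "norm (s - q) / norm (s - p0)"
      let ?x = "max (10 powr - 1) (min (10 powr 1) ?r)"
      have "0 < ?x" by (rule less_le_trans[of _ "10 powr - 1"]) auto
      moreover have "log 10 ?x = 0" using elim by (simp add: tdiff_def)
      ultimately have "?x = 1" by (simp add: log_def)
      \<comment> \<open>The clamping bounds are 1/10 and 10, so the value 1 can only come from the
        ratio itself.\<close>
      then have "?r = 1" by (auto simp: max_def min_def powr_minus split: if_splits)
      moreover have "norm (s - p0) \<noteq> 0" using elim p0_notin by auto
      ultimately have "norm (s - q) = norm (s - p0)" by simp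
      then have "(s - q) \<bullet> (s - q) = (s - p0) \<bullet> (s - p0)" by (simp add: power2_norm_eq_inner[symmetric])
      then show ?case using elim
        by (simp add: power2_norm_eq_inner inner_diff_left inner_diff_right inner_commute)
    qed
    moreover have "q - p0 \<noteq> 0" using assms by simp
    ultimately show False using nondegenerate by blast
  qed
  ultimately show ?thesis by linarith
qed

text \<open>Far away every clamped difference is 1. On the remaining compact region the limit is
  continuous and positive, hence at least some \<open>m\<close>, and uniform closeness within
  \<open>m / 2\<close> passes this on to the averages.\<close>

lemma separation:
  assumes e: "0 < e"
  shows "\<exists>c>0. \<forall>\<^sub>F n in sequentially. \<forall>q. e \<le> dist q p0 \<longrightarrow> c \<le> avg n (\<lambda>i. (tdiff 1 (p i) q)\<^sup>2)"
proof -
  let ?F = "\<lambda>n q. avg n (\<lambda>i. (tdiff 1 (p i) q)\<^sup>2)"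
  let ?G = "\<lambda>q. LINT s:P|\<mu>. (tdiff 1 s q)\<^sup>2"
  obtain L where L: "0 \<le> L" "\<And>s q q'. s \<in> P \<Longrightarrow> \<bar>tdiff 1 s q - tdiff 1 s q'\<bar> \<le> L * dist q q'"
    using tdiff_Lipschitz by blast
  obtain R where R: "\<And>q s. R \<le> norm q \<Longrightarrow> s \<in> P \<Longrightarrow> tdiff 1 s q = 1"
    using tdiff_far[of 1] by auto
  have F: "\<bar>?F n q - ?F n q'\<bar> \<le> 2 * L * dist q q'" for n q q'
  proof (rule order_trans[OF avg_diff_le avg_le_const])
    fix i :: nat assume i: "1 \<le> i"
    have "\<bar>(tdiff 1 (p i) q)\<^sup>2 - (tdiff 1 (p i) q')\<^sup>2\<bar>
      = \<bar>tdiff 1 (p i) q + tdiff 1 (p i) q'\<bar> * \<bar>tdiff 1 (p i) q - tdiff 1 (p i) q'\<bar>"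
      by (simp add: abs_mult[symmetric] power2_eq_square algebra_simps)
    also have "\<dots> \<le> 2 * (L * dist q q')"
      using abs_tdiff_le[of 1 "p i" q] abs_tdiff_le[of 1 "p i" q'] L(2)[OF p_in_P[OF i], of q q']
      by (intro mult_mono) auto
    finally show "\<bar>(tdiff 1 (p i) q)\<^sup>2 - (tdiff 1 (p i) q')\<^sup>2\<bar> \<le> 2 * L * dist q q'" by simp
  qed (use L in auto)
  have conv: "(\<lambda>n. ?F n q) \<longlonglongrightarrow> ?G q" for q
    by (intro tendsto_avg_continuous continuous_intros continuous_on_tdiff)
  \<comment> \<open>The limit inherits the Lipschitz bound of the averages.\<close>
  have G: "\<bar>?G q - ?G q'\<bar> \<le> 2 * L * dist q q'" for q q'
    by (rule LIMSEQ_le_const2[of "\<lambda>n. \<bar>?F n q - ?F n q'\<bar>"]) (auto intro!: tendsto_intros conv F)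
  let ?C = "cball 0 R - ball p0 e"
  have C: "compact ?C" by (intro compact_diff) auto
  have contG: "continuous_on ?C ?G"
    by (rule lipschitz_on_continuous_on[of "2 * L"]) (auto simp: lipschitz_on_def dist_real_def L(1) G)
  obtain m where m: "0 < m" "\<And>q. q \<in> ?C \<Longrightarrow> m \<le> ?G q"
  proof (cases "?C = {}")
    case True
    show ?thesis by (rule that[of 1]) (simp_all only: True empty_iff zero_less_one)
  next
    case False
    then obtain q where q: "q \<in> ?C" "\<And>q'. q' \<in> ?C \<Longrightarrow> ?G q \<le> ?G q'"
      using continuous_attains_inf[OF C _ contG] by blast
    have "0 < ?G q" using q(1) e by (intro avg_tdiff_sq_limit_pos) auto
    then show ?thesis using that[of "?G q"] q(2) by blast
  qed
  have dist_self_less: "\<exists>q. dist q x < r" if "0 < r" for x :: "real ^ 'm" and r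
    by (rule exI[of _ x]) (use that in simp)
  have "\<forall>\<^sub>F n in sequentially. \<forall>q\<in>?C. \<bar>?F n q - ?G q\<bar> < m / 2"
    by (rule eventually_uniformly_close[OF C _ F G, where Q = UNIV]) (use L m in \<open>auto intro: conv dist_self_less\<close>)
  then have "\<forall>\<^sub>F n in sequentially. \<forall>q. e \<le> dist q p0 \<longrightarrow> min 1 (m / 2) \<le> ?F n q"
    using eventually_ge_at_top[of 1]
  proof eventually_elim
    case (elim n)
    show ?case
    proof (intro allI impI)
      fix q assume q: "e \<le> dist q p0"
      show "min 1 (m / 2) \<le> ?F n q"
      proof (cases "R \<le> norm q")
        case True
        then have "?F n q = avg n (\<lambda>i. 1)"
          by (intro avg_cong) (use R[OF True] p_in_P in simp)
        then show ?thesis using avg_const[OF elim(2), of 1] by simp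
      next
        case False
        then have qC: "q \<in> ?C" using q by (auto simp: dist_commute)
        show ?thesis
          using elim(1)[rule_format, OF qC] m(2)[OF qC] unfolding abs_less_iff min_le_iff_disj by linarith
      qed
    qed
  qed
  then show ?thesis using m(1) by (intro exI[of _ "min 1 (m / 2)"]) auto
qed

text \<open>Minimality against \<open>p0\<close> makes the mean of
  \<open>d\<^sup>2 - 2 * w * d\<close> nonpositive for the raw differences \<open>d\<close>. Level 1
  on the left gives a lower bound independent of \<open>T\<close>; level \<open>T\<close> on the
  right keeps the clamping cost small.\<close>

lemma estimate_residual_le:
  assumes n: "1 \<le> n" and y: "\<And>i. i \<ge> 1 \<Longrightarrow> y i = log_dist (p i) p0 + w i"
    and ml: "is_ML_estimate p y n q" and T: "1 \<le> T"
  shows "avg n (\<lambda>i. (tdiff 1 (p i) q)\<^sup>2) \<le> 2 * avg n (\<lambda>i. w i * tdiff T (p i) q) + avg n (\<lambda>i. w i ^ 4) / T\<^sup>2"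
proof -
  let ?d = "\<lambda>i. log_dist (p i) q - log_dist (p i) p0"
  let ?r = "(\<lambda>i. (y i - log_dist (p i) q)\<^sup>2 - (y i - log_dist (p i) p0)\<^sup>2)"
  have p0: "p0 \<noteq> p i" if "1 \<le> i" for i using p_in_P[OF that] p0_notin by auto
  have off: "q \<noteq> p i" if "1 \<le> i" "i \<le> n" for i
    using estimate_off_sensors[OF ml _ that] p0 by blast
  have "avg n (\<lambda>i. (y i - log_dist (p i) q)\<^sup>2) \<le> avg n (\<lambda>i. (y i - log_dist (p i) p0)\<^sup>2)"
    by (rule estimate_cost_le[OF ml]) (use p0 in auto)
  then have le0: "avg n ?r \<le> 0"
    by (simp add: avg_diff)
  have "avg n (\<lambda>i. (tdiff 1 (p i) q)\<^sup>2 - 2 * (w i * tdiff T (p i) q) - w i ^ 4 * (1 / T\<^sup>2))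
    \<le> avg n ?r"
  proof (rule avg_mono)
    fix i assume i: "1 \<le> i" "i \<le> n"
    have t: "tdiff T' (p i) q = max (- T') (min T' (?d i))" for T'
      using tdiff_eq[OF off[OF i] p_in_P[OF i(1)]] by simp
    have "\<bar>tdiff 1 (p i) q\<bar> \<le> \<bar>tdiff T (p i) q\<bar>" unfolding t using T by (auto simp: max_def min_def)
    then have "(tdiff 1 (p i) q)\<^sup>2 \<le> (tdiff T (p i) q)\<^sup>2" by (metis abs_le_square_iff)
    moreover have "(tdiff T (p i) q)\<^sup>2 - 2 * w i * tdiff T (p i) q \<le> (?d i)\<^sup>2 - 2 * w i * ?d i + w i ^ 4 / T\<^sup>2"
      unfolding t[of T] using T by (intro truncated_residual_le) auto
    moreover have "(y i - log_dist (p i) q)\<^sup>2 - (y i - log_dist (p i) p0)\<^sup>2 = (?d i)\<^sup>2 - 2 * w i * ?d i"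
      unfolding y[OF i(1)] by (simp add: power2_eq_square algebra_simps)
    ultimately show "(tdiff 1 (p i) q)\<^sup>2 - 2 * (w i * tdiff T (p i) q) - w i ^ 4 * (1 / T\<^sup>2)
      \<le> (y i - log_dist (p i) q)\<^sup>2 - (y i - log_dist (p i) p0)\<^sup>2" by simp
  qed
  then have "avg n (\<lambda>i. (tdiff 1 (p i) q)\<^sup>2 - 2 * (w i * tdiff T (p i) q) - w i ^ 4 * (1 / T\<^sup>2)) \<le> 0"
    using le0 by linarith
  then show ?thesis
    using avg_cmult[of n "1 / T\<^sup>2" "\<lambda>i. w i ^ 4"] by (simp add: avg_diff avg_cmult mult.commute)
qed

text \<open>A statement about one outcome, whose hypotheses hold almost surely. An estimate outside
  the ball would bound a quantity that is at least \<open>c\<close> by less than \<open>c\<close>: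
  the noise term and the clamping cost are each below \<open>c / 2\<close>.\<close>

lemma consistency:
  assumes y: "\<And>i. i \<ge> 1 \<Longrightarrow> y i = log_dist (p i) p0 + w i"
    and B: "\<And>n. avg n (\<lambda>i. w i ^ 4) \<le> B"
    and dense: "\<And>x e. 0 < e \<Longrightarrow> \<exists>q\<in>Q. dist q x < e"
    and lln: "\<And>T q. q \<in> Q \<Longrightarrow> (\<lambda>n. avg n (\<lambda>i. w i * tdiff (real (Suc T)) (p i) q)) \<longlonglongrightarrow> 0"
    and ml: "\<And>n. n \<ge> 1 \<Longrightarrow> is_ML_estimate p y n (phat n)"
  shows "phat \<longlonglongrightarrow> p0"
proof (rule tendstoI)
  fix e :: real assume e: "0 < e"
  obtain c where c: "0 < c" "\<forall>\<^sub>F n in sequentially. \<forall>q. e \<le> dist q p0 \<longrightarrow> c \<le> avg n (\<lambda>i. (tdiff 1 (p i) q)\<^sup>2)"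
    using separation[OF e] by blast
  have B0: "0 \<le> B" using B[of 0] by (simp add: avg_def)
  \<comment> \<open>With \<open>T > 2 * B / c\<close> and \<open>T \<ge> 1\<close> the cost
    \<open>B / T\<^sup>2\<close> is below \<open>c / 2\<close>. The level is a successor because
    \<open>lln\<close> is assumed at such levels.\<close>
  obtain N :: nat where N: "2 * B / c < real N" using reals_Archimedean2 by blast
  define T where "T = real (Suc N)"
  have T: "1 \<le> T" "B / T\<^sup>2 < c / 2"
  proof -
    show T1: "1 \<le> T" by (simp add: T_def)
    have "2 * B / c < T" using N by (simp add: T_def)
    also have "\<dots> \<le> T\<^sup>2" using T1 by (simp add: power2_eq_square)
    finally show "B / T\<^sup>2 < c / 2" using c(1) T1 by (simp add: field_simps)
  qed
  let ?F = "\<lambda>n q. avg n (\<lambda>i. w i * tdiff T (p i) q)"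
  obtain L where L: "0 \<le> L" "\<And>s q q'. s \<in> P \<Longrightarrow> \<bar>tdiff T s q - tdiff T s q'\<bar> \<le> L * dist q q'"
    using tdiff_Lipschitz by blast
  obtain R where R: "\<And>q s. R \<le> norm q \<Longrightarrow> s \<in> P \<Longrightarrow> tdiff T s q = max (- T) T"
    using tdiff_far[of T] by blast
  have F: "\<bar>?F n q - ?F n q'\<bar> \<le> (1 + B) * L * dist q q'" for n q q'
  proof -
    have "\<bar>?F n q - ?F n q'\<bar> \<le> avg n (\<lambda>i. L * dist q q' * \<bar>w i\<bar>)"
    proof (rule avg_diff_le)
      fix i :: nat assume i: "1 \<le> i"
      have "\<bar>w i * tdiff T (p i) q - w i * tdiff T (p i) q'\<bar> = \<bar>tdiff T (p i) q - tdiff T (p i) q'\<bar> * \<bar>w i\<bar>"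
        by (simp add: abs_mult[symmetric] algebra_simps)
      also have "\<dots> \<le> L * dist q q' * \<bar>w i\<bar>" by (intro mult_right_mono L p_in_P i) auto
      finally show "\<bar>w i * tdiff T (p i) q - w i * tdiff T (p i) q'\<bar> \<le> L * dist q q' * \<bar>w i\<bar>" .
    qed
    also have "\<dots> \<le> L * dist q q' * (1 + B)"
      unfolding avg_cmult using L by (intro mult_left_mono avg_abs_le B) auto
    finally show ?thesis by (simp add: mult_ac)
  qed
  \<comment> \<open>A representative inside the ball: all \<open>q\<close> with
    \<open>R \<le> norm q\<close> give the same mean as \<open>q1\<close>.\<close>
  obtain q1 :: "real ^ 'm" where q1: "norm q1 = \<bar>R\<bar>" by (rule vector_choose_size[of "\<bar>R\<bar>"]) auto
  have "\<forall>\<^sub>F n in sequentially. \<forall>q\<in>cball 0 \<bar>R\<bar>. \<bar>?F n q - 0\<bar> < c / 4"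
  proof (rule eventually_uniformly_close[OF _ _ F, where Q = Q and G = "\<lambda>_. 0"])
    show "(\<lambda>n. ?F n q) \<longlonglongrightarrow> 0" if "q \<in> Q" for q unfolding T_def by (rule lln[OF that])
  qed (use B0 L c dense in auto)
  then have "\<forall>\<^sub>F n in sequentially. \<forall>q. \<bar>?F n q\<bar> < c / 4"
  proof eventually_elim
    case (elim n)
    show ?case
    proof
      fix q
      show "\<bar>?F n q\<bar> < c / 4"
      proof (cases "R \<le> norm q")
        case True
        have "?F n q = ?F n q1"
          by (rule avg_cong) (use R[OF True] R[of q1] q1 p_in_P in simp)
        then show ?thesis using elim q1 by simp
      next
        case False
        then show ?thesis using elim by auto
      qed
    qed
  qed
  then show "\<forall>\<^sub>F n in sequentially. dist (phat n) p0 < e"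
    using c(2) eventually_ge_at_top[of 1]
  proof eventually_elim
    case (elim n)
    have "avg n (\<lambda>i. w i ^ 4) / T\<^sup>2 \<le> B / T\<^sup>2" using B by (intro divide_right_mono) auto
    then have "avg n (\<lambda>i. (tdiff 1 (p i) (phat n))\<^sup>2) < c"
      using estimate_residual_le[OF elim(3) y ml[OF elim(3)] T(1)] elim(1)[rule_format, of "phat n"] T(2)
      unfolding abs_less_iff by linarith
    then show ?case using elim(2) by (meson not_le)
  qed
qed

end

section \<open>Linearization of the score\<close>

text \<open>Off the finitely many sensors the cost is differentiable on an open set, so the
  derivative vanishes at the minimizer. Evaluating it in the direction of the score \<open>v\<close>
  itself gives \<open>v \<bullet> v = 0\<close>.\<close>

lemma estimate_first_order_condition:
  assumes ml: "is_ML_estimate p y n q" and p0: "\<And>i. 1 \<le> i \<Longrightarrow> i \<le> n \<Longrightarrow> p0 \<noteq> p i"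
  shows "(\<Sum>i=1..n. (y i - log_dist (p i) q) *\<^sub>R grad_log_dist (p i) q) = 0"
proof -
  let ?g = "\<lambda>i. grad_log_dist (p i) q"
  let ?f = "\<lambda>q. \<Sum>i=1..n. (y i - log_dist (p i) q)\<^sup>2"
  let ?U = "- p ` {1..n}"
  define v where "v = (\<Sum>i=1..n. (y i - log_dist (p i) q) *\<^sub>R ?g i)"
  have off: "q \<noteq> p i" if "1 \<le> i" "i \<le> n" for i
    using estimate_off_sensors[OF ml p0 that] .
  have d: "(log_dist (p i) has_derivative (\<lambda>h. ?g i \<bullet> h)) (at q)" if "i \<in> {1..n}" for i
    using that by (intro has_derivative_log_dist off) auto
  have "((\<lambda>q. (y i - log_dist (p i) q)\<^sup>2) has_derivative
      (\<lambda>h. - 2 * ((y i - log_dist (p i) q) * (?g i \<bullet> h)))) (at q)" if "i \<in> {1..n}" for i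
    by (rule derivative_eq_intros d[OF that] refl)+ (auto simp: algebra_simps)
  then have "(?f has_derivative (\<lambda>h. \<Sum>i=1..n. - 2 * ((y i - log_dist (p i) q) * (?g i \<bullet> h)))) (at q)"
    by (intro has_derivative_sum) auto
  then have "(\<lambda>h. \<Sum>i=1..n. - 2 * ((y i - log_dist (p i) q) * (?g i \<bullet> h))) = (\<lambda>h. 0)"
  proof (rule differential_zero_maxmin[rotated 2])
    show "q \<in> ?U" using off by (metis ComplI atLeastAtMost_iff imageE)
    show "open ?U" by (intro open_Compl finite_imp_closed) auto
    have "?f q \<le> ?f q'" if "q' \<in> ?U" for q'
    proof (cases "n = 0")
      case False
      have "avg n (\<lambda>i. (y i - log_dist (p i) q)\<^sup>2) \<le> avg n (\<lambda>i. (y i - log_dist (p i) q')\<^sup>2)"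
        by (rule estimate_cost_le[OF ml p0]) (use that in auto)
      then show ?thesis using False by (simp add: avg_def divide_le_cancel)
    qed simp
    then show "(\<forall>q'\<in>?U. ?f q' \<le> ?f q) \<or> (\<forall>q'\<in>?U. ?f q \<le> ?f q')" by blast
  qed
  then have "(\<Sum>i=1..n. - 2 * ((y i - log_dist (p i) q) * (?g i \<bullet> v))) = 0"
    by (rule fun_cong)
  then have "v \<bullet> v = 0"
    unfolding v_def inner_sum_left by (simp add: sum_distrib_left[symmetric] sum_negf)
  then show ?thesis by (simp add: v_def)
qed

section \<open>Second-order expansions of the log-distance and its gradient\<close>

definition hess_log_dist :: "real ^ 'm \<Rightarrow> real ^ 'm \<Rightarrow> real ^ 'm ^ 'm" where
  "hess_log_dist s q = (1 / ((norm (q - s))\<^sup>2 * ln 10)) *\<^sub>R mat 1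
     - (2 / ((norm (q - s)) ^ 4 * ln 10)) *\<^sub>R outer_product (q - s)"

lemma hess_log_dist_mult_vec:
  "hess_log_dist s q *v h = (1 / ((norm (q - s))\<^sup>2 * ln 10)) *\<^sub>R h
     - (2 * ((q - s) \<bullet> h) / ((norm (q - s)) ^ 4 * ln 10)) *\<^sub>R (q - s)"
  by (simp add: hess_log_dist_def matrix_vector_mult_diff_rdistrib scaleR_matrix_vector_assoc[symmetric]
      outer_product_mult_vec)

lemma ln_10_ge_1: "1 \<le> ln (10 :: real)"
proof -
  have "exp 1 \<le> (10 :: real)" using exp_le by simp
  then show ?thesis by (simp add: ln_ge_iff)
qed

text \<open>\<open>u\<close> is the relative change of the squared norm. The radius
  \<open>norm a / 6\<close> makes \<open>3 * norm h / norm a\<close> at most 1/2, which keeps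
  \<open>1 + u\<close> away from 0.\<close>

lemma norm_perturbation:
  fixes a h :: "real ^ 'm"
  assumes a: "a \<noteq> 0" and h: "norm h \<le> norm a / 6"
  defines "u \<equiv> (2 * (a \<bullet> h) + (norm h)\<^sup>2) / (norm a)\<^sup>2"
  shows "(norm (a + h))\<^sup>2 = (norm a)\<^sup>2 * (1 + u)" "\<bar>u\<bar> \<le> 3 * norm h / norm a" "\<bar>u\<bar> \<le> 1 / 2"
    "u\<^sup>2 \<le> 9 * (norm h)\<^sup>2 / (norm a)\<^sup>2"
proof -
  have pos: "0 < norm a" using a by simp
  show "(norm (a + h))\<^sup>2 = (norm a)\<^sup>2 * (1 + u)"
    using pos by (simp add: u_def field_simps power2_norm_eq_inner inner_add_left inner_add_right inner_commute)
  have "\<bar>2 * (a \<bullet> h) + (norm h)\<^sup>2\<bar> \<le> 2 * \<bar>a \<bullet> h\<bar> + norm h * norm h"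
    using abs_triangle_ineq[of "2 * (a \<bullet> h)" "(norm h)\<^sup>2"] by (simp add: abs_mult power2_eq_square)
  also have "\<dots> \<le> 2 * (norm a * norm h) + norm a * norm h"
  proof (intro add_mono mult_left_mono mult_right_mono)
    show "norm h \<le> norm a" using h norm_ge_zero[of a] by linarith
  qed (simp_all add: Cauchy_Schwarz_ineq2)
  finally have "\<bar>u\<bar> \<le> 3 * (norm a * norm h) / (norm a)\<^sup>2"
    unfolding u_def abs_divide by (simp add: divide_right_mono)
  also have "\<dots> = 3 * norm h / norm a" using pos by (simp add: power2_eq_square)
  finally show u3: "\<bar>u\<bar> \<le> 3 * norm h / norm a" .
  also have "\<dots> \<le> 1 / 2" using h pos by (simp add: field_simps)
  finally show "\<bar>u\<bar> \<le> 1 / 2" .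
  have "\<bar>u\<bar>\<^sup>2 \<le> (3 * norm h / norm a)\<^sup>2" by (intro power_mono u3) auto
  then show "u\<^sup>2 \<le> 9 * (norm h)\<^sup>2 / (norm a)\<^sup>2" by (simp add: power_divide power_mult_distrib)
qed

text \<open>With \<open>a = q - s\<close> the increment is \<open>ln (1 + u) / (2 * ln 10)\<close>,
  and \<open>u / 2\<close> is the linear term plus
  \<open>(norm h)\<^sup>2 / (2 * (norm a)\<^sup>2)\<close>. The logarithm's remainder contributes 9
  to the constant and this extra term at most 1.\<close>

lemma log_dist_expansion:
  fixes s q h :: "real ^ 'm"
  assumes a: "q \<noteq> s" and h: "norm h \<le> norm (q - s) / 6"
  shows "\<bar>log_dist s (q + h) - log_dist s q - grad_log_dist s q \<bullet> h\<bar> \<le> 10 * (norm h)\<^sup>2 / (norm (q - s))\<^sup>2"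
proof -
  define a where "a = q - s"
  define u where "u = (2 * (a \<bullet> h) + (norm h)\<^sup>2) / (norm a)\<^sup>2"
  let ?R = "ln (1 + u) / 2 - (a \<bullet> h) / (norm a)\<^sup>2"
  have a0: "a \<noteq> 0" using a by (simp add: a_def)
  have pos: "0 < norm a" using a0 by simp
  note U = norm_perturbation[OF a0 h[folded a_def], folded u_def]
  have u1: "0 < 1 + u" using U(3) by (simp add: abs_le_iff)
  have ln2: "ln (norm x) = ln ((norm x)\<^sup>2) / 2" if "x \<noteq> 0" for x :: "real ^ 'm"
    using that by (simp add: ln_realpow)
  have "(norm (a + h))\<^sup>2 > 0" unfolding U(1) using pos u1 by simp
  then have ah: "a + h \<noteq> 0" by auto
  have L: "ln (norm (a + h)) - ln (norm a) = ln (1 + u) / 2"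
  proof -
    have l: "ln ((norm a)\<^sup>2 * (1 + u)) = ln ((norm a)\<^sup>2) + ln (1 + u)"
      using pos u1 by (intro ln_mult_pos) auto
    show ?thesis unfolding ln2[OF ah] ln2[OF a0] U(1) l by (simp add: add_divide_distrib)
  qed
  have A: "log_dist s (q + h) = ln (norm (a + h)) / ln 10" "log_dist s q = ln (norm a) / ln 10"
    by (simp_all add: log_dist_def log_def a_def norm_minus_commute[of s] algebra_simps)
  have G: "grad_log_dist s q \<bullet> h = (a \<bullet> h) / (norm a)\<^sup>2 / ln 10"
    by (simp add: grad_log_dist_def a_def norm_minus_commute[of s])
  have eq: "log_dist s (q + h) - log_dist s q - grad_log_dist s q \<bullet> h
      = (?R) / ln 10"
    by (simp only: A G diff_divide_distrib[symmetric] L)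
  have "?R = (ln (1 + u) - u) / 2 + (norm h)\<^sup>2 / (2 * (norm a)\<^sup>2)"
    using pos by (simp add: u_def field_simps)
  then have "\<bar>?R\<bar> \<le> \<bar>ln (1 + u) - u\<bar> / 2 + (norm h)\<^sup>2 / (2 * (norm a)\<^sup>2)"
    using abs_triangle_ineq[of "(ln (1 + u) - u) / 2" "(norm h)\<^sup>2 / (2 * (norm a)\<^sup>2)"] by simp
  also have "\<dots> \<le> u\<^sup>2 + (norm h)\<^sup>2 / (2 * (norm a)\<^sup>2)"
    using abs_ln_one_plus_x_minus_x_bound[OF U(3)] by simp
  also have "\<dots> \<le> 9 * (norm h)\<^sup>2 / (norm a)\<^sup>2 + (norm h)\<^sup>2 / (norm a)\<^sup>2"
    using U(4) pos by (intro add_mono) (auto simp: field_simps)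
  finally have b: "\<bar>?R\<bar> \<le> 10 * (norm h)\<^sup>2 / (norm a)\<^sup>2"
    by (simp add: add_divide_distrib[symmetric])
  have "\<bar>(?R) / ln 10\<bar> \<le> \<bar>?R\<bar> / 1"
    unfolding abs_divide using ln_10_ge_1 by (intro divide_left_mono) auto
  then show ?thesis unfolding eq using b by (simp add: a_def)
qed

lemma grad_log_dist_expansion:
  fixes s q h :: "real ^ 'm"
  assumes a: "q \<noteq> s" and h: "norm h \<le> norm (q - s) / 6"
  shows "norm (grad_log_dist s (q + h) - grad_log_dist s q - hess_log_dist s q *v h)
    \<le> 25 * (norm h)\<^sup>2 / (norm (q - s)) ^ 3"
proof -
  let ?D = "grad_log_dist s (q + h) - grad_log_dist s q - hess_log_dist s q *v h"
  define a where "a = q - s"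
  define N where "N = (norm a)\<^sup>2"
  define u where "u = (2 * (a \<bullet> h) + (norm h)\<^sup>2) / (norm a)\<^sup>2"
  have a0: "a \<noteq> 0" using a by (simp add: a_def)
  have pos: "0 < norm a" "0 < N" using a0 by (simp_all add: N_def)
  note U = norm_perturbation[OF a0 h[folded a_def], folded u_def]
  have u1: "1 / 2 \<le> 1 + u" using U(3) by (simp add: abs_le_iff)
  \<comment> \<open>\<open>\<alpha>\<close> and \<open>\<beta>\<close> are the remainders of
    \<open>1 / (1 + u)\<close> after the constant and the linear term. The Hessian cancels the
    linear part along \<open>a\<close>, leaving \<open>\<beta>\<close>; along \<open>h\<close> the
    size of \<open>\<alpha>\<close> already suffices.\<close>
  define \<alpha> where "\<alpha> = 1 / (1 + u) - 1"
  define \<beta> where "\<beta> = 1 / (1 + u) - 1 + u"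
  let ?R = "((\<beta> - (norm h)\<^sup>2 / N) / N) *\<^sub>R a + (\<alpha> / N) *\<^sub>R h"
  have inv2: "1 / (1 + u) \<le> 2" using u1 by (simp add: field_simps)
  have "\<alpha> = - u * (1 / (1 + u))" using u1 by (simp add: \<alpha>_def field_simps)
  then have "\<bar>\<alpha>\<bar> = \<bar>u\<bar> * (1 / (1 + u))" using u1 by (simp add: abs_mult)
  also have "\<dots> \<le> \<bar>u\<bar> * 2" by (intro mult_left_mono inv2) auto
  finally have al: "\<bar>\<alpha>\<bar> \<le> 2 * \<bar>u\<bar>" by simp
  have "\<beta> = u\<^sup>2 * (1 / (1 + u))" using u1 by (simp add: \<beta>_def field_simps power2_eq_square)
  then have "\<bar>\<beta>\<bar> = u\<^sup>2 * (1 / (1 + u))" using u1 by (simp add: abs_mult)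
  also have "\<dots> \<le> u\<^sup>2 * 2" by (intro mult_left_mono inv2) auto
  finally have be: "\<bar>\<beta>\<bar> \<le> 2 * u\<^sup>2" by simp
  have g1: "grad_log_dist s (q + h) = (1 / ln 10) *\<^sub>R ((1 / (N * (1 + u))) *\<^sub>R (a + h))"
    using U(1) by (simp add: grad_log_dist_def a_def N_def norm_minus_commute[of s] algebra_simps)
  have g0: "grad_log_dist s q = (1 / ln 10) *\<^sub>R ((1 / N) *\<^sub>R a)"
    by (simp add: grad_log_dist_def a_def N_def norm_minus_commute[of s] algebra_simps)
  have N4: "norm a ^ 4 = N * N" by (simp add: N_def power2_eq_square power4_eq_xxxx)
  have hs: "hess_log_dist s q *v h = (1 / ln 10) *\<^sub>R ((1 / N) *\<^sub>R h - (2 * (a \<bullet> h) / (N * N)) *\<^sub>R a)"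
    unfolding hess_log_dist_mult_vec a_def[symmetric] N4 N_def[symmetric]
    by (simp add: scaleR_diff_right mult.commute)
  have e1: "1 / (N * (1 + u)) = (1 + \<alpha>) / N" by (simp add: \<alpha>_def)
  have e2: "\<alpha> + 2 * (a \<bullet> h) / N = \<beta> - (norm h)\<^sup>2 / N"
    by (simp add: \<alpha>_def \<beta>_def u_def N_def add_divide_distrib)
  have "(1 / (N * (1 + u))) *\<^sub>R (a + h) - (1 / N) *\<^sub>R a - ((1 / N) *\<^sub>R h - (2 * (a \<bullet> h) / (N * N)) *\<^sub>R a)
      = ((\<alpha> + 2 * (a \<bullet> h) / N) / N) *\<^sub>R a + (\<alpha> / N) *\<^sub>R h"
    unfolding e1 by (simp add: algebra_simps add_divide_distrib)
  then have eq: "?D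
      = (1 / ln 10) *\<^sub>R (?R)"
    unfolding g1 g0 hs e2 by (simp only: scaleR_diff_right[symmetric])
  have "norm (?D)
      = (1 / ln 10) * norm (?R)"
    unfolding eq using ln_10_ge_1 by simp
  also have "\<dots> \<le> 1 * norm (?R)"
    using ln_10_ge_1 by (intro mult_right_mono) auto
  also have "\<dots> \<le> \<bar>\<beta> - (norm h)\<^sup>2 / N\<bar> / N * norm a + \<bar>\<alpha>\<bar> / N * norm h"
    using norm_triangle_ineq[of "((\<beta> - (norm h)\<^sup>2 / N) / N) *\<^sub>R a" "(\<alpha> / N) *\<^sub>R h"] pos by simp
  \<comment> \<open>The 19 is \<open>2 * 9 + 1\<close>, from \<open>\<beta>\<close> and the extra
    square; the 6 comes from \<open>\<bar>\<alpha>\<bar> \<le> 2 * \<bar>u\<bar>\<close>.\<close>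
  also have "\<dots> \<le> (19 * (norm h)\<^sup>2 / N) / N * norm a + (6 * norm h / norm a) / N * norm h"
  proof (intro add_mono mult_right_mono divide_right_mono)
    have "\<bar>\<beta> - (norm h)\<^sup>2 / N\<bar> \<le> \<bar>\<beta>\<bar> + (norm h)\<^sup>2 / N"
      using abs_triangle_ineq4[of \<beta> "(norm h)\<^sup>2 / N"] pos by simp
    also have "\<dots> \<le> 2 * (9 * (norm h)\<^sup>2 / N) + (norm h)\<^sup>2 / N"
      using be U(4) by (simp add: N_def)
    also have "\<dots> = 19 * (norm h)\<^sup>2 / N" by (simp add: add_divide_distrib[symmetric])
    finally show "\<bar>\<beta> - (norm h)\<^sup>2 / N\<bar> \<le> 19 * (norm h)\<^sup>2 / N" .
    show "\<bar>\<alpha>\<bar> \<le> 6 * norm h / norm a" using al U(2) by simp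
  qed (use pos in auto)
  also have "\<dots> = 25 * (norm h)\<^sup>2 / (norm a) ^ 3"
    using pos by (simp add: N_def power2_eq_square power3_eq_cube field_simps)
  finally show ?thesis by (simp add: a_def)
qed

text \<open>The product of the expansions of residual and gradient. \<open>C1\<close> and
  \<open>C2\<close> bound the two Taylor remainders, \<open>C3\<close> the gradient and
  \<open>C4\<close> the Hessian; \<open>norm h \<le> 1\<close> lets second-order terms count as
  first-order ones inside products.\<close>

lemma score_expansion:
  fixes s q h :: "real ^ 'm"
  assumes \<delta>: "0 < \<delta>" "\<delta> \<le> norm (q - s)" and h: "norm h \<le> \<delta> / 6" "norm h \<le> 1"
  defines "C1 \<equiv> 10 / \<delta>\<^sup>2" and "C2 \<equiv> 25 / \<delta> ^ 3" and "C3 \<equiv> 1 / \<delta>" and "C4 \<equiv> 3 / \<delta>\<^sup>2"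
  shows "norm ((w - (log_dist s (q + h) - log_dist s q)) *\<^sub>R grad_log_dist s (q + h)
      - (w *\<^sub>R grad_log_dist s q + w *\<^sub>R (hess_log_dist s q *v h) - outer_product (grad_log_dist s q) *v h))
    \<le> (C2 + C1 * C3 + (C3 + C1) * (C4 + C2)) * (1 + \<bar>w\<bar>) * (norm h)\<^sup>2"
proof -
  have pos: "0 < norm (q - s)" and ne: "q \<noteq> s" and h6: "norm h \<le> norm (q - s) / 6" using \<delta> h by auto
  define g where "g = grad_log_dist s q"
  define r where "r = log_dist s (q + h) - log_dist s q - g \<bullet> h"
  define k where "k = hess_log_dist s q *v h"
  define \<rho> where "\<rho> = grad_log_dist s (q + h) - g - k"
  have C: "0 < C1" "0 < C2" "0 < C3" "0 < C4" using \<delta> by (auto simp: C1_def C2_def C3_def C4_def)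
  have r: "\<bar>r\<bar> \<le> C1 * (norm h)\<^sup>2"
  proof -
    have "\<bar>r\<bar> \<le> 10 * (norm h)\<^sup>2 / (norm (q - s))\<^sup>2" unfolding r_def g_def by (rule log_dist_expansion[OF ne h6])
    also have "\<dots> \<le> 10 * (norm h)\<^sup>2 / \<delta>\<^sup>2" using \<delta> by (intro divide_left_mono power_mono mult_pos_pos) auto
    finally show ?thesis by (simp add: C1_def)
  qed
  have \<rho>: "norm \<rho> \<le> C2 * (norm h)\<^sup>2"
  proof -
    have "norm \<rho> \<le> 25 * (norm h)\<^sup>2 / (norm (q - s)) ^ 3"
      unfolding \<rho>_def k_def g_def by (rule grad_log_dist_expansion[OF ne h6])
    also have "\<dots> \<le> 25 * (norm h)\<^sup>2 / \<delta> ^ 3" using \<delta> by (intro divide_left_mono power_mono mult_pos_pos) auto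
    finally show ?thesis by (simp add: C2_def)
  qed
  have l: "0 < 1 / ln (10::real)" "1 / ln (10::real) \<le> 1" using ln_10_ge_1 by auto
  have g: "norm g \<le> C3"
  proof -
    have "norm g = (1 / ln 10) * (1 / norm (q - s))"
      using pos l by (simp add: g_def grad_log_dist_def norm_minus_commute[of s] power2_eq_square)
    also have "\<dots> \<le> 1 * (1 / \<delta>)" using l \<delta> by (intro mult_mono frac_le) auto
    finally show ?thesis by (simp add: C3_def)
  qed
  have k: "norm k \<le> C4 * norm h"
  proof -
    let ?N = "(norm (q - s))\<^sup>2"
    let ?v = "(1 / ?N) *\<^sub>R h - (2 * ((q - s) \<bullet> h) / (?N * ?N)) *\<^sub>R (q - s)"
    have "k = (1 / ln 10) *\<^sub>R (?v)"
      unfolding k_def hess_log_dist_mult_vec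
      by (simp add: scaleR_diff_right mult.commute power4_eq_xxxx power2_eq_square mult.assoc)
    then have "norm k = (1 / ln 10) * norm (?v)"
      using l by simp
    also have "\<dots> \<le> 1 * norm (?v)"
      using l by (intro mult_right_mono) auto
    also have "\<dots> \<le> norm h / ?N + 2 * \<bar>(q - s) \<bullet> h\<bar> / (?N * ?N) * norm (q - s)"
      using norm_triangle_ineq4[of "(1 / ?N) *\<^sub>R h" "(2 * ((q - s) \<bullet> h) / (?N * ?N)) *\<^sub>R (q - s)"]
      by (simp add: abs_mult)
    also have "\<dots> \<le> norm h / ?N + 2 * (norm (q - s) * norm h) / (?N * ?N) * norm (q - s)"
      by (intro add_mono mult_right_mono divide_right_mono mult_left_mono Cauchy_Schwarz_ineq2) auto
    also have "\<dots> = 3 * norm h / ?N" using pos by (simp add: power2_eq_square field_simps)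
    also have "\<dots> \<le> 3 * norm h / \<delta>\<^sup>2" using \<delta> by (intro divide_left_mono power_mono mult_pos_pos) auto
    finally show ?thesis by (simp add: C4_def)
  qed
  have h2: "(norm h)\<^sup>2 \<le> norm h" using h(2) by (simp add: power2_eq_square mult_left_le)
  define d where "d = g \<bullet> h + r"
  have d: "\<bar>d\<bar> \<le> (C3 + C1) * norm h"
  proof -
    have "\<bar>g \<bullet> h\<bar> \<le> C3 * norm h"
      using Cauchy_Schwarz_ineq2[of g h] g by (meson mult_right_mono norm_ge_zero order_trans)
    moreover have "\<bar>r\<bar> \<le> C1 * norm h" using r h2 C by (meson less_imp_le mult_left_mono order_trans)
    ultimately show ?thesis unfolding d_def by (simp add: algebra_simps)
  qed
  have k\<rho>: "norm (k + \<rho>) \<le> (C4 + C2) * norm h"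
  proof -
    have "norm \<rho> \<le> C2 * norm h" using \<rho> h2 C by (meson less_imp_le mult_left_mono order_trans)
    then show ?thesis using norm_triangle_ineq[of k \<rho>] k by (simp add: algebra_simps)
  qed
  have grad: "grad_log_dist s (q + h) = g + (k + \<rho>)" by (simp add: \<rho>_def)
  have ld: "log_dist s (q + h) - log_dist s q = d" by (simp add: d_def r_def)
  have eq: "(w - d) *\<^sub>R (g + (k + \<rho>)) - (w *\<^sub>R g + w *\<^sub>R k - (g \<bullet> h) *\<^sub>R g)
      = w *\<^sub>R \<rho> - r *\<^sub>R g - d *\<^sub>R (k + \<rho>)"
    by (simp add: d_def algebra_simps)
  have "norm (w *\<^sub>R \<rho> - r *\<^sub>R g - d *\<^sub>R (k + \<rho>)) \<le> norm (w *\<^sub>R \<rho>) + norm (r *\<^sub>R g) + norm (d *\<^sub>R (k + \<rho>))"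
    using norm_triangle_ineq4[of "w *\<^sub>R \<rho> - r *\<^sub>R g" "d *\<^sub>R (k + \<rho>)"] norm_triangle_ineq4[of "w *\<^sub>R \<rho>" "r *\<^sub>R g"]
    by linarith
  also have "\<dots> \<le> \<bar>w\<bar> * (C2 * (norm h)\<^sup>2) + (C1 * (norm h)\<^sup>2) * C3 + ((C3 + C1) * norm h) * ((C4 + C2) * norm h)"
    unfolding norm_scaleR using \<rho> r g d k\<rho> C by (intro add_mono mult_mono) auto
  also have "\<dots> = (\<bar>w\<bar> * C2 + (C1 * C3 + (C3 + C1) * (C4 + C2))) * (norm h)\<^sup>2"
    by (simp add: algebra_simps power2_eq_square)
  also have "\<dots> \<le> ((C2 + C1 * C3 + (C3 + C1) * (C4 + C2)) * (1 + \<bar>w\<bar>)) * (norm h)\<^sup>2"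
  proof (rule mult_right_mono)
    define K where "K = C1 * C3 + (C3 + C1) * (C4 + C2)"
    have "0 \<le> K" using C by (simp add: K_def)
    then have "0 \<le> C2 + K * \<bar>w\<bar>" using C by simp
    then show "\<bar>w\<bar> * C2 + (C1 * C3 + (C3 + C1) * (C4 + C2)) \<le> (C2 + C1 * C3 + (C3 + C1) * (C4 + C2)) * (1 + \<bar>w\<bar>)"
      unfolding add.assoc[of C2] K_def[symmetric] by (simp add: algebra_simps)
  qed simp
  finally show ?thesis
    unfolding grad ld outer_product_mult_vec g_def[symmetric] k_def[symmetric] eq .
qed

section \<open>Perturbed linear equations and limits of covariance matrices\<close>

text \<open>Absorption: the error is \<open>matrix_inv M0\<close> applied to terms bounded by
  vanishing factors times \<open>norm (h n)\<close>. Once the total factor is below 1/2,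
  \<open>norm (h n)\<close> is at most twice the norm of the leading term, so no rate for
  \<open>h\<close> has to be known in advance.\<close>

lemma linear_error_bound:
  fixes A K :: "nat \<Rightarrow> real ^ 'm ^ 'm" and h S :: "nat \<Rightarrow> real ^ 'm"
  assumes A: "A \<longlonglongrightarrow> M0" and M0: "invertible M0" and K: "K \<longlonglongrightarrow> 0" and h: "h \<longlonglongrightarrow> 0"
    and le: "\<forall>\<^sub>F n in sequentially. norm (A n *v h n - S n - K n *v h n) \<le> D * (norm (h n))\<^sup>2"
  shows "\<exists>e. e \<longlonglongrightarrow> 0 \<and> (\<forall>\<^sub>F n in sequentially.
    norm (h n - matrix_inv M0 *v S n) \<le> e n * norm (matrix_inv M0 *v S n))"
proof -
  define c where "c = real CARD('m) * real CARD('m)"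
  let ?Q = "matrix_inv M0"
  have mv: "norm (B *v x) \<le> c * norm B * norm x" for B :: "real ^ 'm ^ 'm" and x
    unfolding c_def by (rule norm_matrix_vector_mult_le)
  define e where "e = (\<lambda>n. c * norm ?Q * (c * norm (M0 - A n) + c * norm (K n) + \<bar>D\<bar> * norm (h n)))"
  have "e \<longlonglongrightarrow> c * norm ?Q * (c * norm (M0 - M0) + c * norm (0 :: real ^ 'm ^ 'm) + \<bar>D\<bar> * norm (0 :: real ^ 'm))"
    unfolding e_def by (intro tendsto_intros A K h)
  then have e0: "e \<longlonglongrightarrow> 0" by simp
  then have "\<forall>\<^sub>F n in sequentially. e n < 1 / 2" by (rule order_tendstoD) simp
  with le have "\<forall>\<^sub>F n in sequentially. norm (h n - ?Q *v S n) \<le> 2 * e n * norm (?Q *v S n)"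
  proof eventually_elim
    case (elim n)
    let ?r = "norm (h n - ?Q *v S n)"
    have c0: "0 \<le> c" by (simp add: c_def)
    have en: "0 \<le> e n" unfolding e_def using c0 by (intro mult_nonneg_nonneg add_nonneg_nonneg) auto
    define E where "E = A n *v h n - S n - K n *v h n"
    have "h n - ?Q *v S n = ?Q *v (M0 *v h n - S n)"
      by (simp add: matrix_vector_mult_diff_distrib matrix_inv_mult_vec(2)[OF M0])
    also have "M0 *v h n - S n = (M0 - A n) *v h n + K n *v h n + E"
      by (simp add: E_def matrix_vector_mult_diff_rdistrib)
    finally have 0: "?r \<le> c * norm ?Q * norm ((M0 - A n) *v h n + K n *v h n + E)"
      using mv by metis
    have "norm ((M0 - A n) *v h n + K n *v h n + E) \<le> norm ((M0 - A n) *v h n) + norm (K n *v h n) + norm E"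
      by (meson add_right_mono norm_triangle_ineq order_trans)
    also have "\<dots> \<le> c * norm (M0 - A n) * norm (h n) + c * norm (K n) * norm (h n) + \<bar>D\<bar> * norm (h n) * norm (h n)"
    proof (intro add_mono mv)
      have "norm E \<le> D * (norm (h n))\<^sup>2" using elim(1) by (simp add: E_def)
      also have "\<dots> \<le> \<bar>D\<bar> * (norm (h n))\<^sup>2" by (intro mult_right_mono) auto
      finally show "norm E \<le> \<bar>D\<bar> * norm (h n) * norm (h n)" by (simp add: power2_eq_square mult.assoc)
    qed
    finally have "norm ((M0 - A n) *v h n + K n *v h n + E)
        \<le> (c * norm (M0 - A n) + c * norm (K n) + \<bar>D\<bar> * norm (h n)) * norm (h n)"
      by (simp add: algebra_simps)
    from order_trans[OF 0 mult_left_mono[OF this]] c0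
    have 1: "?r \<le> e n * norm (h n)"
      by (simp add: e_def mult.assoc)
    have "e n * norm (h n) \<le> 1 / 2 * norm (h n)" using elim(2) by (intro mult_right_mono) auto
    moreover have "norm (h n) \<le> ?r + norm (?Q *v S n)"
      using norm_triangle_ineq[of "h n - ?Q *v S n" "?Q *v S n"] by simp
    ultimately have "norm (h n) \<le> 2 * norm (?Q *v S n)" using 1 by linarith
    then have "e n * norm (h n) \<le> e n * (2 * norm (?Q *v S n))" using en by (rule mult_left_mono)
    then show ?case using 1 by simp
  qed
  moreover have "(\<lambda>n. 2 * e n) \<longlonglongrightarrow> 0" using tendsto_mult_left[OF e0, of 2] by simp
  ultimately show ?thesis by blast
qed

lemma matrix_vector_mult_sum: "(\<Sum>i\<in>I. A i) *v x = (\<Sum>i\<in>I. (A i :: real ^ 'n ^ 'm) *v x)"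
  by (induction I rule: infinite_finite_induct) (auto simp: matrix_vector_mult_add_rdistrib)

lemma tendsto_matrix_vector_mult:
  fixes A :: "'a \<Rightarrow> real ^ 'n ^ 'm"
  assumes "(A \<longlongrightarrow> B) F"
  shows "((\<lambda>n. A n *v x) \<longlongrightarrow> B *v x) F"
  unfolding matrix_vector_mult_def
proof (rule vec_tendstoI, simp)
  fix i
  show "((\<lambda>n. \<Sum>j\<in>UNIV. A n $ i $ j * x $ j) \<longlongrightarrow> (\<Sum>j\<in>UNIV. B $ i $ j * x $ j)) F"
    by (intro tendsto_intros assms)
qed

text \<open>Symmetry and \<open>0 \<le> det S0\<close> pass to the limit from matrices regularized
  by a vanishing multiple of the identity; positivity of the form excludes a kernel and hence a zero
  determinant.\<close>

lemma spd_limit_of_outer_products: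
  fixes S0 :: "real ^ 'n ^ 'n"
  assumes conv: "(\<lambda>n. \<Sum>i=1..n. outer_product (c n i)) \<longlonglongrightarrow> S0"
    and pos: "\<And>x. x \<noteq> 0 \<Longrightarrow> 0 < x \<bullet> (S0 *v x)"
  shows "spd S0"
proof -
  define e where "e = (\<lambda>n. 1 / real (Suc n))"
  have e: "0 < e n" for n by (simp add: e_def)
  have e0: "e \<longlonglongrightarrow> 0" unfolding e_def by (rule LIMSEQ_Suc[OF lim_1_over_n])
  define S where "S = (\<lambda>n. (e n)\<^sup>2 *\<^sub>R mat 1 + (\<Sum>i=1..n. outer_product (c n i)))"
  have spdS: "spd (S n)" for n
    unfolding S_def by (intro spd_plus_sum_outer_product spd_scaled_mat_1 e) simp
  have "S \<longlonglongrightarrow> 0\<^sup>2 *\<^sub>R mat 1 + S0"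
    unfolding S_def by (intro tendsto_intros e0 conv)
  then have S: "S \<longlonglongrightarrow> S0" by simp
  have "S0 $ i $ j = S0 $ j $ i" for i j
  proof (rule LIMSEQ_unique)
    show "(\<lambda>n. S n $ i $ j) \<longlonglongrightarrow> S0 $ i $ j" by (intro tendsto_vec_nth S)
    have "S n $ i $ j = S n $ j $ i" for n
    proof -
      have "S n $ i $ j = transpose (S n) $ j $ i" by (simp add: transpose_def)
      also have "transpose (S n) = S n" using spdS[of n] unfolding spd_def by blast
      finally show ?thesis .
    qed
    then show "(\<lambda>n. S n $ i $ j) \<longlonglongrightarrow> S0 $ j $ i" by (simp add: tendsto_vec_nth S)
  qed
  then have "transpose S0 = S0" by (simp add: transpose_def vec_eq_iff)
  moreover have "0 \<le> det S0"
    by (rule LIMSEQ_le_const[OF tendsto_det[OF S]]) (use spdS in \<open>auto simp: spd_def less_imp_le\<close>)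
  moreover have "det S0 \<noteq> 0"
  proof -
    have "\<exists>B. B ** S0 = mat 1"
      unfolding matrix_left_invertible_ker using pos by (metis inner_zero_right less_irrefl)
    then have "invertible S0" by (simp add: invertible_left_inverse)
    then show ?thesis by (simp add: invertible_det_nz)
  qed
  ultimately show ?thesis using pos by (simp add: spd_def)
qed

text \<open>With \<open>Q = matrix_inv M0\<close> the limit is
  \<open>s\<^sup>2 *\<^sub>R (Q ** M0 ** Q)\<close>, which collapses. Symmetry of \<open>Q\<close>
  lets its rows serve as its columns.\<close>

lemma normal_covariance_limit:
  fixes M0 :: "real ^ 'n ^ 'n" and g :: "nat \<Rightarrow> real ^ 'n"
  assumes M0: "spd M0" and conv: "(\<lambda>n. (1 / real n) *\<^sub>R (\<Sum>i=1..n. outer_product (g i))) \<longlonglongrightarrow> M0"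
  shows "(\<lambda>n. \<Sum>i=1..n. outer_product (s *\<^sub>R ((1 / sqrt (real n)) *\<^sub>R (matrix_inv M0 *v g i))))
    \<longlonglongrightarrow> s\<^sup>2 *\<^sub>R matrix_inv M0"
proof (rule vec_tendstoI, rule vec_tendstoI)
  fix j k
  let ?Q = "matrix_inv M0"
  let ?T = "\<lambda>n. \<Sum>i=1..n. outer_product (s *\<^sub>R ((1 / sqrt (real n)) *\<^sub>R (?Q *v g i)))"
  let ?A = "\<lambda>n. (1 / real n) *\<^sub>R (\<Sum>i=1..n. outer_product (g i))"
  have nth: "(?Q *v v) $ i = ?Q $ i \<bullet> v" for i v by (rule matrix_vector_mul_component)
  have row: "?Q $ k = ?Q *v axis k 1"
  proof (simp add: vec_eq_iff, intro allI)
    fix i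
    have "axis i 1 \<bullet> (?Q *v axis k 1) = (?Q *v axis i 1) \<bullet> axis k 1"
      using matrix_inv_inner[OF _ spd_invertible[OF M0]] M0 by (simp add: spd_def)
    then have "(?Q *v axis k 1) $ i = (?Q *v axis i 1) $ k" by (simp add: inner_axis inner_axis')
    then show "?Q $ k $ i = (?Q *v axis k 1) $ i" by (simp add: nth inner_axis)
  qed
  have "?T n $ j $ k
      = s\<^sup>2 * (?Q $ j \<bullet> (?A n *v (?Q $ k)))" for n
  proof -
    have "?T n $ j $ k
      = (\<Sum>i=1..n. s\<^sup>2 * (1 / real n) * ((?Q $ j \<bullet> g i) * (?Q $ k \<bullet> g i)))"
      by (auto simp: outer_product_component nth power2_eq_square intro!: sum.cong)
    also have "\<dots> = s\<^sup>2 * ((1 / real n) * (\<Sum>i=1..n. (?Q $ j \<bullet> g i) * (?Q $ k \<bullet> g i)))"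
      by (simp add: sum_distrib_left mult.assoc)
    also have "(\<Sum>i=1..n. (?Q $ j \<bullet> g i) * (?Q $ k \<bullet> g i)) = ?Q $ j \<bullet> ((\<Sum>i=1..n. outer_product (g i)) *v (?Q $ k))"
      by (simp add: matrix_vector_mult_sum outer_product_mult_vec inner_sum_right inner_commute mult.commute)
    finally show ?thesis by (simp add: scaleR_matrix_vector_assoc[symmetric])
  qed
  moreover have "(\<lambda>n. s\<^sup>2 * (?Q $ j \<bullet> (?A n *v (?Q $ k))))
      \<longlonglongrightarrow> s\<^sup>2 * (?Q $ j \<bullet> (M0 *v (?Q $ k)))"
    by (intro tendsto_intros tendsto_matrix_vector_mult conv)
  moreover have "M0 *v (?Q $ k) = axis k 1"
    unfolding row by (rule matrix_inv_mult_vec(1)[OF spd_invertible[OF M0]])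
  ultimately show "(\<lambda>n. ?T n $ j $ k)
      \<longlonglongrightarrow> (s\<^sup>2 *\<^sub>R ?Q) $ j $ k"
    by (simp add: inner_axis)
qed

context localization
begin

lemma continuous_on_grad: "continuous_on P (\<lambda>s. grad_log_dist s p0 $ j)"
  unfolding grad_log_dist_def vector_scaleR_component vector_minus_component
  using p0_notin by (intro continuous_intros) auto

lemma continuous_on_hess: "continuous_on P (\<lambda>s. hess_log_dist s p0 $ j $ k)"
  unfolding hess_log_dist_def vector_scaleR_component vector_minus_component outer_product_component
  using p0_notin by (intro continuous_intros) auto

lemma bounded_continuous:
  assumes "continuous_on P (f :: real ^ 'm \<Rightarrow> real)"
  shows "\<exists>C. \<forall>s\<in>P. \<bar>f s\<bar> \<le> C"
  using compact_imp_bounded[OF compact_continuous_image[OF assms compact_P]] by (auto simp: bounded_iff)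

text \<open>The quadratic form of the limit at \<open>x\<close> is the integral of a squared
  directional derivative. If it vanished, almost every point would lie on the hyperplane through
  \<open>p0\<close> normal to \<open>x\<close>.\<close>

lemma info_matrix_limit:
  "\<exists>M0. info_matrix p p0 \<longlonglongrightarrow> M0 \<and> spd M0"
proof -
  let ?g = "\<lambda>s. grad_log_dist s p0"
  define M0 :: "real ^ 'm ^ 'm" where "M0 = (\<chi> j k. LINT s:P|\<mu>. ?g s $ j * ?g s $ k)"
  have comp: "info_matrix p p0 n $ j $ k = avg n (\<lambda>i. ?g (p i) $ j * ?g (p i) $ k)" for n j k
    by (simp add: info_matrix_def avg_def outer_product_component)
  have conv: "info_matrix p p0 \<longlonglongrightarrow> M0"
  proof (rule vec_tendstoI, rule vec_tendstoI)
    fix j k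
    show "(\<lambda>n. info_matrix p p0 n $ j $ k) \<longlonglongrightarrow> M0 $ j $ k"
      unfolding comp M0_def vec_lambda_beta
      by (intro tendsto_avg_continuous continuous_intros continuous_on_grad)
  qed
  have pos: "0 < x \<bullet> (M0 *v x)" if x: "x \<noteq> 0" for x
  proof -
    let ?I = "(LINT s:P|\<mu>. (?g s \<bullet> x)\<^sup>2)"
    have c: "continuous_on P (\<lambda>s. (?g s \<bullet> x)\<^sup>2)"
      unfolding inner_vec_def by (intro continuous_intros continuous_on_grad)
    have "x \<bullet> (info_matrix p p0 n *v x) = avg n (\<lambda>i. (?g (p i) \<bullet> x)\<^sup>2)" for n
      by (simp add: info_matrix_def avg_def scaleR_matrix_vector_assoc[symmetric] matrix_vector_mult_sum
          outer_product_mult_vec inner_sum_right inner_commute power2_eq_square)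
    then have "(\<lambda>n. avg n (\<lambda>i. (?g (p i) \<bullet> x)\<^sup>2)) \<longlonglongrightarrow> x \<bullet> (M0 *v x)"
      using tendsto_inner[OF tendsto_const tendsto_matrix_vector_mult[OF conv], of x x] by simp
    then have eq: "x \<bullet> (M0 *v x) = ?I"
      by (rule LIMSEQ_unique[OF _ tendsto_avg_continuous[OF c]])
    have "0 \<le> ?I"
      unfolding set_lebesgue_integral_def by (intro integral_nonneg_AE) auto
    moreover have "?I \<noteq> 0"
    proof
      assume "?I = 0"
      then have "AE s in \<mu>. s \<in> P \<and> (?g s \<bullet> x)\<^sup>2 = 0"
        by (intro AE_zero_of_set_integral_zero[OF c]) auto
      then have "AE s in \<mu>. s \<in> P \<and> x \<bullet> s = x \<bullet> p0"
      proof eventually_elim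
        case (elim s)
        then have "norm (s - p0) \<noteq> 0" using p0_notin by auto
        then have "(p0 - s) \<bullet> x = 0" using elim by (simp add: grad_log_dist_def)
        then have "p0 \<bullet> x = s \<bullet> x" by (simp add: inner_diff_left)
        then show ?case using elim by (simp add: inner_commute)
      qed
      then show False using nondegenerate[OF x] by blast
    qed
    ultimately show ?thesis unfolding eq by linarith
  qed
  have "spd M0"
  proof (rule spd_limit_of_outer_products[OF _ pos])
    have eq: "info_matrix p p0 = (\<lambda>n. \<Sum>i=1..n. outer_product ((1 / sqrt (real n)) *\<^sub>R ?g (p i)))"
      by (auto simp: fun_eq_iff info_matrix_def vec_eq_iff outer_product_component sum_distrib_left intro!: sum.cong)
    show "(\<lambda>n. \<Sum>i=1..n. outer_product ((1 / sqrt (real n)) *\<^sub>R ?g (p i))) \<longlonglongrightarrow> M0"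
      using conv unfolding eq .
  qed
  then show ?thesis using conv by blast
qed

text \<open>The exact scores at the estimate sum to 0, so the linear parts of their expansions at
  \<open>p0\<close> sum to the remainders up to sign; bounded means of
  \<open>\<bar>w i\<bar>\<close> control those.\<close>

lemma score_linearization:
  assumes y: "\<And>i. i \<ge> 1 \<Longrightarrow> y i = log_dist (p i) p0 + w i"
    and B: "\<And>n. avg n (\<lambda>i. \<bar>w i\<bar>) \<le> B"
    and ml: "\<And>n. n \<ge> 1 \<Longrightarrow> is_ML_estimate p y n (phat n)"
    and cons: "phat \<longlonglongrightarrow> p0"
  shows "\<exists>D. \<forall>\<^sub>F n in sequentially. norm (info_matrix p p0 n *v (phat n - p0)
      - (1 / real n) *\<^sub>R (\<Sum>i=1..n. w i *\<^sub>R grad_log_dist (p i) p0)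
      - ((1 / real n) *\<^sub>R (\<Sum>i=1..n. w i *\<^sub>R hess_log_dist (p i) p0)) *v (phat n - p0))
    \<le> D * (norm (phat n - p0))\<^sup>2"
    (is "\<exists>D. eventually (\<lambda>n. ?lhs n \<le> D * _ n) _")
proof -
  obtain \<delta> R where R: "0 < \<delta>" "0 < R" "\<And>s. s \<in> P \<Longrightarrow> \<delta> \<le> norm (s - p0)"
    "\<And>s. s \<in> P \<Longrightarrow> norm (s - p0) \<le> R" "\<And>s. s \<in> P \<Longrightarrow> norm s \<le> R" by (rule dist_bounds) blast
  define C where "C = 25 / \<delta> ^ 3 + 10 / \<delta>\<^sup>2 * (1 / \<delta>) + (1 / \<delta> + 10 / \<delta>\<^sup>2) * (3 / \<delta>\<^sup>2 + 25 / \<delta> ^ 3)"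
  have C0: "0 \<le> C" using R(1) by (simp add: C_def)
  have "(\<lambda>n. norm (phat n - p0)) \<longlonglongrightarrow> 0" using cons by (simp add: tendsto_norm_zero LIM_zero)
  then have "\<forall>\<^sub>F n in sequentially. norm (phat n - p0) < min (\<delta> / 6) 1"
    using R(1) by (intro order_tendstoD) auto
  with eventually_ge_at_top[of 1]
  have "\<forall>\<^sub>F n in sequentially. ?lhs n \<le> (C * (1 + B)) * (norm (phat n - p0))\<^sup>2"
  proof eventually_elim
    case (elim n)
    define h where "h = phat n - p0"
    let ?g = "\<lambda>i. grad_log_dist (p i) p0" and ?H = "\<lambda>i. hess_log_dist (p i) p0"
    let ?lin = "\<lambda>i. w i *\<^sub>R ?g i + w i *\<^sub>R (?H i *v h) - outer_product (?g i) *v h"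
    let ?sc = "\<lambda>i. (w i - (log_dist (p i) (p0 + h) - log_dist (p i) p0)) *\<^sub>R grad_log_dist (p i) (p0 + h)"
    have p0: "p0 \<noteq> p i" if "1 \<le> i" for i using p_in_P[OF that] p0_notin by auto
    have "(\<Sum>i=1..n. (y i - log_dist (p i) (phat n)) *\<^sub>R grad_log_dist (p i) (phat n)) = 0"
      by (rule estimate_first_order_condition[OF ml[OF elim(1)]]) (rule p0)
    moreover have "(\<Sum>i=1..n. ?sc i) = (\<Sum>i=1..n. (y i - log_dist (p i) (phat n)) *\<^sub>R grad_log_dist (p i) (phat n))"
      by (intro sum.cong refl) (auto simp: h_def y algebra_simps)
    ultimately have foc: "(\<Sum>i=1..n. ?sc i) = 0" by simp
    let ?L = "info_matrix p p0 n *v h - (1 / real n) *\<^sub>R (\<Sum>i=1..n. w i *\<^sub>R ?g i)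
        - ((1 / real n) *\<^sub>R (\<Sum>i=1..n. w i *\<^sub>R ?H i)) *v h"
    have "?L = - (1 / real n) *\<^sub>R (\<Sum>i=1..n. ?lin i)"
    proof -
      have e1: "info_matrix p p0 n *v h = (1 / real n) *\<^sub>R (\<Sum>i=1..n. outer_product (?g i) *v h)"
        by (simp add: info_matrix_def scaleR_matrix_vector_assoc[symmetric] matrix_vector_mult_sum)
      have e2: "((1 / real n) *\<^sub>R (\<Sum>i=1..n. w i *\<^sub>R ?H i)) *v h = (1 / real n) *\<^sub>R (\<Sum>i=1..n. w i *\<^sub>R (?H i *v h))"
        by (simp add: scaleR_matrix_vector_assoc[symmetric] matrix_vector_mult_sum)
      have e3: "c *\<^sub>R u - c *\<^sub>R v - c *\<^sub>R z = - c *\<^sub>R (v + z - u)" for c and u v z :: "real ^ 'm"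
        by (simp add: algebra_simps)
      show ?thesis unfolding e1 e2 sum.distrib sum_subtractf by (rule e3)
    qed
    also have "\<dots> = (1 / real n) *\<^sub>R ((\<Sum>i=1..n. ?sc i) - (\<Sum>i=1..n. ?lin i))"
      unfolding foc by simp
    also have "\<dots> = (1 / real n) *\<^sub>R (\<Sum>i=1..n. ?sc i - ?lin i)"
      by (simp only: sum_subtractf[of ?sc ?lin])
    finally have "norm (?L) = norm (\<Sum>i=1..n. ?sc i - ?lin i) / real n"
      by simp
    also have "\<dots> \<le> (\<Sum>i=1..n. C * (1 + \<bar>w i\<bar>) * (norm h)\<^sup>2) / real n"
    proof (intro divide_right_mono sum_norm_le)
      fix i assume "i \<in> {1..n}"
      then have s: "p i \<in> P" using p_in_P by auto
      show "norm (?sc i - ?lin i) \<le> C * (1 + \<bar>w i\<bar>) * (norm h)\<^sup>2"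
        unfolding C_def using R(1) R(3)[OF s] elim(2)
        by (intro score_expansion) (auto simp: h_def norm_minus_commute)
    qed simp
    also have "\<dots> = C * (norm h)\<^sup>2 * avg n (\<lambda>i. 1 + \<bar>w i\<bar>)"
      unfolding avg_cmult[symmetric] by (simp add: avg_def mult_ac)
    also have "\<dots> \<le> C * (norm h)\<^sup>2 * (1 + B)"
      using B[of n] C0 elim(1) by (intro mult_left_mono) (auto simp: avg_add avg_const)
    finally show ?case by (simp add: h_def mult_ac)
  qed
  then show ?thesis by blast
qed

text \<open>Still for one outcome. Dividing by \<open>1 + norm (W n)\<close> avoids a zero
  denominator and expresses a relative error, to be made absolute by the second moments of
  \<open>W\<close>.\<close>

lemma asymptotic_linearity:
  assumes y: "\<And>i. i \<ge> 1 \<Longrightarrow> y i = log_dist (p i) p0 + w i"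
    and B: "\<And>n. avg n (\<lambda>i. \<bar>w i\<bar>) \<le> B"
    and ml: "\<And>n. n \<ge> 1 \<Longrightarrow> is_ML_estimate p y n (phat n)"
    and cons: "phat \<longlonglongrightarrow> p0"
    and H: "\<And>j k. (\<lambda>n. avg n (\<lambda>i. w i * hess_log_dist (p i) p0 $ j $ k)) \<longlonglongrightarrow> 0"
    and M0: "info_matrix p p0 \<longlonglongrightarrow> M0" "invertible M0"
  defines "W \<equiv> \<lambda>n. \<Sum>i=1..n. w i *\<^sub>R ((1 / sqrt (real n)) *\<^sub>R (matrix_inv M0 *v grad_log_dist (p i) p0))"
  shows "(\<lambda>n. norm (sqrt (real n) *\<^sub>R (phat n - p0) - W n) / (1 + norm (W n))) \<longlonglongrightarrow> 0"
proof -
  let ?Q = "matrix_inv M0"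
  let ?S = "\<lambda>n. (1 / real n) *\<^sub>R (\<Sum>i=1..n. w i *\<^sub>R grad_log_dist (p i) p0)"
  let ?K = "\<lambda>n. (1 / real n) *\<^sub>R (\<Sum>i=1..n. w i *\<^sub>R hess_log_dist (p i) p0)"
  obtain D where D: "\<forall>\<^sub>F n in sequentially. norm (info_matrix p p0 n *v (phat n - p0) - ?S n
      - ?K n *v (phat n - p0)) \<le> D * (norm (phat n - p0))\<^sup>2"
    using score_linearization[OF y B ml cons] by blast
  have K: "?K \<longlonglongrightarrow> 0"
    using H by (intro vec_tendstoI) (simp add: avg_def)
  have h: "(\<lambda>n. phat n - p0) \<longlonglongrightarrow> 0" using cons by (simp add: LIM_zero)
  obtain e where e: "e \<longlonglongrightarrow> 0" "\<forall>\<^sub>F n in sequentially.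
      norm (phat n - p0 - ?Q *v ?S n) \<le> e n * norm (?Q *v ?S n)"
    using linear_error_bound[OF M0 K h D] by blast
  have W: "W n = sqrt (real n) *\<^sub>R (?Q *v ?S n)" for n
  proof (cases "n = 0")
    case False
    then have "x * sqrt (real n) / real n = x / sqrt (real n)" for x
      by (simp add: field_simps)
    moreover have "?Q *v ?S n = (1 / real n) *\<^sub>R (\<Sum>i=1..n. w i *\<^sub>R (?Q *v grad_log_dist (p i) p0))"
      by (simp add: matrix_vector_mult_scaleR linear_sum[OF matrix_vector_mul_linear])
    ultimately show ?thesis
      by (simp add: W_def scaleR_sum_right mult.commute)
  qed (simp add: W_def)
  show ?thesis
  proof (rule Lim_null_comparison)
    show "(\<lambda>n. \<bar>e n\<bar>) \<longlonglongrightarrow> 0" using tendsto_rabs_zero[OF e(1)] .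
    show "\<forall>\<^sub>F n in sequentially. norm (norm (sqrt (real n) *\<^sub>R (phat n - p0) - W n) / (1 + norm (W n))) \<le> \<bar>e n\<bar>"
      using e(2)
    proof eventually_elim
      case (elim n)
      have "norm (sqrt (real n) *\<^sub>R (phat n - p0) - W n) = sqrt (real n) * norm (phat n - p0 - ?Q *v ?S n)"
        unfolding W scaleR_diff_right[symmetric] by simp
      also have "\<dots> \<le> sqrt (real n) * (e n * norm (?Q *v ?S n))"
        by (intro mult_left_mono elim) simp
      also have "\<dots> = e n * norm (W n)" unfolding W by simp
      also have "\<dots> \<le> \<bar>e n\<bar> * (1 + norm (W n))" by (intro mult_mono) auto
      finally show ?case by (simp add: pos_divide_le_eq add_pos_nonneg)
    qed
  qed
qed

end

section \<open>From almost sure relative errors to errors in probability\<close>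

lemma (in prob_space) AE_tendsto_imp_prob_tendsto:
  fixes X :: "nat \<Rightarrow> 'a \<Rightarrow> real"
  assumes [measurable]: "\<And>n. X n \<in> borel_measurable M"
    and ae: "AE \<omega> in M. (\<lambda>n. X n \<omega>) \<longlonglongrightarrow> 0" and e: "0 < e"
  shows "(\<lambda>n. prob {\<omega> \<in> space M. e < X n \<omega>}) \<longlonglongrightarrow> 0"
proof -
  have "(\<lambda>n. \<integral>\<omega>. indicator {\<omega> \<in> space M. e < X n \<omega>} \<omega> \<partial>M) \<longlonglongrightarrow> (\<integral>\<omega>. (0::real) \<partial>M)"
  proof (rule integral_dominated_convergence[where w = "\<lambda>_. 1"])
    show "AE \<omega> in M. (\<lambda>n. indicator {\<omega> \<in> space M. e < X n \<omega>} \<omega>) \<longlonglongrightarrow> (0::real)"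
      using ae
    proof eventually_elim
      case (elim \<omega>)
      then have "\<forall>\<^sub>F n in sequentially. X n \<omega> < e" using e by (rule order_tendstoD)
      then have "\<forall>\<^sub>F n in sequentially. indicator {\<omega> \<in> space M. e < X n \<omega>} \<omega> = (0::real)"
        by eventually_elim auto
      then show ?case by (rule tendsto_eventually)
    qed
  qed (auto split: split_indicator)
  then show ?thesis by simp
qed

text \<open>Bounded second moments keep \<open>1 + norm (W n)\<close> below \<open>t\<close> outside
  an event of probability less than \<open>e / 2\<close>; on the rest a relative error of
  \<open>d / t\<close> is an absolute error of at most \<open>d\<close>.\<close>

lemma (in prob_space) prob_not_close_tendsto:
  fixes Z W :: "nat \<Rightarrow> 'a \<Rightarrow> real ^ 'n"
  assumes [measurable]: "\<And>n. Z n \<in> borel_measurable M" "\<And>n. W n \<in> borel_measurable M"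
    and ae: "AE \<omega> in M. (\<lambda>n. norm (Z n \<omega> - W n \<omega>) / (1 + norm (W n \<omega>))) \<longlonglongrightarrow> 0"
    and W2: "\<And>n. integrable M (\<lambda>\<omega>. (norm (W n \<omega>))\<^sup>2)" "\<And>n. expectation (\<lambda>\<omega>. (norm (W n \<omega>))\<^sup>2) \<le> V"
    and d: "0 < d"
  shows "(\<lambda>n. prob {\<omega> \<in> space M. \<not> norm (Z n \<omega> - W n \<omega>) \<le> d}) \<longlonglongrightarrow> 0"
proof (rule tendstoI)
  fix e :: real assume e: "0 < e"
  have V: "0 \<le> V" by (rule order_trans[OF _ W2(2)[of 0]]) simp
  \<comment> \<open>Here \<open>t - 1\<close> is at least 1 and exceeds \<open>2 * V / e\<close>, so
    Markov's inequality at level \<open>(t - 1)\<^sup>2\<close> gives less than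
    \<open>e / 2\<close>.\<close>
  define t where "t = 2 + 2 * V / e"
  have t: "2 \<le> t" using V e by (simp add: t_def)
  have Vt: "V / (t - 1)\<^sup>2 < e / 2"
  proof -
    have "2 * V / e < t - 1" by (simp add: t_def)
    also have "\<dots> \<le> (t - 1)\<^sup>2" using t by (simp add: power2_eq_square)
    finally show ?thesis using t e by (simp add: field_simps)
  qed
  let ?r = "\<lambda>n \<omega>. norm (Z n \<omega> - W n \<omega>) / (1 + norm (W n \<omega>))"
  have "(\<lambda>n. prob {\<omega> \<in> space M. d / t < ?r n \<omega>}) \<longlonglongrightarrow> 0"
    by (rule AE_tendsto_imp_prob_tendsto[OF _ ae]) (use d t in auto)
  then have "\<forall>\<^sub>F n in sequentially. prob {\<omega> \<in> space M. d / t < ?r n \<omega>} < e / 2"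
    using e by (intro order_tendstoD) auto
  then show "\<forall>\<^sub>F n in sequentially. dist (prob {\<omega> \<in> space M. \<not> norm (Z n \<omega> - W n \<omega>) \<le> d}) 0 < e"
  proof eventually_elim
    case (elim n)
    let ?C = "{\<omega> \<in> space M. \<not> norm (Z n \<omega> - W n \<omega>) \<le> d}"
    let ?B = "{\<omega> \<in> space M. (norm (W n \<omega>))\<^sup>2 \<ge> (t - 1)\<^sup>2}"
    let ?A = "{\<omega> \<in> space M. d / t < ?r n \<omega>}"
    have "prob ?B \<le> expectation (\<lambda>\<omega>. (norm (W n \<omega>))\<^sup>2) / (t - 1)\<^sup>2"
      using t by (intro integral_Markov_inequality_measure[where A = "{}"] W2) auto
    also have "\<dots> \<le> V / (t - 1)\<^sup>2" by (intro divide_right_mono W2) simp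
    finally have 1: "prob ?B < e / 2" using Vt by linarith
    have "prob ?C
      \<le> prob (?A \<union> ?B)"
    proof (rule finite_measure_mono)
      show "?C
        \<subseteq> ?A \<union> ?B"
      proof (rule subsetI, rule ccontr)
        fix \<omega> assume a: "\<omega> \<in> ?C"
          and b: "\<omega> \<notin> ?A \<union> ?B"
        have "(norm (W n \<omega>))\<^sup>2 < (t - 1)\<^sup>2" "?r n \<omega> \<le> d / t" using a b by auto
        then have w: "norm (W n \<omega>) < t - 1" "?r n \<omega> \<le> d / t"
          using t power2_less_imp_less[of "norm (W n \<omega>)" "t - 1"] by auto
        have p: "0 < 1 + norm (W n \<omega>)" by (simp add: add_pos_nonneg)
        have "norm (Z n \<omega> - W n \<omega>) = ?r n \<omega> * (1 + norm (W n \<omega>))" using p by simp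
        also have "\<dots> \<le> d / t * t" using w t d p by (intro mult_mono) auto
        finally show False using a t by simp
      qed
    qed measurable
    also have "\<dots> \<le> prob ?A + prob ?B"
      by (intro measure_Un_le) measurable
    finally show ?case using elim 1 by (simp add: dist_real_def)
  qed
qed

section \<open>Moments of the noise and laws of large numbers\<close>

context normal_noise
begin

definition moment :: "nat \<Rightarrow> real" where
  "moment k = (\<integral>x. normal_density 0 s x * x ^ k \<partial>lborel)"

lemma noise_moment:
  assumes i: "i \<ge> 1"
  shows "integrable M (\<lambda>\<omega>. w i \<omega> ^ k)" "expectation (\<lambda>\<omega>. w i \<omega> ^ k) = moment k"
proof -
  have "integrable lborel (\<lambda>x. normal_density 0 s x * x ^ k)"
    using integrable_normal_moment[of s 0 k] s_pos by simp
  then show "integrable M (\<lambda>\<omega>. w i \<omega> ^ k)"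
    using distributed_integrable[OF normal[OF i], of "\<lambda>x. x ^ k"] by simp
  show "expectation (\<lambda>\<omega>. w i \<omega> ^ k) = moment k"
    unfolding moment_def by (subst distributed_integral[OF normal[OF i], symmetric]) auto
qed

lemma noise_mean: "i \<ge> 1 \<Longrightarrow> expectation (w i) = 0"
  using normal_distributed_expectation[OF s_pos normal] .

lemma moment_4_nonneg: "0 \<le> moment 4"
  unfolding moment_def by (intro integral_nonneg_AE) auto

lemma scaled_noise:
  assumes b: "\<And>i. i \<ge> 1 \<Longrightarrow> \<bar>b i\<bar> \<le> C"
  shows "indep_vars (\<lambda>_. borel) (\<lambda>i \<omega>. w i \<omega> * b i) {1..}"
    and "i \<ge> 1 \<Longrightarrow> integrable M (\<lambda>\<omega>. (w i \<omega> * b i) ^ 4)"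
    and "i \<ge> 1 \<Longrightarrow> expectation (\<lambda>\<omega>. (w i \<omega> * b i) ^ 4) \<le> moment 4 * C ^ 4"
    and "i \<ge> 1 \<Longrightarrow> expectation (\<lambda>\<omega>. w i \<omega> * b i) = 0"
proof -
  show "indep_vars (\<lambda>_. borel) (\<lambda>i \<omega>. w i \<omega> * b i) {1..}"
    by (rule indep_vars_compose2[OF indep, where Y = "\<lambda>i x. x * b i"]) simp
  assume i: "i \<ge> 1"
  show "integrable M (\<lambda>\<omega>. (w i \<omega> * b i) ^ 4)"
    using noise_moment(1)[OF i, of 4] by (simp add: power_mult_distrib)
  have "b i ^ 4 \<le> C ^ 4" using power_mono[OF b[OF i], of 4] by simp
  then show "expectation (\<lambda>\<omega>. (w i \<omega> * b i) ^ 4) \<le> moment 4 * C ^ 4"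
    using noise_moment(2)[OF i, of 4] moment_4_nonneg by (simp add: power_mult_distrib mult_left_mono)
  show "expectation (\<lambda>\<omega>. w i \<omega> * b i) = 0" using noise_mean[OF i] by simp
qed

text \<open>The weights will be clamped differences at points of a countable set and Hessian entries
  at \<open>p0\<close>, both bounded on \<open>P\<close>.\<close>

lemma weighted_lln:
  assumes b: "\<And>i. i \<ge> 1 \<Longrightarrow> \<bar>b i\<bar> \<le> C"
  shows "AE \<omega> in M. (\<lambda>n. avg n (\<lambda>i. w i \<omega> * b i)) \<longlonglongrightarrow> 0"
  unfolding avg_def
  by (rule slln_fourth_moment) (blast intro: scaled_noise[where b = b and C = C] b)+

lemma weighted_sum_second_moment:
  assumes b: "\<And>i. i \<ge> 1 \<Longrightarrow> \<bar>b i\<bar> \<le> C"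
  shows "integrable M (\<lambda>\<omega>. (\<Sum>i=1..n. w i \<omega> * b i)\<^sup>2)"
    and "expectation (\<lambda>\<omega>. (\<Sum>i=1..n. w i \<omega> * b i)\<^sup>2) \<le> real n * (1 + moment 4 * C ^ 4)"
proof -
  let ?S = "(\<lambda>\<omega>. (\<Sum>i=1..n. w i \<omega> * b i)\<^sup>2)"
  have B: "integrable M (\<lambda>\<omega>. (\<Sum>i=1..n. w i \<omega> * b i) ^ 4) \<and> expectation (\<lambda>\<omega>. \<Sum>i=1..n. w i \<omega> * b i) = 0 \<and>
      expectation ?S \<le> real n * (1 + moment 4 * C ^ 4) \<and>
      expectation (\<lambda>\<omega>. (\<Sum>i=1..n. w i \<omega> * b i) ^ 4) \<le> 7 * (1 + moment 4 * C ^ 4)\<^sup>2 * (real n)\<^sup>2"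
    by (rule sum_fourth_moment_bound) (blast intro: scaled_noise[where b = b and C = C] b)+
  show "expectation ?S \<le> real n * (1 + moment 4 * C ^ 4)"
    using B by blast
  have "(\<lambda>\<omega>. \<Sum>i=1..n. w i \<omega> * b i) \<in> borel_measurable M"
    by (intro borel_measurable_sum borel_measurable_times w_measurable) auto
  then show "integrable M ?S"
    by (rule integrable_lower_power) (use B in auto)
qed

text \<open>The strong law for the centred fourth powers; their own fourth moments involve the
  sixteenth moment of the noise, finite for a normal law.\<close>

lemma fourth_powers_bounded: "AE \<omega> in M. \<exists>B. \<forall>n. avg n (\<lambda>i. w i \<omega> ^ 4) \<le> B"
proof -
  let ?X = "\<lambda>i \<omega>. w i \<omega> ^ 4 - moment 4"
  have X4: "?X i \<omega> ^ 4 = w i \<omega> ^ 16 - 4 * moment 4 * w i \<omega> ^ 12 + 6 * (moment 4)\<^sup>2 * w i \<omega> ^ 8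
      - 4 * moment 4 ^ 3 * w i \<omega> ^ 4 + moment 4 ^ 4" for i \<omega>
    by algebra
  have "AE \<omega> in M. (\<lambda>n. (\<Sum>i=1..n. ?X i \<omega>) / real n) \<longlonglongrightarrow> 0"
  proof (rule slln_fourth_moment)
    show "indep_vars (\<lambda>_. borel) ?X {1..}"
      by (rule indep_vars_compose2[OF indep, where Y = "\<lambda>i x. x ^ 4 - moment 4"]) simp
    fix i :: nat assume i: "i \<ge> 1"
    show "integrable M (\<lambda>\<omega>. ?X i \<omega> ^ 4)" unfolding X4 by (simp add: noise_moment[OF i])
    show "expectation (\<lambda>\<omega>. ?X i \<omega> ^ 4) \<le> moment 16 - 4 * moment 4 * moment 12 + 6 * (moment 4)\<^sup>2 * moment 8
        - 4 * moment 4 ^ 3 * moment 4 + moment 4 ^ 4"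
      unfolding X4 by (simp add: noise_moment[OF i] prob_space)
    show "expectation (?X i) = 0"
      using noise_moment[OF i, of 4] by (simp add: prob_space)
  qed
  then show ?thesis
  proof eventually_elim
    case (elim \<omega>)
    then have "Bseq (\<lambda>n. (\<Sum>i=1..n. ?X i \<omega>) / real n)"
      by (intro convergent_imp_Bseq) (auto simp: convergent_def)
    then obtain K where K: "\<And>n. \<bar>avg n (\<lambda>i. ?X i \<omega>)\<bar> \<le> K"
      unfolding avg_def by (auto simp: Bseq_def)
    have "avg n (\<lambda>i. w i \<omega> ^ 4) \<le> K + moment 4" for n
    proof -
      have "avg n (\<lambda>i. w i \<omega> ^ 4) = avg n (\<lambda>i. ?X i \<omega>) + avg n (\<lambda>i. moment 4)"
        unfolding avg_add[symmetric] by simp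
      moreover have "avg n (\<lambda>i. moment 4) \<le> moment 4"
        by (rule avg_le_const[OF moment_4_nonneg]) simp
      ultimately show ?thesis using K[of n] unfolding abs_le_iff by linarith
    qed
    then show ?case by blast
  qed
qed

end

theorem proposition1:
  fixes M :: "'a measure"
    and p0 :: "real ^ 'm" and p :: "nat \<Rightarrow> real ^ 'm" and P0 P :: "(real ^ 'm) set"
    and \<alpha> \<sigma> :: real
    and w y :: "nat \<Rightarrow> 'a \<Rightarrow> real"
    and \<mu> :: "(real ^ 'm) measure"
    and phat :: "nat \<Rightarrow> 'a \<Rightarrow> real ^ 'm"
  assumes dim: "CARD('m) \<in> {2, 3}"
    and p0: "p0 \<in> P0" and p: "\<And>i. i \<ge> 1 \<Longrightarrow> p i \<in> P"
    and params: "\<alpha> > 0" "0 < \<sigma>\<^sup>2"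
    and prob: "prob_space M"
    and noise_indep: "prob_space.indep_vars M (\<lambda>_. borel) w {1..}"
    and noise_normal: "\<And>i. i \<ge> 1 \<Longrightarrow>
          distributed M lborel (w i) (normal_density 0 (sqrt (\<sigma>\<^sup>2 / (100 * \<alpha>\<^sup>2))))"
    and y: "\<And>i x. i \<ge> 1 \<Longrightarrow> x \<in> space M \<Longrightarrow> y i x = log 10 (norm (p i - p0)) + w i x"
    and compact: "compact P0" "compact P" and disjoint: "P0 \<inter> P = {}"
    and mu: "prob_space \<mu>" "sets \<mu> = sets borel"
    and empirical: "vec_weak_conv (empirical_cdf p) (vec_cdf \<mu>)"
    and nondegenerate_finite: "\<And>n. n \<ge> CARD('m) + 1 \<Longrightarrow> \<not> on_line_or_plane (p ` {1..n})"
    and nondegenerate_limit: "\<not> (\<exists>P' \<in> sets \<mu>. P' \<subseteq> P \<and> measure \<mu> P' = 1 \<and> on_line_or_plane P')"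
    and phat_measurable: "\<And>n. phat n \<in> borel_measurable M"
    and phat: "\<And>n x. n \<ge> 1 \<Longrightarrow> x \<in> space M \<Longrightarrow> is_ML_estimate p (\<lambda>i. y i x) n (phat n x)"
  shows "(AE x in M. (\<lambda>n. phat n x) \<longlonglongrightarrow> p0) \<and>
         (\<exists>M0. info_matrix p p0 \<longlonglongrightarrow> M0 \<and> invertible M0 \<and>
            converges_in_distribution M (\<lambda>n x. sqrt (real n) *\<^sub>R (phat n x - p0))
              (mv_normal 0 ((\<sigma>\<^sup>2 / (100 * \<alpha>\<^sup>2)) *\<^sub>R matrix_inv M0)))"
proof -
  define s where "s = sqrt (\<sigma>\<^sup>2 / (100 * \<alpha>\<^sup>2))"
  have s: "0 < s" "s\<^sup>2 = \<sigma>\<^sup>2 / (100 * \<alpha>\<^sup>2)" using params by (auto simp: s_def)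
  interpret normal_noise M w s
    by (intro normal_noise.intro normal_noise_axioms.intro prob noise_indep noise_normal[folded s_def] s)
  interpret loc: localization \<mu> p P p0
  proof (intro localization.intro weakly_convergent_points.intro weakly_convergent_points_axioms.intro
      localization_axioms.intro mu empirical compact(2) p)
    show "p0 \<notin> P" using p0 disjoint by auto
    fix a :: "real ^ 'm" and b assume a: "a \<noteq> 0"
    show "\<not> (AE s in \<mu>. s \<in> P \<and> a \<bullet> s = b)"
    proof
      assume AE: "AE s in \<mu>. s \<in> P \<and> a \<bullet> s = b"
      interpret mu: prob_space \<mu> by (rule mu(1))
      \<comment> \<open>Closed, hence measurable, and so an admissible witness against
        \<open>nondegenerate_limit\<close>.\<close>
      let ?P' = "P \<inter> {s. a \<bullet> s = b}"
      have "closed ?P'" by (intro closed_Int compact_imp_closed compact(2) closed_hyperplane)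
      then have P': "?P' \<in> sets \<mu>" by (simp add: mu(2))
      have "measure \<mu> ?P' = 1" using AE P' by (subst mu.prob_eq_1) auto
      moreover have "on_line_or_plane ?P'" by (rule on_line_or_plane_hyperplane[OF dim a]) (rule Int_lower2)
      ultimately have "\<exists>P'\<in>sets \<mu>. P' \<subseteq> P \<and> measure \<mu> P' = 1 \<and> on_line_or_plane P'"
        by (intro bexI[of _ ?P'] conjI Int_lower1 P')
      then show False using nondegenerate_limit by contradiction
    qed
  qed
  have y': "y i x = log_dist (p i) p0 + w i x" if "i \<ge> 1" "x \<in> space M" for i x
    using y[OF that] by (simp add: log_dist_def)
  \<comment> \<open>Countability merges the laws at single points into one almost sure event;
    density serves the uniform argument.\<close>
  obtain Q :: "(real ^ 'm) set" where Q: "countable Q" "\<And>X. open X \<Longrightarrow> X \<noteq> {} \<Longrightarrow> \<exists>d\<in>Q. d \<in> X"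
    by (rule countable_dense_setE) blast
  have dense: "\<exists>q\<in>Q. dist q x < e" if "0 < e" for x e
    using Q(2)[of "ball x e"] that by (auto simp: dist_commute)
  have lln: "AE x in M. \<forall>q\<in>Q. \<forall>T. (\<lambda>n. avg n (\<lambda>i. w i x * loc.tdiff (real (Suc T)) (p i) q)) \<longlonglongrightarrow> 0"
    unfolding AE_ball_countable[OF Q(1)] AE_all_countable
  proof (intro ballI allI)
    fix q and T :: nat
    show "AE x in M. (\<lambda>n. avg n (\<lambda>i. w i x * loc.tdiff (real (Suc T)) (p i) q)) \<longlonglongrightarrow> 0"
      by (rule weighted_lln[where C = "real (Suc T)"]) (rule loc.abs_tdiff_le, simp)
  qed
  have consistent: "AE x in M. (\<lambda>n. phat n x) \<longlonglongrightarrow> p0"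
    using lln fourth_powers_bounded AE_space
  proof eventually_elim
    case (elim x)
    then obtain B where B: "\<And>n. avg n (\<lambda>i. w i x ^ 4) \<le> B" by blast
    show ?case
      by (rule loc.consistency[where y = "\<lambda>i. y i x" and w = "\<lambda>i. w i x" and Q = Q, OF y' B dense])
         (use elim phat in auto)
  qed
  obtain M0 where M0: "info_matrix p p0 \<longlonglongrightarrow> M0" "spd M0" using loc.info_matrix_limit by blast
  \<comment> \<open>\<open>g\<close> is the first-order influence of a sensor at \<open>s\<close> on
    the estimate; scaled by \<open>1 / sqrt n\<close>, its values are the deterministic coefficients
    of the noise in \<open>W\<close>.\<close>
  define g where "g = (\<lambda>s. matrix_inv M0 *v grad_log_dist s p0)"
  define c where "c = (\<lambda>n i. (1 / sqrt (real n)) *\<^sub>R g (p i))"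
  define W where "W = (\<lambda>n x. \<Sum>i=1..n. w i x *\<^sub>R c n i)"
  define Z where "Z = (\<lambda>n x. sqrt (real n) *\<^sub>R (phat n x - p0))"
  have Wm [measurable]: "W n \<in> borel_measurable M" for n
    unfolding W_def by (intro borel_measurable_sum borel_measurable_scaleR w_measurable) auto
  have Zm [measurable]: "Z n \<in> borel_measurable M" for n
    unfolding Z_def using phat_measurable by measurable
  have cont: "continuous_on P (\<lambda>s. g s $ j)" for j
    unfolding g_def matrix_vector_mul_component inner_vec_def by (intro continuous_intros loc.continuous_on_grad)
  have "\<exists>C. \<forall>j. \<forall>s\<in>P. \<bar>g s $ j\<bar> \<le> C j"
    using loc.bounded_continuous[OF cont] by metis
  then obtain C where C: "\<And>j s. s \<in> P \<Longrightarrow> \<bar>g s $ j\<bar> \<le> C j" by blast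
  have W_nth: "(W n x $ j)\<^sup>2 = (1 / real n) * (\<Sum>i=1..n. w i x * g (p i) $ j)\<^sup>2" for n x j
  proof -
    have "W n x $ j = (1 / sqrt (real n)) * (\<Sum>i=1..n. w i x * g (p i) $ j)"
      by (simp add: W_def c_def sum_distrib_left mult_ac)
    then show ?thesis by (simp add: power_mult_distrib power_divide)
  qed
  have norm_W: "(norm (W n x))\<^sup>2 = (\<Sum>j\<in>UNIV. (W n x $ j)\<^sup>2)" for n x
    unfolding power2_norm_eq_inner inner_vec_def by (simp add: power2_eq_square)
  note second = weighted_sum_second_moment[OF C[OF p]]
  have W_int: "integrable M (\<lambda>x. (norm (W n x))\<^sup>2)" for n
    unfolding norm_W W_nth
    by (intro Bochner_Integration.integrable_sum integrable_mult_right second(1))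
  have W_bound: "expectation (\<lambda>x. (norm (W n x))\<^sup>2) \<le> (\<Sum>j\<in>UNIV. 1 + moment 4 * C j ^ 4)" for n
  proof -
    have "expectation (\<lambda>x. (norm (W n x))\<^sup>2) = (\<Sum>j\<in>UNIV. (1 / real n) *
        expectation (\<lambda>x. (\<Sum>i=1..n. w i x * g (p i) $ j)\<^sup>2))"
      unfolding norm_W W_nth
      by (subst Bochner_Integration.integral_sum) (auto intro!: integrable_mult_right second(1) simp del: One_nat_def)
    also have "\<dots> \<le> (\<Sum>j\<in>UNIV. (1 / real n) * (real n * (1 + moment 4 * C j ^ 4)))"
      by (intro sum_mono mult_left_mono second(2)) simp_all
    \<comment> \<open>An inequality because of \<open>n = 0\<close>, where the left side is
      0.\<close>
    also have "\<dots> \<le> (\<Sum>j\<in>UNIV. 1 + moment 4 * C j ^ 4)"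
      using moment_4_nonneg by (intro sum_mono) auto
    finally show ?thesis .
  qed
  have hess: "AE x in M. \<forall>j k. (\<lambda>n. avg n (\<lambda>i. w i x * hess_log_dist (p i) p0 $ j $ k)) \<longlonglongrightarrow> 0"
    unfolding AE_all_countable
  proof (intro allI)
    fix j k
    obtain C' where "\<forall>s\<in>P. \<bar>hess_log_dist s p0 $ j $ k\<bar> \<le> C'"
      using loc.bounded_continuous[OF loc.continuous_on_hess] by blast
    then show "AE x in M. (\<lambda>n. avg n (\<lambda>i. w i x * hess_log_dist (p i) p0 $ j $ k)) \<longlonglongrightarrow> 0"
      using p by (intro weighted_lln) auto
  qed
  have linear: "AE x in M. (\<lambda>n. norm (Z n x - W n x) / (1 + norm (W n x))) \<longlonglongrightarrow> 0"
    using consistent hess fourth_powers_bounded AE_space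
  proof eventually_elim
    case (elim x)
    obtain B where B: "\<And>n. avg n (\<lambda>i. w i x ^ 4) \<le> B" using elim(3) by blast
    show ?case
      unfolding Z_def W_def c_def g_def
      by (rule loc.asymptotic_linearity[where y = "\<lambda>i. y i x" and w = "\<lambda>i. w i x" and phat = "\<lambda>n. phat n x" and B = "1 + B"])
         (use elim y' avg_abs_le[OF B] phat M0 spd_invertible in auto)
  qed
  have close: "(\<lambda>n. prob {x \<in> space M. \<not> norm (Z n x - W n x) \<le> d}) \<longlonglongrightarrow> 0" if "0 < d" for d
    by (rule prob_not_close_tendsto[OF Zm Wm linear W_int W_bound that])
  have cov: "(\<lambda>n. \<Sum>i=1..n. outer_product (s *\<^sub>R c n i)) \<longlonglongrightarrow> s\<^sup>2 *\<^sub>R matrix_inv M0"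
    unfolding c_def g_def using M0(1) unfolding info_matrix_def[abs_def]
    by (intro normal_covariance_limit M0(2))
  \<comment> \<open>The covariance is again a limit of sums of outer products, which supplies its
    symmetry.\<close>
  have "spd (s\<^sup>2 *\<^sub>R matrix_inv M0)"
  proof (rule spd_limit_of_outer_products[OF cov])
    show "0 < x \<bullet> ((s\<^sup>2 *\<^sub>R matrix_inv M0) *v x)" if "x \<noteq> 0" for x
      using spd_matrix_inv_pos[OF M0(2) that] s(1) by (simp add: scaleR_matrix_vector_assoc[symmetric])
  qed
  then have "converges_in_distribution M Z (mv_normal 0 (s\<^sup>2 *\<^sub>R matrix_inv M0))"
    by (intro converges_in_distribution_gaussian_sum[OF cov _ Zm])
       (use close in \<open>auto simp: W_def\<close>)
  then show ?thesis
    using consistent M0 spd_invertible by (auto simp: s(2) Z_def)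
qed

end
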